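(* Let $X,Z,W$ be complex Banach spaces, let $-A$ generate a (not necessarily strongly continuous) bounded analytic semigroup $T(\cdot)$ on $X$, let $B\in\mathcal B(W,X_{-1})$, let $C:X\to Z$ be a closed linear operator which is bounded from $X_1$ to $Z$, and let $F:Z\times Z\to W$ be bilinear with $\|F(y,\tilde y)\|_W\le K\|y\|_Z\|\tilde y\|_Z$ for some $K>0$. Let $\tau\in(0,\infty]$, $p\in(2,\infty]$ and $\alpha\ge 0$ with $\alpha+\frac1p\in(0,\frac12)$. Assume: [A1] the map $x\mapsto CT(\cdot)x$ is bounded $X\to L^p_\alpha((0,\tau),Z)$; [A2] the map $u\mapsto (T_{-1}(\cdot)B)\ast u$, $((T_{-1}(\cdot)B)\ast u)(t)=\int_0^tT_{-1}(t-s)Bu(s)\,ds$, is bounded $L^{p/2}_{2\alpha}((0,\tau),W)\to L^\infty((0,\tau),X)$; [A3] the map $u\mapsto (CT_{-1}(\cdot)B)\ast u$ is bounded $L^{p/2}_{2\alpha}((0,\tau),W)\to L^p_\alpha((0,\tau),Z)$. Then for every $x_0\in X^\flat:=\overline{D(A)}$ (closure in $X$) there exists $\eta\in(0,\tau]$ such that the problem $x'(t)+Ax(t)=Bu(t)$, $x(0)=x_0$, $y(t)=Cx(t)$, $u(t)=F(y(t),y(t))$ $(t>0)$ has a unique mild solution $x\in C([0,\eta),X^\flat)$ with $Cx\in L^p_\alpha((0,\eta),Z)$, i.e. a unique such $x$ satisfying $x(t)=T(t)x_0+\int_0^tT_{-1}(t-s)BF(Cx(s),Cx(s))\,ds$ for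 $t\in[0,\eta)$. Moreover, if $\|x_0\|_X$ is sufficiently small, the solution exists globally (i.e. one may take $\eta=\tau$).
   Context: For a Banach space $E$, $\tau\in(0,\infty]$, $p\in[1,\infty]$ and $\alpha\in\mathbb R$, $L^p_\alpha((0,\tau),E)$ is the space of measurable $f:(0,\tau)\to E$ with $\|f\|_{L^p_\alpha}:=\|t\mapsto t^\alpha f(t)\|_{L^p((0,\tau),E)}<\infty$. $X_1=D(A)$ with norm $\|(I+A)x\|_X$. $X_{-1}$ is the extrapolation space of $A$: a Banach space containing $X$ continuously, together with an extension $A_{-1}$ of $A$ such that $I+A_{-1}:X\to X_{-1}$ is an isometric isomorphism (for densely defined $A$ it is the completion of $X$ for the norm $\|(I+A)^{-1}\cdot\|_X$). $T_{-1}(t):=(I+A_{-1})T(t)(I+A_{-1})^{-1}$ is the extension of the semigroup to $X_{-1}$. *)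

theory Defs
  imports "HOL-Analysis.Analysis" "HOL-Probability.Essential_Supremum"
begin

class cbanach = banach +
  fixes scaleC :: "complex \<Rightarrow> 'a \<Rightarrow> 'a"
  assumes scaleC_add_right: "scaleC a (x + y) = scaleC a x + scaleC a y"
    and scaleC_add_left: "scaleC (a + b) x = scaleC a x + scaleC b x"
    and scaleC_scaleC: "scaleC a (scaleC b x) = scaleC (a * b) x"
    and scaleC_of_real: "scaleC (of_real r) x = r *\<^sub>R x"
    and norm_scaleC: "norm (scaleC a x) = cmod a * norm x"

definition clinear :: "('a::cbanach \<Rightarrow> 'b::cbanach) \<Rightarrow> bool" where
  "clinear f \<longleftrightarrow> (\<forall>x y. f (x + y) = f x + f y) \<and> (\<forall>c x. f (scaleC c x) = scaleC c (f x))"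

definition bounded_clinear :: "('a::cbanach \<Rightarrow> 'b::cbanach) \<Rightarrow> bool" where
  "bounded_clinear f \<longleftrightarrow> clinear f \<and> (\<exists>M. \<forall>x. norm (f x) \<le> M * norm x)"

definition csubspace :: "'a::cbanach set \<Rightarrow> bool" where
  "csubspace S \<longleftrightarrow> 0 \<in> S \<and> (\<forall>x\<in>S. \<forall>y\<in>S. x + y \<in> S) \<and> (\<forall>c. \<forall>x\<in>S. scaleC c x \<in> S)"

text \<open>A linear operator with domain D (a complex subspace); values outside D are irrelevant.\<close>
definition lin_op :: "'a::cbanach set \<Rightarrow> ('a \<Rightarrow> 'b::cbanach) \<Rightarrow> bool" where
  "lin_op D A \<longleftrightarrow> csubspace D \<and> (\<forall>x\<in>D. \<forall>y\<in>D. A (x + y) = A x + A y)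
     \<and> (\<forall>c. \<forall>x\<in>D. A (scaleC c x) = scaleC c (A x))"

definition closed_op :: "'a::cbanach set \<Rightarrow> ('a \<Rightarrow> 'b::cbanach) \<Rightarrow> bool" where
  "closed_op D A \<longleftrightarrow> lin_op D A \<and> closed {(x, A x) | x. x \<in> D}"

definition bounded_cbilinear :: "('a::cbanach \<Rightarrow> 'a \<Rightarrow> 'b::cbanach) \<Rightarrow> real \<Rightarrow> bool" where
  "bounded_cbilinear F K \<longleftrightarrow> (\<forall>y. clinear (F y)) \<and> (\<forall>y. clinear (\<lambda>z. F z y))
     \<and> (\<forall>y z. norm (F y z) \<le> K * norm y * norm z)"

definition sector :: "real \<Rightarrow> complex set" where
  "sector \<theta> = {z. z \<noteq> 0 \<and> \<bar>Arg z\<bar> < \<theta>}"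

definition strongly_holomorphic_on :: "(complex \<Rightarrow> 'a::cbanach \<Rightarrow> 'a) \<Rightarrow> complex set \<Rightarrow> bool" where
  "strongly_holomorphic_on Tc S \<longleftrightarrow>
     (\<forall>x. \<forall>z\<in>S. \<exists>v. ((\<lambda>\<zeta>. Tc \<zeta> x) has_derivative (\<lambda>h. scaleC h v)) (at z))"

definition bounded_analytic_semigroup :: "(real \<Rightarrow> 'a::cbanach \<Rightarrow> 'a) \<Rightarrow> bool" where
  "bounded_analytic_semigroup T \<longleftrightarrow>
     (\<forall>t\<ge>0. bounded_clinear (T t)) \<and> T 0 = id \<and>
     (\<forall>s\<ge>0. \<forall>t\<ge>0. T (s + t) = T s \<circ> T t) \<and>
     (\<exists>\<theta>. 0 < \<theta> \<and> \<theta> \<le> pi / 2 \<and> (\<exists>Tc M.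
        (\<forall>t>0. Tc (complex_of_real t) = T t) \<and>
        (\<forall>z\<in>sector \<theta>. bounded_clinear (Tc z) \<and> (\<forall>x. norm (Tc z x) \<le> M * norm x)) \<and>
        (\<forall>z\<in>sector \<theta>. \<forall>w\<in>sector \<theta>. Tc (z + w) = Tc z \<circ> Tc w) \<and>
        strongly_holomorphic_on Tc (sector \<theta>)))"

text \<open>-A (linear operator with domain DA) generates T in the sense of the
Laplace transform (Arendt-Batty-Hieber-Neubrander): for every \<lambda> > 0,
\<lambda> + A : DA \<rightarrow> X is bijective and its inverse is the Laplace transform of T.\<close>
definition neg_generates :: "'a::cbanach set \<Rightarrow> ('a \<Rightarrow> 'a) \<Rightarrow> (real \<Rightarrow> 'a \<Rightarrow> 'a) \<Rightarrow> bool" where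
  "neg_generates DA A T \<longleftrightarrow> lin_op DA A \<and>
     (\<forall>l::real. l > 0 \<longrightarrow>
        (\<forall>x\<in>DA. l *\<^sub>R x + A x = 0 \<longrightarrow> x = 0) \<and>
        (\<forall>y. \<exists>x\<in>DA. l *\<^sub>R x + A x = y \<and>
              ((\<lambda>t. exp (- l * t) *\<^sub>R T t y) has_integral x) {0..}))"

definition generates_bounded_analytic :: "'a::cbanach set \<Rightarrow> ('a \<Rightarrow> 'a) \<Rightarrow> (real \<Rightarrow> 'a \<Rightarrow> 'a) \<Rightarrow> bool" where
  "generates_bounded_analytic DA A T \<longleftrightarrow> bounded_analytic_semigroup T \<and> neg_generates DA A T"

text \<open>X_{-1} is modelled by a complex Banach space 'y, a continuous injective
linear map J : X \<rightarrow> X_{-1} (the inclusion) and the restriction Am1 : X \<rightarrow> X_{-1}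
of the extension A_{-1} of A, such that Am1 x = J (A x) on D(A) and
I + A_{-1} = J + Am1 : X \<rightarrow> X_{-1} is an isometric isomorphism.\<close>
definition extrapolation_space ::
  "'a::cbanach set \<Rightarrow> ('a \<Rightarrow> 'a) \<Rightarrow> ('a \<Rightarrow> 'y::cbanach) \<Rightarrow> ('a \<Rightarrow> 'y) \<Rightarrow> bool" where
  "extrapolation_space DA A J Am1 \<longleftrightarrow>
     bounded_clinear J \<and> inj J \<and> clinear Am1 \<and>
     (\<forall>x\<in>DA. Am1 x = J (A x)) \<and>
     surj (\<lambda>x. J x + Am1 x) \<and> (\<forall>x. norm (J x + Am1 x) = norm x)"

definition extrap_sg :: "('a::cbanach \<Rightarrow> 'y::cbanach) \<Rightarrow> ('a \<Rightarrow> 'y) \<Rightarrow> (real \<Rightarrow> 'a \<Rightarrow> 'a) \<Rightarrow> real \<Rightarrow> 'y \<Rightarrow> 'y" where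
  "extrap_sg J Am1 T t y = (let E = (\<lambda>x. J x + Am1 x) in E (T t (inv E y)))"

definition ival :: "ereal \<Rightarrow> real set" where
  "ival \<tau> = {t. 0 < t \<and> ereal t < \<tau>}"

definition rival :: "ereal \<Rightarrow> real set" where
  "rival \<tau> = {t. 0 \<le> t \<and> ereal t < \<tau>}"

definition strongly_measurable_on :: "real set \<Rightarrow> (real \<Rightarrow> 'a::real_normed_vector) \<Rightarrow> bool" where
  "strongly_measurable_on S f \<longleftrightarrow>
     (\<exists>s :: nat \<Rightarrow> real \<Rightarrow> 'a. (\<forall>n. s n \<in> borel_measurable (restrict_space lebesgue S) \<and> finite (range (s n)))
        \<and> (AE t in lebesgue. t \<in> S \<longrightarrow> (\<lambda>n. s n t) \<longlonglongrightarrow> f t))"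

text \<open>Bochner integrability on S (the value of the integral is then the
Henstock-Kurzweil integral, which coincides with the Bochner integral).\<close>
definition bochner_integrable_on :: "(real \<Rightarrow> 'a::real_normed_vector) \<Rightarrow> real set \<Rightarrow> bool" where
  "bochner_integrable_on f S \<longleftrightarrow> strongly_measurable_on S f \<and>
     (\<integral>\<^sup>+ t. indicator S t * ennreal (norm (f t)) \<partial>lebesgue) < \<infinity>"

definition Lpw_norm :: "ereal \<Rightarrow> real \<Rightarrow> ereal \<Rightarrow> (real \<Rightarrow> 'a::real_normed_vector) \<Rightarrow> ereal" where
  "Lpw_norm p \<alpha> \<tau> f =
     (if p = \<infinity> then esssup (restrict_space lebesgue (ival \<tau>)) (\<lambda>t. ereal (t powr \<alpha> * norm (f t)))
      else (let I = (\<integral>\<^sup>+ t. indicator (ival \<tau>) t * ennreal ((t powr \<alpha> * norm (f t)) powr real_of_ereal p) \<partial>lebesgue)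
            in if I = \<infinity> then \<infinity> else ereal (enn2real I powr (1 / real_of_ereal p))))"

definition in_Lpw :: "ereal \<Rightarrow> real \<Rightarrow> ereal \<Rightarrow> (real \<Rightarrow> 'a::real_normed_vector) \<Rightarrow> bool" where
  "in_Lpw p \<alpha> \<tau> f \<longleftrightarrow> strongly_measurable_on (ival \<tau>) f \<and> Lpw_norm p \<alpha> \<tau> f < \<infinity>"

definition mild_solution ::
  "'x::cbanach set \<Rightarrow> (real \<Rightarrow> 'x \<Rightarrow> 'x) \<Rightarrow> ('x \<Rightarrow> 'y::cbanach) \<Rightarrow> ('x \<Rightarrow> 'y) \<Rightarrow>
   ('w::cbanach \<Rightarrow> 'y) \<Rightarrow> 'x set \<Rightarrow> ('x \<Rightarrow> 'z::cbanach) \<Rightarrow> ('z \<Rightarrow> 'z \<Rightarrow> 'w) \<Rightarrow>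
   ereal \<Rightarrow> real \<Rightarrow> 'x \<Rightarrow> ereal \<Rightarrow> (real \<Rightarrow> 'x) \<Rightarrow> bool" where
  "mild_solution DA T J Am1 B DC C F p \<alpha> x0 \<eta> x \<longleftrightarrow>
     continuous_on (rival \<eta>) x \<and> (\<forall>t\<in>rival \<eta>. x t \<in> closure DA) \<and>
     (AE s in lebesgue. s \<in> ival \<eta> \<longrightarrow> x s \<in> DC) \<and>
     in_Lpw p \<alpha> \<eta> (\<lambda>s. C (x s)) \<and>
     (\<forall>t\<in>rival \<eta>.
        bochner_integrable_on (\<lambda>s. extrap_sg J Am1 T (t - s) (B (F (C (x s)) (C (x s))))) {0..t} \<and>
        ((\<lambda>s. extrap_sg J Am1 T (t - s) (B (F (C (x s)) (C (x s))))) has_integral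
            (J (x t) - J (T t x0))) {0..t})"

end

theory Submission
  imports Defs
begin

text \<open>Identifying the extrapolation space with X through the isometry $I + A_{-1}$ turns the inclusion of X
  into the resolvent $R = (I + A)^{-1}$, so that only the bounded operators R, $T(t)$ and
  $S(t) = (I + A)T(t)$ on X occur. The output $y = Cx$ solves the fixed point equation
  $y = CT(\cdot)x_0 + (CT_{-1}B) * F(y, y)$, whose right-hand side contracts a small ball of
  $L^p_\alpha$ by [A1], [A3] and Hoelder's inequality; [A1] and density of $D(A)$ make $CT(\cdot)x_0$ small
  on short intervals. [A2], applied on short time intervals, shows that the convolution is continuous
  with values in X, and C is applied to it by closedness. Translating the weight to the left decreases
  the norm, so two solutions that agree up to some time agree a little longer; for infinite p this fails at time 0,
  where the solution is compared with the small ones restarted at positive times.\<close>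

section \<open>Strong measurability and Bochner integrability\<close>

text \<open>The equation is solved for the output y rather than for the state x, because C is
  unbounded and the nonlinearity sees x only through Cx; x is then rebuilt from the input F(y, y).
  What shapes the proof is that [A2] and [A3] speak of almost every time, with a null set that
  depends on the input: at a given time the convolution need not at first have a value in X, and a
  continuous representative has to be assembled from countably many restarts. The operators S(t) are
  available only for t > 0, so integrals with kernel C S(t - s) are cut off before s = t and C is
  recovered by closedness. Since T need not be strongly continuous, limits at time 0 are taken on
  the closure of D(A). The two sides of the condition on \<alpha> + 1/p have different tasks:
  positivity makes bounded functions small in L^p_\<alpha> on short intervals, and the bound 1/2
  gives 2\<alpha> + 2/p < 1, hence local integrability of the inputs in L^(p/2)_(2\<alpha>).\<close>

lemma strongly_measurable_on_iff_simple:
  fixes f :: "real \<Rightarrow> 'a::real_normed_vector"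
  assumes S: "S \<in> sets lebesgue"
  shows "strongly_measurable_on S f \<longleftrightarrow>
    (\<exists>s. (\<forall>n::nat. simple_function lebesgue (s n)) \<and>
         (AE t in lebesgue. t \<in> S \<longrightarrow> (\<lambda>n. s n t) \<longlonglongrightarrow> f t))"
proof
  assume "strongly_measurable_on S f"
  then obtain s :: "nat \<Rightarrow> real \<Rightarrow> 'a" where
    s: "\<And>n. s n \<in> borel_measurable (restrict_space lebesgue S)" "\<And>n. finite (range (s n))"
    and lim: "AE t in lebesgue. t \<in> S \<longrightarrow> (\<lambda>n. s n t) \<longlonglongrightarrow> f t"
    unfolding strongly_measurable_on_def by blast
  have "simple_function lebesgue (\<lambda>t. if t \<in> S then s n t else 0)" for n
  proof (rule simple_function_borel_measurable)
    show "(\<lambda>t. if t \<in> S then s n t else 0) \<in> borel_measurable lebesgue"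
      using measurable_restrict_space_iff[of S lebesgue 0 borel "s n"] s S by simp
    show "finite ((\<lambda>t. if t \<in> S then s n t else 0) ` space lebesgue)"
      by (rule finite_subset[of _ "insert 0 (range (s n))"]) (use s(2) in auto)
  qed
  moreover have "AE t in lebesgue. t \<in> S \<longrightarrow> (\<lambda>n. if t \<in> S then s n t else 0) \<longlonglongrightarrow> f t"
    using lim by eventually_elim auto
  ultimately show "\<exists>s. (\<forall>n::nat. simple_function lebesgue (s n)) \<and>
         (AE t in lebesgue. t \<in> S \<longrightarrow> (\<lambda>n. s n t) \<longlonglongrightarrow> f t)"
    by (intro exI[of _ "\<lambda>n t. if t \<in> S then s n t else 0"]) auto
next
  assume "\<exists>s. (\<forall>n::nat. simple_function lebesgue (s n)) \<and>
         (AE t in lebesgue. t \<in> S \<longrightarrow> (\<lambda>n. s n t) \<longlonglongrightarrow> f t)"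
  then obtain s where s: "\<And>n::nat. simple_function lebesgue (s n)"
    and lim: "AE t in lebesgue. t \<in> S \<longrightarrow> (\<lambda>n. s n t) \<longlonglongrightarrow> f t" by blast
  show "strongly_measurable_on S f"
    unfolding strongly_measurable_on_def
    using simple_functionD(1)[OF s] borel_measurable_simple_function[OF s] lim
    by (intro exI[of _ s]) (auto intro: measurable_restrict_space1)
qed

lemma strongly_measurable_on_simple_obtain:
  fixes f :: "real \<Rightarrow> 'a::real_normed_vector"
  assumes "S \<in> sets lebesgue" "strongly_measurable_on S f"
  obtains s where "\<And>n::nat. simple_function lebesgue (s n)"
    "AE t in lebesgue. t \<in> S \<longrightarrow> (\<lambda>n. s n t) \<longlonglongrightarrow> f t"
  using assms strongly_measurable_on_iff_simple by blast

lemma strongly_measurable_on_mono_AE: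
  fixes f g :: "real \<Rightarrow> 'a::real_normed_vector"
  assumes "S \<in> sets lebesgue" "S' \<in> sets lebesgue" "strongly_measurable_on S f"
    "AE t in lebesgue. t \<in> S' \<longrightarrow> t \<in> S \<and> g t = f t"
  shows "strongly_measurable_on S' g"
proof -
  obtain s where s: "\<And>n::nat. simple_function lebesgue (s n)"
    and lim: "AE t in lebesgue. t \<in> S \<longrightarrow> (\<lambda>n. s n t) \<longlonglongrightarrow> f t"
    using strongly_measurable_on_simple_obtain assms(1,3) by blast
  have "AE t in lebesgue. t \<in> S' \<longrightarrow> (\<lambda>n. s n t) \<longlonglongrightarrow> g t"
    using lim assms(4) by eventually_elim auto
  then show ?thesis
    unfolding strongly_measurable_on_iff_simple[OF assms(2)] using s by blast
qed

lemma strongly_measurable_on_if_0: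
  fixes f :: "real \<Rightarrow> 'a::real_normed_vector"
  assumes "S \<in> sets lebesgue" "S' \<in> sets lebesgue" "strongly_measurable_on S f"
  shows "strongly_measurable_on S' (\<lambda>t. if t \<in> S then f t else 0)"
proof -
  obtain s where s: "\<And>n::nat. simple_function lebesgue (s n)"
    and lim: "AE t in lebesgue. t \<in> S \<longrightarrow> (\<lambda>n. s n t) \<longlonglongrightarrow> f t"
    using strongly_measurable_on_simple_obtain assms(1,3) by blast
  have 1: "simple_function lebesgue (\<lambda>t. if t \<in> S then s n t else 0)" for n
    by (rule simple_function_If_set[OF s]) (use assms in auto)
  have "AE t in lebesgue. t \<in> S' \<longrightarrow>
     (\<lambda>n. if t \<in> S then s n t else 0) \<longlonglongrightarrow> (if t \<in> S then f t else 0)"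
    using lim by eventually_elim auto
  then show ?thesis
    unfolding strongly_measurable_on_iff_simple[OF assms(2)]
    by (intro exI[of _ "\<lambda>n t. if t \<in> S then s n t else 0"]) (use 1 in auto)
qed

lemma strongly_measurable_on_compose2:
  fixes f :: "real \<Rightarrow> 'a::real_normed_vector" and g :: "real \<Rightarrow> 'b::real_normed_vector"
    and h :: "'a \<Rightarrow> 'b \<Rightarrow> 'c::real_normed_vector"
  assumes "S \<in> sets lebesgue" "strongly_measurable_on S f" "strongly_measurable_on S g"
    and h: "continuous_on UNIV (\<lambda>(x, y). h x y)"
  shows "strongly_measurable_on S (\<lambda>t. h (f t) (g t))"
proof -
  obtain s where s: "\<And>n::nat. simple_function lebesgue (s n)"
    and lim: "AE t in lebesgue. t \<in> S \<longrightarrow> (\<lambda>n. s n t) \<longlonglongrightarrow> f t"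
    using strongly_measurable_on_simple_obtain assms(1,2) by blast
  obtain r where r: "\<And>n::nat. simple_function lebesgue (r n)"
    and limr: "AE t in lebesgue. t \<in> S \<longrightarrow> (\<lambda>n. r n t) \<longlonglongrightarrow> g t"
    using strongly_measurable_on_simple_obtain assms(1,3) by blast
  have *: "(\<lambda>n. h (x n) (y n)) \<longlonglongrightarrow> h a b" if "x \<longlonglongrightarrow> a" "y \<longlonglongrightarrow> b" for x y a b
    using continuous_on_tendsto_compose[OF h tendsto_Pair[OF that]] by simp
  have "AE t in lebesgue. t \<in> S \<longrightarrow> (\<lambda>n. h (s n t) (r n t)) \<longlonglongrightarrow> h (f t) (g t)"
    using lim limr by eventually_elim (auto intro: *)
  then show ?thesis
    unfolding strongly_measurable_on_iff_simple[OF assms(1)]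
    by (intro exI[of _ "\<lambda>n t. h (s n t) (r n t)"]) (auto intro: simple_function_compose2 s r)
qed

lemma strongly_measurable_on_compose:
  fixes f :: "real \<Rightarrow> 'a::real_normed_vector" and h :: "'a \<Rightarrow> 'c::real_normed_vector"
  assumes "S \<in> sets lebesgue" "strongly_measurable_on S f" and h: "continuous_on UNIV h"
  shows "strongly_measurable_on S (\<lambda>t. h (f t))"
proof (rule strongly_measurable_on_compose2[OF assms(1,2,2), of "\<lambda>x y. h x"])
  show "continuous_on UNIV (\<lambda>(x, y::'a). h x)"
    unfolding case_prod_beta by (intro continuous_on_compose2[OF h] continuous_intros) auto
qed

lemmas strongly_measurable_on_add =
    strongly_measurable_on_compose2[where h="\<lambda>x y. x + y", unfolded case_prod_beta,
      OF _ _ _ continuous_on_add[OF continuous_on_fst continuous_on_snd], simplified]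
  and strongly_measurable_on_diff =
    strongly_measurable_on_compose2[where h="\<lambda>x y. x - y", unfolded case_prod_beta,
      OF _ _ _ continuous_on_diff[OF continuous_on_fst continuous_on_snd], simplified]

section \<open>Translation of the argument\<close>

lemma simple_function_affine:
  assumes "simple_function lebesgue s"
  shows "simple_function lebesgue (\<lambda>t::real. s (a + t))"
proof -
  have m: "(\<lambda>t::real. a + t) \<in> lebesgue \<rightarrow>\<^sub>M lebesgue"
    using lebesgue_affine_measurable[of "\<lambda>_. 1::real" a] by simp
  show ?thesis
    unfolding simple_function_eq_measurable
    using measurable_compose[OF m measurable_simple_function[OF assms]] simple_functionD(1)[OF assms]
    by (auto elim: finite_subset[rotated])
qed

lemma AE_lebesgue_translation:
  assumes "AE t in lebesgue. P t"
  shows "AE t in lebesgue. P (a + t :: real)"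
proof -
  have "AE t in lborel. P t" using assms AE_completion_iff by blast
  then obtain N where N: "N \<in> null_sets lborel" "{t. \<not> P t} \<subseteq> N"
    by (auto elim!: AE_E simp: null_sets_def)
  have "{x. x - (- a) \<in> N} \<in> null_sets lborel" using null_sets_translation[OF N(1)] .
  then have "AE t in lborel. t \<notin> {x. x - (- a) \<in> N}" by (rule AE_not_in)
  then have "AE t in lborel. P (a + t)"
    using N(2) by (auto simp: add.commute elim!: eventually_mono)
  then show ?thesis using AE_completion by blast
qed

lemma strongly_measurable_on_translation:
  fixes f :: "real \<Rightarrow> 'a::real_normed_vector"
  assumes "S \<in> sets lebesgue" "S' \<in> sets lebesgue" "strongly_measurable_on S f"
    "\<And>t. t \<in> S' \<Longrightarrow> a + t \<in> S"
  shows "strongly_measurable_on S' (\<lambda>t. f (a + t))"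
proof -
  obtain s where s: "\<And>n::nat. simple_function lebesgue (s n)"
    and lim: "AE t in lebesgue. t \<in> S \<longrightarrow> (\<lambda>n. s n t) \<longlonglongrightarrow> f t"
    using strongly_measurable_on_simple_obtain assms(1,3) by blast
  have "AE t in lebesgue. t \<in> S' \<longrightarrow> (\<lambda>n. s n (a + t)) \<longlonglongrightarrow> f (a + t)"
    using AE_lebesgue_translation[OF lim, of a] by eventually_elim (use assms(4) in auto)
  then show ?thesis
    unfolding strongly_measurable_on_iff_simple[OF assms(2)]
    by (intro exI[of _ "\<lambda>n t. s n (a + t)"]) (auto intro: simple_function_affine s)
qed

lemma borel_measurable_norm_if:
  fixes f :: "real \<Rightarrow> 'a::real_normed_vector"
  assumes "S \<in> sets lebesgue" "strongly_measurable_on S f"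
  shows "(\<lambda>t. if t \<in> S then norm (f t) else 0) \<in> borel_measurable lebesgue"
proof -
  obtain s where s: "\<And>n::nat. simple_function lebesgue (s n)"
    and lim: "AE t in lebesgue. t \<in> S \<longrightarrow> (\<lambda>n. s n t) \<longlonglongrightarrow> f t"
    using strongly_measurable_on_simple_obtain assms by blast
  \<comment> \<open>The convergence set is only known to be conull; completeness of Lebesgue measure
    makes it measurable, so that cutting off outside it gives convergence everywhere instead of
    almost everywhere.\<close>
  define G where "G = {t. t \<in> S \<longrightarrow> (\<lambda>n. s n t) \<longlonglongrightarrow> f t}"
  have "- G \<in> null_sets lebesgue"
    using lim completion.AE_iff_null_sets[of _ lborel] by (auto simp: G_def Collect_neg_eq)
  then have nG: "- G \<in> null_sets lebesgue" and G: "G \<in> sets lebesgue"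
    by (auto simp: null_sets_def Compl_in_sets_lebesgue)
  have meas: "(\<lambda>t. if t \<in> S \<inter> G then norm (s n t) else 0) \<in> borel_measurable lebesgue" for n
  proof -
    have "simple_function lebesgue (\<lambda>t. norm (s n t))" by (rule simple_function_compose1[OF s])
    then have "(\<lambda>t. norm (s n t)) \<in> borel_measurable lebesgue"
      by (rule borel_measurable_simple_function)
    then show ?thesis by (intro measurable_If_set) (use G assms in auto)
  qed
  have "(\<lambda>t. if t \<in> S \<inter> G then norm (f t) else 0) \<in> borel_measurable lebesgue"
  proof (rule borel_measurable_LIMSEQ_metric[OF meas])
    fix t :: real
    show "(\<lambda>n. if t \<in> S \<inter> G then norm (s n t) else 0) \<longlonglongrightarrow> (if t \<in> S \<inter> G then norm (f t) else 0)"
      by (auto simp: G_def intro: tendsto_norm)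
  qed
  moreover have "AE t in lebesgue. (if t \<in> S \<inter> G then norm (f t) else 0) = (if t \<in> S then norm (f t) else 0)"
    using AE_not_in[OF nG] by eventually_elim auto
  ultimately show ?thesis
    by (rule borel_measurable_AE)
qed

text \<open>Almost every value of the limit lies in the closure of the countable set of values of the
  approximating simple functions, so its best approximations by the first n of them converge.\<close>

lemma strongly_measurable_on_LIMSEQ:
  fixes f :: "nat \<Rightarrow> real \<Rightarrow> 'a::real_normed_vector"
  assumes S: "S \<in> sets lebesgue" and f: "\<And>n. strongly_measurable_on S (f n)"
    and lim: "AE t in lebesgue. t \<in> S \<longrightarrow> (\<lambda>n. f n t) \<longlonglongrightarrow> g t"
  shows "strongly_measurable_on S g"
proof -
  have "\<exists>s. (\<forall>k::nat. simple_function lebesgue (s k)) \<and>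
         (AE t in lebesgue. t \<in> S \<longrightarrow> (\<lambda>k. s k t) \<longlonglongrightarrow> f n t)" for n
    using f strongly_measurable_on_iff_simple[OF S] by blast
  then obtain s where s: "\<And>n k. simple_function lebesgue (s n (k::nat))"
    and lims: "\<And>n. AE t in lebesgue. t \<in> S \<longrightarrow> (\<lambda>k. s n k t) \<longlonglongrightarrow> f n t"
    by metis
  define G where "G = {t. t \<in> S \<longrightarrow> (\<lambda>n. f n t) \<longlonglongrightarrow> g t \<and> (\<forall>n. (\<lambda>k. s n k t) \<longlonglongrightarrow> f n t)}"
  have "AE t in lebesgue. \<forall>n. t \<in> S \<longrightarrow> (\<lambda>k. s n k t) \<longlonglongrightarrow> f n t"
    unfolding AE_all_countable using lims by blast
  then have AEG: "AE t in lebesgue. t \<in> G"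
    using lim by eventually_elim (auto simp: G_def)
  then have "- G \<in> null_sets lebesgue"
    using completion.AE_iff_null_sets[of "\<lambda>t. t \<in> G" lborel] by (simp add: Compl_eq)
  then have G: "G \<in> sets lebesgue" by (auto simp: null_sets_def Compl_in_sets_lebesgue)
  define g' where "g' t = (if t \<in> S \<inter> G then g t else 0)" for t
  have lim_if: "(\<lambda>k. if P then x k else 0) \<longlonglongrightarrow> (if P then y else 0)"
    if "P \<Longrightarrow> x \<longlonglongrightarrow> y" for P x and y :: 'a using that by (cases P) auto
  have f': "(\<lambda>t. if t \<in> S \<inter> G then f n t else 0) \<in> borel_measurable lebesgue" for n
  proof (rule borel_measurable_LIMSEQ_metric)
    show "(\<lambda>t. if t \<in> S \<inter> G then s n k t else 0) \<in> borel_measurable lebesgue" for k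
      by (intro measurable_If_set borel_measurable_simple_function s) (use G S in auto)
    show "(\<lambda>k. if t \<in> S \<inter> G then s n k t else 0) \<longlonglongrightarrow> (if t \<in> S \<inter> G then f n t else 0)" for t
      by (rule lim_if) (auto simp: G_def)
  qed
  have g': "g' \<in> borel_measurable lebesgue"
  proof (rule borel_measurable_LIMSEQ_metric[OF f'])
    show "(\<lambda>n. if t \<in> S \<inter> G then f n t else 0) \<longlonglongrightarrow> g' t" for t
      unfolding g'_def by (rule lim_if) (auto simp: G_def)
  qed
  \<comment> \<open>The value 0 is added because \<open>g'\<close> takes it outside the convergence
    set; it also keeps \<open>D\<close> nonempty, as an enumeration requires.\<close>
  define D where "D = insert 0 (\<Union>n k. range (s n k))"
  have "countable (range (s n k))" for n k
    by (rule countable_finite) (use simple_functionD(1)[OF s[of n k]] in simp)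
  then have D: "countable D" "D \<noteq> {}" unfolding D_def by auto
  define e where "e = from_nat_into D"
  have re: "range e = D" unfolding e_def by (rule range_from_nat_into[OF D(2,1)])
  have g'D: "g' t \<in> closure D" for t
  proof (cases "t \<in> S \<inter> G")
    case True
    then have l: "(\<lambda>n. f n t) \<longlonglongrightarrow> g t" "\<And>n. (\<lambda>k. s n k t) \<longlonglongrightarrow> f n t" by (auto simp: G_def)
    have "f n t \<in> closure D" for n
      unfolding closure_sequential by (rule exI[of _ "\<lambda>k. s n k t"]) (use l(2) in \<open>fastforce simp: D_def\<close>)
    then have "g t \<in> closure D"
      using closed_sequentially[OF closed_closure, of "\<lambda>n. f n t" D] l(1) by blast
    then show ?thesis using True by (simp add: g'_def)
  next
    case False
    then show ?thesis using closure_subset[of D] by (auto simp: g'_def D_def)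
  qed
  define best where "best n t k \<longleftrightarrow> k \<le> n \<and> (\<forall>j\<le>n. dist (e k) (g' t) \<le> dist (e j) (g' t))" for n t k
  \<comment> \<open>Ties between equally good approximations are broken by the least index, which
    makes the choice a measurable function of \<open>t\<close> with values at most
    \<open>n\<close>.\<close>
  define K where "K n t = (LEAST k. best n t k)" for n t
  have best: "best n t (K n t)" for n t
  proof -
    have "finite ((\<lambda>j. dist (e j) (g' t)) ` {..n})" by simp
    then have "Min ((\<lambda>j. dist (e j) (g' t)) ` {..n}) \<in> (\<lambda>j. dist (e j) (g' t)) ` {..n}"
      by (rule Min_in) auto
    then obtain k where "k \<le> n" "dist (e k) (g' t) = Min ((\<lambda>j. dist (e j) (g' t)) ` {..n})"
      by (metis (no_types, lifting) imageE atMost_iff)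
    then have "best n t k" unfolding best_def by auto
    then show ?thesis unfolding K_def by (rule LeastI)
  qed
  have [measurable]: "(\<lambda>t. dist (e k) (g' t)) \<in> borel_measurable lebesgue" for k
  proof -
    have "(\<lambda>x. dist (e k) x) \<in> borel_measurable borel"
      by (intro borel_measurable_continuous_onI continuous_intros)
    from measurable_compose[OF g' this] show ?thesis .
  qed
  have Km: "K n \<in> lebesgue \<rightarrow>\<^sub>M count_space UNIV" for n
    unfolding K_def best_def by measurable
  have "K n ` space lebesgue \<subseteq> {..n}" for n using best by (auto simp: best_def)
  then have "simple_function lebesgue (K n)" for n
    unfolding simple_function_eq_measurable using Km finite_subset by blast
  then have 1: "simple_function lebesgue (\<lambda>t. e (K n t))" for n by (rule simple_function_compose1)
  have 2: "(\<lambda>n. e (K n t)) \<longlonglongrightarrow> g' t" for t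
  proof (rule metric_LIMSEQ_I)
    fix \<epsilon> :: real assume "\<epsilon> > 0"
    then obtain y where "y \<in> D" "dist y (g' t) < \<epsilon>"
      using g'D[of t] closure_approachable by blast
    then obtain j where j: "dist (e j) (g' t) < \<epsilon>" using re by blast
    show "\<exists>N. \<forall>n\<ge>N. dist (e (K n t)) (g' t) < \<epsilon>"
    proof (intro exI[of _ j] allI impI)
      fix n assume "n \<ge> j"
      then show "dist (e (K n t)) (g' t) < \<epsilon>" using best[of n t] j by (force simp: best_def)
    qed
  qed
  have "AE t in lebesgue. t \<in> S \<longrightarrow> (\<lambda>n. e (K n t)) \<longlonglongrightarrow> g t"
    using AEG
  proof eventually_elim
    case (elim t)
    then show ?case using 2[of t] by (auto simp: g'_def)
  qed
  then show ?thesis unfolding strongly_measurable_on_iff_simple[OF S]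
    by (intro exI[of _ "\<lambda>n t. e (K n t)"]) (use 1 in auto)
qed

text \<open>Riemann sums of the error f - g are dominated by those of its norm.\<close>

lemma integrable_on_L1_approx:
  fixes f :: "real \<Rightarrow> 'a::banach"
  assumes approx: "\<And>e. e > 0 \<Longrightarrow> \<exists>g r I. g integrable_on {a..b} \<and> (r has_integral I) {a..b} \<and> I < e \<and>
     (\<forall>x\<in>{a..b}. norm (f x - g x) \<le> r x)"
  shows "f integrable_on {a..b}"
proof -
  have "\<exists>\<gamma>. gauge \<gamma> \<and>
          (\<forall>\<D>1 \<D>2. \<D>1 tagged_division_of (cbox a b) \<and> \<gamma> fine \<D>1 \<and>
            \<D>2 tagged_division_of (cbox a b) \<and> \<gamma> fine \<D>2 \<longrightarrow>
            norm ((\<Sum>(x,K)\<in>\<D>1. Henstock_Kurzweil_Integration.content K *\<^sub>R f x) - (\<Sum>(x,K)\<in>\<D>2. Henstock_Kurzweil_Integration.content K *\<^sub>R f x)) < e)"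
    if e: "e > 0" for e :: real
  proof -
    \<comment> \<open>One sixth from the integral of \<open>r\<close> and one sixth from its Riemann
      sum give a third for each passage between \<open>f\<close> and \<open>g\<close>; the last
      third is the Cauchy criterion for \<open>g\<close>.\<close>
    obtain g r I where g: "g integrable_on {a..b}" and r: "(r has_integral I) {a..b}" and I: "I < e/6"
      and fg: "\<And>x. x \<in> {a..b} \<Longrightarrow> norm (f x - g x) \<le> r x"
      using approx[of "e/6"] e by auto
    from g have "g integrable_on cbox a b" by simp
    then obtain \<gamma>1 where g1: "gauge \<gamma>1" and
      G1: "\<And>\<D>1 \<D>2. \<D>1 tagged_division_of (cbox a b) \<Longrightarrow> \<gamma>1 fine \<D>1 \<Longrightarrow>
            \<D>2 tagged_division_of (cbox a b) \<Longrightarrow> \<gamma>1 fine \<D>2 \<Longrightarrow>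
            norm ((\<Sum>(x,K)\<in>\<D>1. Henstock_Kurzweil_Integration.content K *\<^sub>R g x) - (\<Sum>(x,K)\<in>\<D>2. Henstock_Kurzweil_Integration.content K *\<^sub>R g x)) < e/3"
      unfolding integrable_Cauchy using e
      by (metis divide_pos_pos zero_less_numeral)
    from r have "(r has_integral I) (cbox a b)" by simp
    then obtain \<gamma>2 where g2: "gauge \<gamma>2" and
      G2: "\<And>\<D>. \<D> tagged_division_of (cbox a b) \<Longrightarrow> \<gamma>2 fine \<D> \<Longrightarrow>
            norm ((\<Sum>(x,K)\<in>\<D>. Henstock_Kurzweil_Integration.content K *\<^sub>R r x) - I) < e/6"
      unfolding has_integral using e
      by (metis divide_pos_pos zero_less_numeral)
    have est: "norm ((\<Sum>(x,K)\<in>\<D>. Henstock_Kurzweil_Integration.content K *\<^sub>R f x) - (\<Sum>(x,K)\<in>\<D>. Henstock_Kurzweil_Integration.content K *\<^sub>R g x)) < e/3"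
      if D: "\<D> tagged_division_of (cbox a b)" "\<gamma>2 fine \<D>" for \<D>
    proof -
      have "norm ((\<Sum>(x,K)\<in>\<D>. Henstock_Kurzweil_Integration.content K *\<^sub>R f x) - (\<Sum>(x,K)\<in>\<D>. Henstock_Kurzweil_Integration.content K *\<^sub>R g x))
          = norm (\<Sum>(x,K)\<in>\<D>. Henstock_Kurzweil_Integration.content K *\<^sub>R (f x - g x))"
        by (simp add: sum_subtractf[symmetric] scaleR_diff_right case_prod_beta)
      also have "\<dots> \<le> (\<Sum>(x,K)\<in>\<D>. Henstock_Kurzweil_Integration.content K *\<^sub>R r x)"
      proof (rule sum_norm_le)
        fix p assume p: "p \<in> \<D>"
        obtain x K where [simp]: "p = (x, K)" by fastforce
        have "x \<in> {a..b}" using tagged_division_ofD(2,3)[OF D(1), of x K] p by auto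
        then show "norm (case p of (x, K) \<Rightarrow> Henstock_Kurzweil_Integration.content K *\<^sub>R (f x - g x)) \<le> (case p of (x, K) \<Rightarrow> Henstock_Kurzweil_Integration.content K *\<^sub>R r x)"
          using fg by (auto intro!: mult_left_mono)
      qed
      also have "\<dots> < I + e/6" using G2[OF D] by (simp only: real_norm_def abs_less_iff) linarith
      finally show ?thesis using I by simp
    qed
    show ?thesis
    proof (intro exI[of _ "\<lambda>x. \<gamma>1 x \<inter> \<gamma>2 x"] conjI allI impI)
      show "gauge (\<lambda>x. \<gamma>1 x \<inter> \<gamma>2 x)" using g1 g2 by (rule gauge_Int)
      fix \<D>1 \<D>2 assume D: "\<D>1 tagged_division_of (cbox a b) \<and> (\<lambda>x. \<gamma>1 x \<inter> \<gamma>2 x) fine \<D>1 \<and>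
            \<D>2 tagged_division_of (cbox a b) \<and> (\<lambda>x. \<gamma>1 x \<inter> \<gamma>2 x) fine \<D>2"
      define sf where "sf h \<D> = (\<Sum>(x,K)\<in>\<D>. Henstock_Kurzweil_Integration.content K *\<^sub>R h x)" for h :: "real \<Rightarrow> 'a" and \<D> :: "(real \<times> real set) set"
      have 1: "norm (sf f \<D>1 - sf g \<D>1) < e/3" "norm (sf f \<D>2 - sf g \<D>2) < e/3"
        using est[of \<D>1] est[of \<D>2] D by (auto simp: fine_Int sf_def)
      have 2: "norm (sf g \<D>1 - sf g \<D>2) < e/3"
        using G1[of \<D>1 \<D>2] D by (auto simp: fine_Int sf_def)
      have "sf f \<D>1 - sf f \<D>2 = (sf f \<D>1 - sf g \<D>1) + (sf g \<D>1 - sf g \<D>2) - (sf f \<D>2 - sf g \<D>2)"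
        by simp
      also have "norm \<dots> \<le> norm (sf f \<D>1 - sf g \<D>1) + norm (sf g \<D>1 - sf g \<D>2) + norm (sf f \<D>2 - sf g \<D>2)"
        by (meson norm_triangle_ineq4 norm_triangle_ineq order_trans add_right_mono)
      finally show "norm ((\<Sum>(x,K)\<in>\<D>1. Henstock_Kurzweil_Integration.content K *\<^sub>R f x) - (\<Sum>(x,K)\<in>\<D>2. Henstock_Kurzweil_Integration.content K *\<^sub>R f x)) < e"
        using 1 2 by (simp add: sf_def)
    qed
  qed
  then show ?thesis unfolding box_real(2)[symmetric] integrable_Cauchy by blast
qed

text \<open>Supplies the existence of the gauge integrals that define the convolutions. Truncated
  simple functions approximate \<open>f\<close> in the mean by dominated convergence for the real
  function \<open>norm (f t - g n t)\<close>; vector-valued integration then enters only for simple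
  functions and through the approximation criterion above.\<close>

lemma bochner_integrable_on_imp_integrable_on:
  fixes f :: "real \<Rightarrow> 'a::banach"
  assumes "bochner_integrable_on f {a..b}"
  shows "f integrable_on {a..b}"
proof -
  let ?S = "{a..b}"
  have S: "?S \<in> sets lebesgue" by simp
  have sm: "strongly_measurable_on ?S f"
    and fin: "(\<integral>\<^sup>+ t. indicator ?S t * ennreal (norm (f t)) \<partial>lebesgue) < \<infinity>"
    using assms by (auto simp: bochner_integrable_on_def)
  obtain s where s: "\<And>n::nat. simple_function lebesgue (s n)"
    and lim: "AE t in lebesgue. t \<in> ?S \<longrightarrow> (\<lambda>n. s n t) \<longlonglongrightarrow> f t"
    using strongly_measurable_on_simple_obtain[OF S sm] by blast
  define nf where "nf t = (if t \<in> ?S then norm (f t) else 0)" for t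
  have nfm[measurable]: "nf \<in> borel_measurable lebesgue"
    unfolding nf_def by (rule borel_measurable_norm_if[OF S sm])
  have "(\<integral>\<^sup>+ t. ennreal (norm (nf t)) \<partial>lebesgue) = (\<integral>\<^sup>+ t. indicator ?S t * ennreal (norm (f t)) \<partial>lebesgue)"
    by (intro nn_integral_cong) (auto simp: nf_def indicator_def)
  then have nfi: "integrable lebesgue nf" using fin by (intro integrableI_bounded) auto
  \<comment> \<open>The truncation bounds the error by \<open>3 * nf t\<close>. The factor 2 leaves
    room: where \<open>f t\<close> is nonzero, the approximations eventually have norm below
    \<open>2 * norm (f t)\<close> and are kept; where it vanishes, \<open>g n t\<close> is
    0.\<close>
  define g where "g n t = (if t \<in> ?S \<and> norm (s n t) \<le> 2 * nf t then s n t else 0)" for n t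
  have gs: "simple_function lebesgue (g n)" for n
  proof -
    have "simple_function lebesgue (\<lambda>t. norm (s n t))" by (rule simple_function_compose1[OF s])
    then have [measurable]: "(\<lambda>t. norm (s n t)) \<in> borel_measurable lebesgue"
      by (rule borel_measurable_simple_function)
    have "{t \<in> space lebesgue. norm (s n t) \<le> 2 * nf t} \<in> sets lebesgue"
      by (rule borel_measurable_le) measurable
    then have "?S \<inter> {t \<in> space lebesgue. norm (s n t) \<le> 2 * nf t} \<in> sets lebesgue"
      using S by blast
    also have "?S \<inter> {t \<in> space lebesgue. norm (s n t) \<le> 2 * nf t} =
      {t \<in> space lebesgue. t \<in> ?S \<and> norm (s n t) \<le> 2 * nf t}" by auto
    finally have "{t \<in> space lebesgue. t \<in> ?S \<and> norm (s n t) \<le> 2 * nf t} \<in> sets lebesgue" .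
    then show ?thesis unfolding g_def by (intro simple_function_If s) auto
  qed
  have gsm: "strongly_measurable_on ?S (g n)" for n
    unfolding strongly_measurable_on_iff_simple[OF S] by (intro exI[of _ "\<lambda>_. g n"]) (use gs in auto)
  define r where "r n t = (if t \<in> ?S then norm (f t - g n t) else 0)" for n t
  have rm: "r n \<in> borel_measurable lebesgue" for n
    unfolding r_def by (intro borel_measurable_norm_if S strongly_measurable_on_diff sm gsm)
  have rb: "norm (r n t) \<le> 3 * nf t" for n t
    using norm_triangle_ineq4[of "f t" "g n t"] by (auto simp: r_def nf_def g_def)
  have rlim: "AE t in lebesgue. (\<lambda>n. r n t) \<longlonglongrightarrow> 0"
    using lim
  proof eventually_elim
    case (elim t)
    show ?case
    proof (cases "t \<in> ?S")
      case True
      then have st: "(\<lambda>n. s n t) \<longlonglongrightarrow> f t" using elim by auto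
      have "(\<lambda>n. g n t) \<longlonglongrightarrow> f t"
      proof (cases "f t = 0")
        case True
        then have "g n t = 0" for n by (auto simp: g_def nf_def)
        then show ?thesis using True by simp
      next
        case False
        have "(\<lambda>n. norm (s n t)) \<longlonglongrightarrow> norm (f t)" using st by (rule tendsto_norm)
        then have "eventually (\<lambda>n. norm (s n t) < 2 * norm (f t)) sequentially"
          using False by (intro order_tendstoD) auto
        then have "eventually (\<lambda>n. g n t = s n t) sequentially"
          by eventually_elim (use \<open>t \<in> ?S\<close> in \<open>auto simp: g_def nf_def\<close>)
        then show ?thesis using st by (simp add: tendsto_cong)
      qed
      then have "(\<lambda>n. norm (f t - g n t)) \<longlonglongrightarrow> norm (f t - f t)" by (intro tendsto_intros)
      then show ?thesis using True by (simp add: r_def)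
    next
      case False
      then have "r n t = 0" for n by (auto simp: r_def)
      then show ?thesis by simp
    qed
  qed
  have ri: "integrable lebesgue (r n)" for n
  proof (rule Bochner_Integration.integrable_bound[OF _ rm])
    show "integrable lebesgue (\<lambda>t. 3 * nf t)" using nfi by simp
    show "AE x in lebesgue. norm (r n x) \<le> norm (3 * nf x)"
      by (intro AE_I2 order_trans[OF rb]) simp
  qed
  have "(\<lambda>n. integral\<^sup>L lebesgue (r n)) \<longlonglongrightarrow> integral\<^sup>L lebesgue (\<lambda>t :: real. 0 :: real)"
    by (rule integral_dominated_convergence[where w="\<lambda>t. 3 * nf t"])
       (use rm rb rlim nfi in auto)
  then have I0: "(\<lambda>n. integral\<^sup>L lebesgue (r n)) \<longlonglongrightarrow> 0" by simp
  have rhas: "(r n has_integral integral\<^sup>L lebesgue (r n)) ?S" for n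
  proof -
    have "(r n has_integral integral\<^sup>L lebesgue (r n)) UNIV"
      using ri[of n] by (rule has_integral_integral_lebesgue)
    moreover have "r n = (\<lambda>t. if t \<in> ?S then r n t else 0)" by (auto simp: r_def)
    ultimately show ?thesis using has_integral_restrict_UNIV[of ?S "r n"] by metis
  qed
  have gint: "g n integrable_on ?S" for n
  proof -
    have fr: "finite (range (g n))" using simple_functionD(1)[OF gs[of n]] by simp
    have eq: "g n t = (\<Sum>v\<in>range (g n). indicator (g n -` {v} \<inter> ?S) t *\<^sub>R v)" if "t \<in> ?S" for t
    proof -
      have "(\<Sum>v\<in>range (g n). indicator (g n -` {v} \<inter> ?S) t *\<^sub>R v)
          = (\<Sum>v\<in>range (g n). if v = g n t then v else 0)"
        using that by (intro sum.cong) (auto simp: indicator_def)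
      then show ?thesis using fr by simp
    qed
    have "(\<lambda>t. \<Sum>v\<in>range (g n). indicator (g n -` {v} \<inter> ?S) t *\<^sub>R v) integrable_on ?S"
    proof (intro integrable_sum fr)
      fix v assume "v \<in> range (g n)"
      have "g n -` {v} \<in> sets lebesgue" using simple_functionD(2)[OF gs[of n], of "{v}"] by simp
      then have "g n -` {v} \<inter> ?S \<in> lmeasurable"
        by (subst Int_commute) (intro fmeasurable_Int_fmeasurable, auto)
      then have "(indicator (g n -` {v} \<inter> ?S) :: real \<Rightarrow> real) integrable_on UNIV"
        using lmeasurable_iff_indicator_has_integral[of "g n -` {v} \<inter> ?S"] by (simp only: integrable_on_def) blast
      then have "(indicator (g n -` {v} \<inter> ?S) :: real \<Rightarrow> real) integrable_on ?S"
        by (rule integrable_on_subinterval) simp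
      from integrable_linear[OF this bounded_linear_scaleR_left[of v]]
      show "(\<lambda>t. indicator (g n -` {v} \<inter> ?S) t *\<^sub>R v) integrable_on ?S" by (simp add: o_def)
    qed
    then show ?thesis by (rule integrable_eq) (rule eq[symmetric])
  qed
  show ?thesis
  proof (rule integrable_on_L1_approx)
    fix e :: real assume "e > 0"
    then obtain n where "integral\<^sup>L lebesgue (r n) < e"
      using order_tendstoD(2)[OF I0] eventually_happens' sequentially_bot by metis
    then show "\<exists>g r I. g integrable_on ?S \<and> (r has_integral I) ?S \<and> I < e \<and> (\<forall>x\<in>?S. norm (f x - g x) \<le> r x)"
      using gint rhas by (intro exI[of _ "g n"] exI[of _ "r n"]) (auto simp: r_def)
  qed
qed

section \<open>Weighted Lebesgue norms\<close>

text \<open>Bounds by a real constant replace arithmetic with the extended real norm, and one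
  predicate serves finite and infinite exponents. Nonnegativity of \<open>c\<close> is demanded
  because an essential supremum over an empty interval is -\<infinity>; measurability is bundled
  because the integral in \<open>Lpw_norm\<close> is defined without it.\<close>

definition Lpw_le :: "ereal \<Rightarrow> real \<Rightarrow> ereal \<Rightarrow> real \<Rightarrow> (real \<Rightarrow> 'a::real_normed_vector) \<Rightarrow> bool" where
  "Lpw_le p \<alpha> \<eta> c f \<longleftrightarrow> strongly_measurable_on (ival \<eta>) f \<and> 0 \<le> c \<and> Lpw_norm p \<alpha> \<eta> f \<le> ereal c"

lemma ival_sets [simp, intro]: "ival \<eta> \<in> sets lebesgue"
proof -
  have "ival \<eta> = {0<..} \<inter> {t. ereal t < \<eta>}" by (auto simp: ival_def)
  moreover have "open {t. ereal t < \<eta>}"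
    by (intro open_Collect_less continuous_intros) 
  ultimately show ?thesis by (metis borel_open open_Int open_greaterThan lborelD sets_completionI_sets)
qed

lemma Lpw_leD: "Lpw_le p \<alpha> \<eta> c f \<Longrightarrow> strongly_measurable_on (ival \<eta>) f" "Lpw_le p \<alpha> \<eta> c f \<Longrightarrow> 0 \<le> c"
  by (auto simp: Lpw_le_def)

lemma borel_measurable_lebesgue_powr [measurable]:
  "(\<lambda>t. t powr \<alpha>) \<in> borel_measurable lebesgue" for \<alpha> :: real
  by (intro measurable_completion) measurable

lemma Lpw_weight_measurable:
  assumes "strongly_measurable_on (ival \<eta>) f"
  shows "(\<lambda>t. if t \<in> ival \<eta> then t powr \<alpha> * norm (f t) else 0) \<in> borel_measurable lebesgue"
proof -
  note [measurable] = borel_measurable_norm_if[OF ival_sets assms]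
  have "(\<lambda>t. t powr \<alpha> * (if t \<in> ival \<eta> then norm (f t) else 0)) \<in> borel_measurable lebesgue"
    by measurable
  also have "(\<lambda>t. t powr \<alpha> * (if t \<in> ival \<eta> then norm (f t) else 0)) =
    (\<lambda>t. if t \<in> ival \<eta> then t powr \<alpha> * norm (f t) else 0)" by auto
  finally show ?thesis .
qed

lemma Lpw_integrand_measurable:
  assumes "strongly_measurable_on (ival \<eta>) f"
  shows "(\<lambda>t. indicator (ival \<eta>) t * ennreal ((t powr \<alpha> * norm (f t)) powr q)) \<in> borel_measurable lebesgue"
proof -
  note [measurable] = Lpw_weight_measurable[OF assms, of \<alpha>]
  have "(\<lambda>t. indicator (ival \<eta>) t * ennreal ((if t \<in> ival \<eta> then t powr \<alpha> * norm (f t) else 0) powr q)) \<in> borel_measurable lebesgue"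
    by (intro borel_measurable_times_ennreal borel_measurable_indicator) auto
  also have "(\<lambda>t. indicator (ival \<eta>) t * ennreal ((if t \<in> ival \<eta> then t powr \<alpha> * norm (f t) else 0) powr q)) =
      (\<lambda>t. indicator (ival \<eta>) t * ennreal ((t powr \<alpha> * norm (f t)) powr q))"
    by (auto simp: indicator_def fun_eq_iff)
  finally show ?thesis .
qed

lemma Lpw_le_infinity:
  "Lpw_le \<infinity> \<alpha> \<eta> c f \<longleftrightarrow> strongly_measurable_on (ival \<eta>) f \<and> 0 \<le> c \<and>
     (AE t in lebesgue. t \<in> ival \<eta> \<longrightarrow> t powr \<alpha> * norm (f t) \<le> c)"
proof (cases "strongly_measurable_on (ival \<eta>) f")
  case True
  let ?M = "restrict_space lebesgue (ival \<eta>)" and ?g = "\<lambda>t. ereal (t powr \<alpha> * norm (f t))"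
  have "(\<lambda>t. t powr \<alpha> * norm (f t)) \<in> borel_measurable ?M"
    using Lpw_weight_measurable[OF True, of \<alpha>]
      measurable_restrict_space_iff[of "ival \<eta>" lebesgue 0 borel "\<lambda>t. t powr \<alpha> * norm (f t)"] by simp
  then have m: "?g \<in> borel_measurable ?M" by simp
  have "esssup ?M ?g \<le> ereal c \<longleftrightarrow> (AE t in ?M. ?g t \<le> ereal c)"
  proof
    assume "esssup ?M ?g \<le> ereal c"
    then show "AE t in ?M. ?g t \<le> ereal c"
      using esssup_AE[of ?g ?M] by (auto elim!: eventually_mono intro: order_trans simp del: ereal_less_eq)
  qed (rule esssup_I[OF m])
  also have "\<dots> \<longleftrightarrow> (AE t in lebesgue. t \<in> ival \<eta> \<longrightarrow> t powr \<alpha> * norm (f t) \<le> c)"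
    by (subst AE_restrict_space_iff) auto
  finally show ?thesis using True by (simp add: Lpw_le_def Lpw_norm_def)
qed (simp add: Lpw_le_def)

lemma Lpw_le_real:
  assumes q: "0 < q"
  shows "Lpw_le (ereal q) \<alpha> \<eta> c f \<longleftrightarrow> strongly_measurable_on (ival \<eta>) f \<and> 0 \<le> c \<and>
     (\<integral>\<^sup>+ t. indicator (ival \<eta>) t * ennreal ((t powr \<alpha> * norm (f t)) powr q) \<partial>lebesgue) \<le> ennreal (c powr q)"
proof -
  define I where "I = (\<integral>\<^sup>+ t. indicator (ival \<eta>) t * ennreal ((t powr \<alpha> * norm (f t)) powr q) \<partial>lebesgue)"
  have "Lpw_norm (ereal q) \<alpha> \<eta> f \<le> ereal c \<longleftrightarrow> I \<le> ennreal (c powr q)" if c: "0 \<le> c"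
  proof (cases I)
    case (real r)
    have "Lpw_norm (ereal q) \<alpha> \<eta> f = ereal (r powr (1 / q))"
      using real by (simp add: Lpw_norm_def I_def[symmetric])
    moreover have "r powr (1 / q) \<le> c \<longleftrightarrow> r \<le> c powr q"
    proof
      assume "r powr (1 / q) \<le> c"
      then have "(r powr (1 / q)) powr q \<le> c powr q" using q by (intro powr_mono2) auto
      then show "r \<le> c powr q" using q real by (simp add: powr_powr)
    next
      assume "r \<le> c powr q"
      then have "r powr (1 / q) \<le> (c powr q) powr (1 / q)" using q real by (intro powr_mono2) auto
      then show "r powr (1 / q) \<le> c" using q c by (simp add: powr_powr)
    qed
    ultimately show ?thesis using real by (simp add: ennreal_le_iff)
  next
    case top
    then show ?thesis by (simp add: Lpw_norm_def I_def[symmetric] top_unique)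
  qed
  then show ?thesis by (auto simp: Lpw_le_def I_def)
qed

lemma Lpw_exponent_cases:
  assumes "0 < p"
  obtains "p = \<infinity>" | q where "p = ereal q" "0 < q"
  using assms by (cases p) auto

lemma Lpw_le_mono_AE:
  assumes p: "0 < p" and g: "Lpw_le p \<alpha> \<eta> c g" and f: "strongly_measurable_on (ival \<eta>) f" and k: "0 \<le> k"
    and fg: "AE t in lebesgue. t \<in> ival \<eta> \<longrightarrow> norm (f t) \<le> k * norm (g t)"
  shows "Lpw_le p \<alpha> \<eta> (k * c) f"
  using p
proof (cases rule: Lpw_exponent_cases)
  case 1
  have "AE t in lebesgue. t \<in> ival \<eta> \<longrightarrow> t powr \<alpha> * norm (g t) \<le> c"
    using g 1 by (simp add: Lpw_le_infinity)
  then have "AE t in lebesgue. t \<in> ival \<eta> \<longrightarrow> t powr \<alpha> * norm (f t) \<le> k * c"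
    using fg
  proof eventually_elim
    case (elim t)
    show ?case
    proof
      assume t: "t \<in> ival \<eta>"
      have "t powr \<alpha> * norm (f t) \<le> t powr \<alpha> * (k * norm (g t))"
        using elim t by (intro mult_left_mono) auto
      also have "\<dots> = k * (t powr \<alpha> * norm (g t))" by simp
      also have "\<dots> \<le> k * c" using elim t k by (intro mult_left_mono) auto
      finally show "t powr \<alpha> * norm (f t) \<le> k * c" .
    qed
  qed
  then show ?thesis using g f k 1 by (simp add: Lpw_le_infinity)
next
  case (2 q)
  have gI: "(\<integral>\<^sup>+ t. indicator (ival \<eta>) t * ennreal ((t powr \<alpha> * norm (g t)) powr q) \<partial>lebesgue) \<le> ennreal (c powr q)"
    and c: "0 \<le> c" and gm: "strongly_measurable_on (ival \<eta>) g"
    using g 2 by (auto simp: Lpw_le_real)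
  have "(\<integral>\<^sup>+ t. indicator (ival \<eta>) t * ennreal ((t powr \<alpha> * norm (f t)) powr q) \<partial>lebesgue)
    \<le> (\<integral>\<^sup>+ t. ennreal (k powr q) * (indicator (ival \<eta>) t * ennreal ((t powr \<alpha> * norm (g t)) powr q)) \<partial>lebesgue)"
  proof (rule nn_integral_mono_AE)
    show "AE t in lebesgue. indicator (ival \<eta>) t * ennreal ((t powr \<alpha> * norm (f t)) powr q)
      \<le> ennreal (k powr q) * (indicator (ival \<eta>) t * ennreal ((t powr \<alpha> * norm (g t)) powr q))"
      using fg
    proof eventually_elim
      case (elim t)
      have "(t powr \<alpha> * norm (f t)) powr q \<le> k powr q * (t powr \<alpha> * norm (g t)) powr q" if t: "t \<in> ival \<eta>"
      proof -
        have "t powr \<alpha> * norm (f t) \<le> t powr \<alpha> * (k * norm (g t))"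
          using elim t by (intro mult_left_mono) auto
        then have "(t powr \<alpha> * norm (f t)) powr q \<le> (k * (t powr \<alpha> * norm (g t))) powr q"
          using 2 by (intro powr_mono2) (auto simp: algebra_simps)
        also have "\<dots> = k powr q * (t powr \<alpha> * norm (g t)) powr q" using k by (simp add: powr_mult)
        finally show ?thesis .
      qed
      then show ?case by (auto simp: indicator_def ennreal_mult'[symmetric])
    qed
  qed
  also have "\<dots> = ennreal (k powr q) * (\<integral>\<^sup>+ t. indicator (ival \<eta>) t * ennreal ((t powr \<alpha> * norm (g t)) powr q) \<partial>lebesgue)"
    by (intro nn_integral_cmult Lpw_integrand_measurable gm)
  also have "\<dots> \<le> ennreal (k powr q) * ennreal (c powr q)" by (intro mult_left_mono gI) auto
  also have "\<dots> = ennreal ((k * c) powr q)" using k c by (simp add: powr_mult ennreal_mult)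
  finally show ?thesis using f k c 2 by (simp add: Lpw_le_real)
qed

lemma Lpw_le_weaken: "Lpw_le p \<alpha> \<eta> c f \<Longrightarrow> c \<le> d \<Longrightarrow> Lpw_le p \<alpha> \<eta> d f"
  unfolding Lpw_le_def by (metis ereal_less_eq(3) order_trans)

lemma Lpw_le_cong_AE:
  assumes "0 < p" "Lpw_le p \<alpha> \<eta> c g" "AE t in lebesgue. t \<in> ival \<eta> \<longrightarrow> f t = g t"
  shows "Lpw_le p \<alpha> \<eta> c f"
proof -
  have "strongly_measurable_on (ival \<eta>) f"
    by (rule strongly_measurable_on_mono_AE[OF _ _ Lpw_leD(1)[OF assms(2)]])
       (use assms(3) in auto)
  moreover have "AE t in lebesgue. t \<in> ival \<eta> \<longrightarrow> norm (f t) \<le> 1 * norm (g t)"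
    using assms(3) by eventually_elim auto
  ultimately show ?thesis using Lpw_le_mono_AE[OF assms(1,2), of f 1] by simp
qed

text \<open>Allows a bound to be enlarged by a small amount and the excess to be removed at the end:
  for Minkowski's inequality with a zero bound, for attaining the infimum of all bounds, and for
  showing that a distance is zero.\<close>

lemma Lpw_le_closed:
  assumes "\<And>e. e > 0 \<Longrightarrow> Lpw_le p \<alpha> \<eta> (c + e) f" and "0 \<le> c"
  shows "Lpw_le p \<alpha> \<eta> c f"
proof -
  have "Lpw_norm p \<alpha> \<eta> f \<le> ereal c"
    by (rule ereal_le_epsilon2) (use assms in \<open>auto simp: Lpw_le_def\<close>)
  then show ?thesis using assms(1)[of 1] assms(2) by (simp add: Lpw_le_def)
qed

text \<open>For positive arguments this is convexity of the power; if an argument is 0, it reduces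
  to m^q \<le> m for m in [0, 1].\<close>

lemma powr_convex_nonneg:
  fixes x y l q :: real
  assumes q: "1 \<le> q" and "0 \<le> x" "0 \<le> y" "0 \<le> l" "l \<le> 1"
  shows "(l * x + (1 - l) * y) powr q \<le> l * x powr q + (1 - l) * y powr q"
proof -
  have *: "(m * z) powr q \<le> m * z powr q" if "0 \<le> m" "m \<le> 1" "0 \<le> z" for m z :: real
  proof -
    have "m powr q \<le> m"
    proof (cases "m = 0")
      case False
      then show ?thesis using that q powr_mono'[of 1 q m] by simp
    qed simp
    then show ?thesis using that by (simp add: powr_mult mult_right_mono)
  qed
  show ?thesis
  proof (cases "x = 0 \<or> y = 0")
    case True
    then show ?thesis using *[of l x] *[of "1 - l" y] assms by auto
  next
    case False
    then have "x \<in> {0<..}" "y \<in> {0<..}" using assms by auto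
    then show ?thesis
      using powr_convex[OF q, unfolded convex_on_def] assms by auto
  qed
qed

text \<open>Minkowski's inequality from convexity: for pointwise values a and b, the quotient (a +
  b) / (c + d) is the convex combination of a / c and b / d with weights c / (c + d) and d / (c +
  d), and the q-th powers of a / c and b / d have integral at most 1.\<close>

lemma Lpw_le_add:
  assumes p: "1 \<le> p" and f: "Lpw_le p \<alpha> \<eta> c f" and g: "Lpw_le p \<alpha> \<eta> d g"
  shows "Lpw_le p \<alpha> \<eta> (c + d) (\<lambda>t. f t + g t)"
proof -
  have p0: "0 < p" using p by (cases p) auto
  have sm: "strongly_measurable_on (ival \<eta>) (\<lambda>t. f t + g t)"
    using strongly_measurable_on_add[OF ival_sets] Lpw_leD f g by blast
  from p0 show ?thesis
  proof (cases rule: Lpw_exponent_cases)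
    case 1
    have "AE t in lebesgue. t \<in> ival \<eta> \<longrightarrow> t powr \<alpha> * norm (f t) \<le> c"
      "AE t in lebesgue. t \<in> ival \<eta> \<longrightarrow> t powr \<alpha> * norm (g t) \<le> d"
      using f g 1 by (auto simp add: Lpw_le_infinity)
    then have "AE t in lebesgue. t \<in> ival \<eta> \<longrightarrow> t powr \<alpha> * norm (f t + g t) \<le> c + d"
    proof eventually_elim
      case (elim t)
      have "t powr \<alpha> * norm (f t + g t) \<le> t powr \<alpha> * (norm (f t) + norm (g t))"
        by (intro mult_left_mono norm_triangle_ineq) auto
      with elim show ?case by (auto simp: algebra_simps)
    qed
    then show ?thesis using sm Lpw_leD(2)[OF f] Lpw_leD(2)[OF g] 1 by (simp add: Lpw_le_infinity)
  next
    case (2 q)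
    have q: "1 \<le> q" using p 2 by simp
    have main: "Lpw_le p \<alpha> \<eta> (c + d) (\<lambda>t. f t + g t)"
      if f: "Lpw_le p \<alpha> \<eta> c f" and g: "Lpw_le p \<alpha> \<eta> d g" and c: "0 < c" and d: "0 < d" for c d
    proof -
      let ?F = "\<lambda>t. indicator (ival \<eta>) t * ennreal ((t powr \<alpha> * norm (f t)) powr q)"
      let ?G = "\<lambda>t. indicator (ival \<eta>) t * ennreal ((t powr \<alpha> * norm (g t)) powr q)"
      define l where "l = c / (c + d)"
      have l: "0 \<le> l" "l \<le> 1" "1 - l = d / (c + d)" using c d by (auto simp: l_def field_simps)
      define k where "k = (c + d) powr q * l * c powr (- q)"
      define k' where "k' = (c + d) powr q * (1 - l) * d powr (- q)"
      have kk: "0 \<le> k" "0 \<le> k'" using l(1,2) by (auto simp: k_def k'_def)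
      have ptw: "(t powr \<alpha> * norm (f t + g t)) powr q
         \<le> k * (t powr \<alpha> * norm (f t)) powr q + k' * (t powr \<alpha> * norm (g t)) powr q" for t
      proof -
        define a b where "a = t powr \<alpha> * norm (f t)" and "b = t powr \<alpha> * norm (g t)"
        have ab: "0 \<le> a" "0 \<le> b" by (auto simp: a_def b_def)
        have "t powr \<alpha> * norm (f t + g t) \<le> a + b"
          unfolding a_def b_def distrib_left[symmetric] by (intro mult_left_mono norm_triangle_ineq) auto
        then have "(t powr \<alpha> * norm (f t + g t)) powr q \<le> (a + b) powr q"
          using q by (intro powr_mono2) auto
        also have "a + b = (c + d) * (l * (a / c) + (1 - l) * (b / d))"
        proof -
          have "(c + d) * l = c" "(c + d) * (1 - l) = d" using c d l(3) by (auto simp: l_def)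
          then have "(c + d) * (l * (a / c) + (1 - l) * (b / d)) = c * (a / c) + d * (b / d)"
            by (metis distrib_left mult.assoc)
          then show ?thesis using c d by simp
        qed
        also have "\<dots> powr q = (c + d) powr q * (l * (a / c) + (1 - l) * (b / d)) powr q"
          by (rule powr_mult)
        also have "\<dots> \<le> (c + d) powr q * (l * (a / c) powr q + (1 - l) * (b / d) powr q)"
          using c d l ab q by (intro mult_left_mono powr_convex_nonneg) auto
        also have "\<dots> = k * a powr q + k' * b powr q"
        proof -
          have "(x / y) powr q = x powr q * y powr (- q)" for x y :: real
            by (simp add: powr_divide powr_minus_divide)
          then show ?thesis unfolding k_def k'_def by (simp only:) (simp only: algebra_simps)
        qed
        finally show ?thesis by (simp add: a_def b_def)
      qed
      have FG: "?F \<in> borel_measurable lebesgue" "?G \<in> borel_measurable lebesgue"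
        using Lpw_integrand_measurable Lpw_leD(1) f g by blast+
      have "(\<integral>\<^sup>+ t. indicator (ival \<eta>) t * ennreal ((t powr \<alpha> * norm (f t + g t)) powr q) \<partial>lebesgue)
        \<le> (\<integral>\<^sup>+ t. ennreal k * ?F t + ennreal k' * ?G t \<partial>lebesgue)"
      proof (rule nn_integral_mono)
        fix t
        have "ennreal ((t powr \<alpha> * norm (f t + g t)) powr q)
            \<le> ennreal k * ennreal ((t powr \<alpha> * norm (f t)) powr q) + ennreal k' * ennreal ((t powr \<alpha> * norm (g t)) powr q)"
          using ptw[of t] kk by (simp add: ennreal_mult'[symmetric] ennreal_plus[symmetric] ennreal_leI del: ennreal_plus)
        then show "indicator (ival \<eta>) t * ennreal ((t powr \<alpha> * norm (f t + g t)) powr q) \<le> ennreal k * ?F t + ennreal k' * ?G t"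
          by (auto simp: indicator_def)
      qed
      also have "\<dots> = ennreal k * integral\<^sup>N lebesgue ?F + ennreal k' * integral\<^sup>N lebesgue ?G"
        using FG by (simp add: nn_integral_add nn_integral_cmult)
      also have "\<dots> \<le> ennreal k * ennreal (c powr q) + ennreal k' * ennreal (d powr q)"
        using f g 2 by (intro add_mono mult_left_mono) (auto simp: Lpw_le_real)
      also have "\<dots> = ennreal (k * c powr q + k' * d powr q)"
        using kk by (simp add: ennreal_mult' ennreal_plus)
      also have "k * c powr q + k' * d powr q = (c + d) powr q"
        using c d by (simp add: k_def k'_def powr_minus field_simps)
      finally show ?thesis using 2 sm c d by (simp add: Lpw_le_real)
    qed
    show ?thesis
    proof (rule Lpw_le_closed)
      fix e :: real assume "e > 0"
      \<comment> \<open>The convexity argument divides by both bounds; enlarging each by e/2 makes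
        them positive.\<close>
      then have "Lpw_le p \<alpha> \<eta> ((c + e/2) + (d + e/2)) (\<lambda>t. f t + g t)"
        using Lpw_leD(2)[OF f] Lpw_leD(2)[OF g] by (intro main Lpw_le_weaken[OF f] Lpw_le_weaken[OF g]) auto
      then show "Lpw_le p \<alpha> \<eta> (c + d + e) (\<lambda>t. f t + g t)" by (simp add: algebra_simps)
    qed (use Lpw_leD(2)[OF f] Lpw_leD(2)[OF g] in auto)
  qed
qed

lemma Lpw_le_minus:
  assumes "0 < p" "Lpw_le p \<alpha> \<eta> c f"
  shows "Lpw_le p \<alpha> \<eta> c (\<lambda>t. - f t)"
proof -
  have "strongly_measurable_on (ival \<eta>) (\<lambda>t. - f t)"
    by (intro strongly_measurable_on_compose[OF _ Lpw_leD(1)[OF assms(2)]] continuous_intros) auto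
  then show ?thesis using Lpw_le_mono_AE[OF assms, of "\<lambda>t. - f t" 1] by simp
qed

lemma Lpw_le_diff:
  assumes "1 \<le> p" "Lpw_le p \<alpha> \<eta> c f" "Lpw_le p \<alpha> \<eta> d g"
  shows "Lpw_le p \<alpha> \<eta> (c + d) (\<lambda>t. f t - g t)"
proof -
  have "0 < p" using assms(1) by (cases p) auto
  then show ?thesis using Lpw_le_add[OF assms(1,2) Lpw_le_minus[OF _ assms(3)]] by simp
qed

lemma Lpw_le_0D:
  assumes p: "0 < p" and "Lpw_le p \<alpha> \<eta> 0 f"
  shows "AE t in lebesgue. t \<in> ival \<eta> \<longrightarrow> f t = 0"
  using p
proof (cases rule: Lpw_exponent_cases)
  case 1
  then have "AE t in lebesgue. t \<in> ival \<eta> \<longrightarrow> t powr \<alpha> * norm (f t) \<le> 0"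
    using assms by (simp add: Lpw_le_infinity)
  then show ?thesis
    by eventually_elim (auto simp: ival_def mult_le_0_iff)
next
  case (2 q)
  have "(\<integral>\<^sup>+ t. indicator (ival \<eta>) t * ennreal ((t powr \<alpha> * norm (f t)) powr q) \<partial>lebesgue) = 0"
    using assms 2 by (simp add: Lpw_le_real)
  then have "AE t in lebesgue. indicator (ival \<eta>) t * ennreal ((t powr \<alpha> * norm (f t)) powr q) = 0"
    using nn_integral_0_iff_AE[OF Lpw_integrand_measurable[OF Lpw_leD(1)[OF assms(2)]]] by blast
  then show ?thesis
    by eventually_elim (auto simp: ival_def indicator_def)
qed

lemma Lpw_le_zero: "0 < p \<Longrightarrow> Lpw_le p \<alpha> \<eta> 0 (\<lambda>t. 0)"
proof -
  assume p: "0 < p"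
  have sm: "strongly_measurable_on (ival \<eta>) (\<lambda>t. 0)"
    unfolding strongly_measurable_on_iff_simple[OF ival_sets] by (intro exI[of _ "\<lambda>n t. 0"]) auto
  from p show ?thesis
    by (cases rule: Lpw_exponent_cases) (use sm in \<open>auto simp: Lpw_le_infinity Lpw_le_real\<close>)
qed

lemma Lpw_le_Fatou:
  assumes p: "0 < p" and f: "\<And>n::nat. Lpw_le p \<alpha> \<eta> c (f n)"
    and lim: "AE t in lebesgue. t \<in> ival \<eta> \<longrightarrow> (\<lambda>n. f n t) \<longlonglongrightarrow> g t"
  shows "Lpw_le p \<alpha> \<eta> c g"
proof -
  have sm: "strongly_measurable_on (ival \<eta>) g"
    using strongly_measurable_on_LIMSEQ[OF ival_sets Lpw_leD(1)[OF f] lim] .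
  from p show ?thesis
  proof (cases rule: Lpw_exponent_cases)
    case 1
    have "AE t in lebesgue. \<forall>n. t \<in> ival \<eta> \<longrightarrow> t powr \<alpha> * norm (f n t) \<le> c"
      unfolding AE_all_countable using f 1 by (simp add: Lpw_le_infinity)
    then have "AE t in lebesgue. t \<in> ival \<eta> \<longrightarrow> t powr \<alpha> * norm (g t) \<le> c"
      using lim
    proof eventually_elim
      case (elim t)
      show ?case
      proof
        assume t: "t \<in> ival \<eta>"
        have "(\<lambda>n. t powr \<alpha> * norm (f n t)) \<longlonglongrightarrow> t powr \<alpha> * norm (g t)"
          using elim t by (intro tendsto_intros) auto
        then show "t powr \<alpha> * norm (g t) \<le> c"
          by (rule LIMSEQ_le_const2) (use elim t in auto)
      qed
    qed
    then show ?thesis using sm Lpw_leD(2)[OF f] 1 by (simp add: Lpw_le_infinity)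
  next
    case (2 q)
    let ?I = "\<lambda>h t. indicator (ival \<eta>) t * ennreal ((t powr \<alpha> * norm (h t)) powr q)"
    have "integral\<^sup>N lebesgue (?I g) = (\<integral>\<^sup>+ t. liminf (\<lambda>n. ?I (f n) t) \<partial>lebesgue)"
    proof (rule nn_integral_cong_AE)
      show "AE t in lebesgue. ?I g t = liminf (\<lambda>n. ?I (f n) t)"
        using lim
      proof eventually_elim
        case (elim t)
        show ?case
        proof (cases "t \<in> ival \<eta>")
          case True
          have "(\<lambda>n. (t powr \<alpha> * norm (f n t)) powr q) \<longlonglongrightarrow> (t powr \<alpha> * norm (g t)) powr q"
            using elim True 2 by (intro tendsto_powr' tendsto_intros) auto
          then have "(\<lambda>n. ennreal ((t powr \<alpha> * norm (f n t)) powr q)) \<longlonglongrightarrow> ennreal ((t powr \<alpha> * norm (g t)) powr q)"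
            by (rule tendsto_ennrealI)
          then have "liminf (\<lambda>n. ennreal ((t powr \<alpha> * norm (f n t)) powr q)) = ennreal ((t powr \<alpha> * norm (g t)) powr q)"
            by (intro lim_imp_Liminf) auto
          then show ?thesis using True by simp
        next
          case False
          have "liminf (\<lambda>n::nat. 0 :: ennreal) = 0" by (intro lim_imp_Liminf) auto
          then show ?thesis using False by simp
        qed
      qed
    qed
    also have "\<dots> \<le> liminf (\<lambda>n. integral\<^sup>N lebesgue (?I (f n)))"
      by (intro nn_integral_liminf Lpw_integrand_measurable Lpw_leD(1)[OF f])
    also have "\<dots> \<le> liminf (\<lambda>n. ennreal (c powr q))"
      using f 2 by (intro Liminf_mono always_eventually) (auto simp: Lpw_le_real)
    also have "\<dots> = ennreal (c powr q)" by (intro lim_imp_Liminf) auto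
    finally show ?thesis using sm Lpw_leD(2)[OF f] 2 by (simp add: Lpw_le_real)
  qed
qed

section \<open>Changing the interval: translation, restriction, extension by zero\<close>

lemma Lpw_le_translation:
  assumes p: "0 < p" and \<alpha>: "0 \<le> \<alpha>" and f: "Lpw_le p \<alpha> \<eta> c f" and a: "0 \<le> a"
    and sub: "\<And>t. t \<in> ival \<eta>' \<Longrightarrow> a + t \<in> ival \<eta>"
  shows "Lpw_le p \<alpha> \<eta>' c (\<lambda>t. f (a + t))"
proof -
  have sm: "strongly_measurable_on (ival \<eta>') (\<lambda>t. f (a + t))"
    using strongly_measurable_on_translation[OF _ _ Lpw_leD(1)[OF f] sub] by simp
  have w: "t powr \<alpha> \<le> (a + t) powr \<alpha>" if "t \<in> ival \<eta>'" for t
    using that a \<alpha> by (intro powr_mono2) (auto simp: ival_def)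
  from p show ?thesis
  proof (cases rule: Lpw_exponent_cases)
    case 1
    have "AE t in lebesgue. t \<in> ival \<eta> \<longrightarrow> t powr \<alpha> * norm (f t) \<le> c"
      using f 1 by (simp add: Lpw_le_infinity)
    then have "AE t in lebesgue. a + t \<in> ival \<eta> \<longrightarrow> (a + t) powr \<alpha> * norm (f (a + t)) \<le> c"
      by (rule AE_lebesgue_translation)
    then have "AE t in lebesgue. t \<in> ival \<eta>' \<longrightarrow> t powr \<alpha> * norm (f (a + t)) \<le> c"
      by eventually_elim (use w sub in \<open>meson mult_right_mono norm_ge_zero order_trans\<close>)
    then show ?thesis using sm f 1 by (simp add: Lpw_le_infinity)
  next
    case (2 q)
    let ?I = "\<lambda>t. indicator (ival \<eta>) t * ennreal ((t powr \<alpha> * norm (f t)) powr q)"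
    have m: "?I \<in> borel_measurable lebesgue" by (intro Lpw_integrand_measurable Lpw_leD(1)[OF f])
    have "(\<integral>\<^sup>+ t. indicator (ival \<eta>') t * ennreal ((t powr \<alpha> * norm (f (a + t))) powr q) \<partial>lebesgue)
      \<le> (\<integral>\<^sup>+ t. ?I (a + 1 * t) \<partial>lebesgue)"
    proof (rule nn_integral_mono)
      fix t
      have "(t powr \<alpha> * norm (f (a + t))) powr q \<le> ((a + t) powr \<alpha> * norm (f (a + t))) powr q" if "t \<in> ival \<eta>'"
        using 2 by (intro powr_mono2 mult_right_mono w[OF that]) auto
      then show "indicator (ival \<eta>') t * ennreal ((t powr \<alpha> * norm (f (a + t))) powr q) \<le> ?I (a + 1 * t)"
        using sub[of t] by (auto simp: indicator_def ennreal_leI)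
    qed
    also have "\<dots> = integral\<^sup>N lebesgue ?I"
      using nn_integral_real_affine_lebesgue[OF m, of 1 a] by simp
    also have "\<dots> \<le> ennreal (c powr q)" using f 2 by (simp add: Lpw_le_real)
    finally show ?thesis using sm f 2 by (simp add: Lpw_le_real)
  qed
qed

lemma Lpw_le_restrict:
  assumes "0 < p" "0 \<le> \<alpha>" "Lpw_le p \<alpha> \<eta> c f" "\<eta>' \<le> \<eta>"
  shows "Lpw_le p \<alpha> \<eta>' c f"
  using Lpw_le_translation[OF assms(1-3), of 0 \<eta>'] assms(4) less_le_trans[of _ \<eta>' \<eta>] by (simp add: ival_def)

text \<open>The hypotheses [A2] and [A3] concern inputs on the whole interval (0, \<tau>); extending
  by zero makes them available for inputs on shorter intervals, with the same constants.\<close>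

lemma Lpw_le_extend_0:
  assumes p: "0 < p" and f: "Lpw_le p \<alpha> \<eta> c f"
  shows "Lpw_le p \<alpha> \<tau> c (\<lambda>t. if t \<in> ival \<eta> then f t else 0)"
proof -
  have sm: "strongly_measurable_on (ival \<tau>) (\<lambda>t. if t \<in> ival \<eta> then f t else 0)"
    using strongly_measurable_on_if_0 Lpw_leD(1)[OF f] ival_sets by blast
  from p show ?thesis
  proof (cases rule: Lpw_exponent_cases)
    case 1
    then have "AE t in lebesgue. t \<in> ival \<eta> \<longrightarrow> t powr \<alpha> * norm (f t) \<le> c"
      using f 1 by (simp add: Lpw_le_infinity)
    then have "AE t in lebesgue. t \<in> ival \<tau> \<longrightarrow> t powr \<alpha> * norm (if t \<in> ival \<eta> then f t else 0) \<le> c"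
      by eventually_elim (use Lpw_leD(2)[OF f] in auto)
    then show ?thesis using sm f 1 by (simp add: Lpw_le_infinity)
  next
    case (2 q)
    have "(\<integral>\<^sup>+ t. indicator (ival \<tau>) t * ennreal ((t powr \<alpha> * norm (if t \<in> ival \<eta> then f t else 0)) powr q) \<partial>lebesgue)
      \<le> (\<integral>\<^sup>+ t. indicator (ival \<eta>) t * ennreal ((t powr \<alpha> * norm (f t)) powr q) \<partial>lebesgue)"
      by (intro nn_integral_mono) (auto simp: indicator_def)
    also have "\<dots> \<le> ennreal (c powr q)" using f 2 by (simp add: Lpw_le_real)
    finally show ?thesis using sm f 2 by (simp add: Lpw_le_real)
  qed
qed

lemma ival_mono: "t \<in> ival \<eta>' \<Longrightarrow> \<eta>' \<le> \<eta> \<Longrightarrow> t \<in> ival \<eta>"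
  by (auto simp: ival_def intro: less_le_trans)

lemma ivalI: "0 < s \<Longrightarrow> s \<le> t \<Longrightarrow> ereal t < \<eta> \<Longrightarrow> s \<in> ival \<eta>"
  using le_less_trans[of "ereal s" "ereal t" \<eta>] by (simp add: ival_def)

text \<open>Plays the part of completeness of L^p_\<alpha>: applied to the partial sums of the norms
  of successive differences, it makes a sequence with summable differences converge at almost every
  point. For finite exponents it is monotone convergence: the supremum of the integrands has finite
  integral, hence is finite almost everywhere.\<close>

lemma Lpw_le_incseq_bounded:
  fixes g :: "nat \<Rightarrow> real \<Rightarrow> real"
  assumes p: "0 < p" and g: "\<And>n. Lpw_le p \<alpha> \<eta> c (g n)"
    and mono: "\<And>n t. 0 \<le> g n t" "\<And>n t. g n t \<le> g (Suc n) t"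
  shows "AE t in lebesgue. t \<in> ival \<eta> \<longrightarrow> bdd_above (range (\<lambda>n. g n t))"
  using p
proof (cases rule: Lpw_exponent_cases)
  case 1
  have "AE t in lebesgue. \<forall>n. t \<in> ival \<eta> \<longrightarrow> t powr \<alpha> * norm (g n t) \<le> c"
    unfolding AE_all_countable using g 1 by (simp add: Lpw_le_infinity)
  then show ?thesis
  proof eventually_elim
    case (elim t)
    show ?case
    proof
      assume t: "t \<in> ival \<eta>"
      then have t0: "0 < t powr \<alpha>" by (simp add: ival_def)
      show "bdd_above (range (\<lambda>n. g n t))"
      proof (intro bdd_aboveI2)
        fix n
        have "t powr \<alpha> * norm (g n t) \<le> c" using elim t by blast
        then show "g n t \<le> c / t powr \<alpha>" using t0 mono(1)[of n t] by (simp add: field_simps)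
      qed
    qed
  qed
next
  case (2 q)
  let ?I = "\<lambda>n t. indicator (ival \<eta>) t * ennreal ((t powr \<alpha> * norm (g n t)) powr q)"
  have m: "?I n \<in> borel_measurable lebesgue" for n
    by (intro Lpw_integrand_measurable Lpw_leD(1)[OF g])
  have inc: "incseq ?I"
  proof (rule incseq_SucI, rule le_funI)
    fix n t
    have "(t powr \<alpha> * norm (g n t)) powr q \<le> (t powr \<alpha> * norm (g (Suc n) t)) powr q"
      using 2 mono(1)[of n t] mono(1)[of "Suc n" t] mono(2)[of n t]
      by (intro powr_mono2 mult_left_mono) auto
    then show "?I n t \<le> ?I (Suc n) t" by (intro mult_left_mono ennreal_leI) auto
  qed
  have "(\<integral>\<^sup>+ t. (SUP n. ?I n t) \<partial>lebesgue) = (SUP n. integral\<^sup>N lebesgue (?I n))"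
    by (rule nn_integral_monotone_convergence_SUP[OF inc m])
  also have "\<dots> \<le> ennreal (c powr q)"
    using g 2 by (intro SUP_least) (simp add: Lpw_le_real)
  finally have "(\<integral>\<^sup>+ t. (SUP n. ?I n t) \<partial>lebesgue) \<noteq> \<infinity>" by (auto simp: top_unique)
  moreover have "(\<lambda>t. SUP n. ?I n t) \<in> borel_measurable lebesgue"
    by (intro borel_measurable_SUP m) auto
  ultimately have "AE t in lebesgue. (SUP n. ?I n t) \<noteq> \<infinity>"
    using nn_integral_PInf_AE by blast
  then show ?thesis
  proof eventually_elim
    case (elim t)
    show ?case
    proof
      assume t: "t \<in> ival \<eta>"
      then have t0: "0 < t powr \<alpha>" by (simp add: ival_def)
      obtain r where r: "0 \<le> r" "(SUP n. ?I n t) = ennreal r"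
        using elim by (cases "SUP n. ?I n t") auto
      show "bdd_above (range (\<lambda>n. g n t))"
      proof (intro bdd_aboveI2)
        fix n
        have "?I n t \<le> ennreal r" using r(2) by (metis SUP_upper UNIV_I)
        then have "(t powr \<alpha> * norm (g n t)) powr q \<le> r" using t r by (simp add: ennreal_le_iff)
        then have "((t powr \<alpha> * norm (g n t)) powr q) powr (1 / q) \<le> r powr (1 / q)"
          using 2 by (intro powr_mono2) auto
        then have "t powr \<alpha> * norm (g n t) \<le> r powr (1 / q)" using 2 by (simp add: powr_powr)
        then show "g n t \<le> r powr (1 / q) / t powr \<alpha>" using t0 mono(1)[of n t] by (simp add: field_simps)
      qed
    qed
  qed
qed

text \<open>Hoelder's inequality with two equal exponents: the weight t^(2\<alpha>) splits evenly,
  and for finite exponents Cauchy-Schwarz is applied to the q/2-th powers of the two weighted norms.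
  This is why a quadratic nonlinearity maps L^p_\<alpha> into L^(p/2)_(2\<alpha>).\<close>

lemma Lpw_le_product:
  assumes p: "0 < p" and f: "Lpw_le p \<alpha> \<eta> c f" and g: "Lpw_le p \<alpha> \<eta> d g" and K: "0 \<le> K"
    and h: "strongly_measurable_on (ival \<eta>) h"
    and fg: "AE t in lebesgue. t \<in> ival \<eta> \<longrightarrow> norm (h t) \<le> K * norm (f t) * norm (g t)"
  shows "Lpw_le (p / 2) (2 * \<alpha>) \<eta> (K * c * d) h"
proof -
  have cd: "0 \<le> c" "0 \<le> d" using f g by (auto dest: Lpw_leD)
  have w: "t powr (2 * \<alpha>) * norm (h t) \<le> K * ((t powr \<alpha> * norm (f t)) * (t powr \<alpha> * norm (g t)))"
    if "norm (h t) \<le> K * norm (f t) * norm (g t)" for t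
  proof -
    have "t powr (2 * \<alpha>) = t powr \<alpha> * t powr \<alpha>" by (simp add: powr_add[symmetric])
    then show ?thesis
      using mult_left_mono[OF that, of "t powr (2 * \<alpha>)"] by (simp add: mult_ac)
  qed
  from p show ?thesis
  proof (cases rule: Lpw_exponent_cases)
    case 1
    have "AE t in lebesgue. t \<in> ival \<eta> \<longrightarrow> t powr \<alpha> * norm (f t) \<le> c"
      "AE t in lebesgue. t \<in> ival \<eta> \<longrightarrow> t powr \<alpha> * norm (g t) \<le> d"
      using f g 1 by (auto simp add: Lpw_le_infinity)
    then have "AE t in lebesgue. t \<in> ival \<eta> \<longrightarrow> t powr (2 * \<alpha>) * norm (h t) \<le> K * c * d"
      using fg
    proof eventually_elim
      case (elim t)
      show ?case
      proof
        assume t: "t \<in> ival \<eta>"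
        have "t powr (2 * \<alpha>) * norm (h t) \<le> K * ((t powr \<alpha> * norm (f t)) * (t powr \<alpha> * norm (g t)))"
          using elim t by (intro w) auto
        also have "\<dots> \<le> K * (c * d)" using elim t K cd by (intro mult_left_mono mult_mono) auto
        finally show "t powr (2 * \<alpha>) * norm (h t) \<le> K * c * d" by simp
      qed
    qed
    then show ?thesis using h K cd 1 by (simp add: Lpw_le_infinity)
  next
    case (2 q)
    have p2: "p / 2 = ereal (q / 2)" using 2 by simp
    let ?F = "\<lambda>t. indicator (ival \<eta>) t * ennreal ((t powr \<alpha> * norm (f t)) powr (q / 2))"
    let ?G = "\<lambda>t. indicator (ival \<eta>) t * ennreal ((t powr \<alpha> * norm (g t)) powr (q / 2))"
    have FG: "?F \<in> borel_measurable lebesgue" "?G \<in> borel_measurable lebesgue"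
      using Lpw_integrand_measurable Lpw_leD(1) f g by blast+
    have sq: "(ennreal (x powr (q / 2)))\<^sup>2 = ennreal (x powr q)" for x
      by (simp add: power2_eq_square ennreal_mult'[symmetric] powr_add[symmetric])
    have ind2: "(indicator (ival \<eta>) t * e)\<^sup>2 = indicator (ival \<eta>) t * e\<^sup>2" for t and e :: ennreal
      by (auto simp: indicator_def power2_eq_square)
    have F2: "(\<integral>\<^sup>+ t. (?F t)\<^sup>2 \<partial>lebesgue) \<le> ennreal (c powr q)"
      unfolding ind2 sq using f 2 by (simp add: Lpw_le_real)
    have G2: "(\<integral>\<^sup>+ t. (?G t)\<^sup>2 \<partial>lebesgue) \<le> ennreal (d powr q)"
      unfolding ind2 sq using g 2 by (simp add: Lpw_le_real)
    have FGi: "(\<integral>\<^sup>+ t. ?F t * ?G t \<partial>lebesgue) \<le> ennreal ((c * d) powr (q / 2))"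
    proof -
      have "(\<integral>\<^sup>+ t. ?F t * ?G t \<partial>lebesgue)\<^sup>2 \<le> ennreal (c powr q) * ennreal (d powr q)"
        using Cauchy_Schwarz_nn_integral[OF FG] mult_mono[OF F2 G2] by (meson order_trans zero_le)
      also have "\<dots> = (ennreal ((c * d) powr (q / 2)))\<^sup>2"
        unfolding sq by (simp add: ennreal_mult'[symmetric] powr_mult)
      finally have le: "(\<integral>\<^sup>+ t. ?F t * ?G t \<partial>lebesgue)\<^sup>2 \<le> (ennreal ((c * d) powr (q / 2)))\<^sup>2" .
      show ?thesis
      proof (cases "\<integral>\<^sup>+ t. ?F t * ?G t \<partial>lebesgue")
        case (real x)
        then have "x\<^sup>2 \<le> ((c * d) powr (q / 2))\<^sup>2" using le by (simp add: ennreal_power ennreal_le_iff)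
        then have "x \<le> (c * d) powr (q / 2)" by (rule power2_le_imp_le) simp
        then show ?thesis unfolding real by (rule ennreal_leI)
      next
        case top
        then show ?thesis using le by (simp add: ennreal_power top_unique ennreal_top_eq_mult_iff power2_eq_square ennreal_mult'[symmetric])
      qed
    qed
    have "(\<integral>\<^sup>+ t. indicator (ival \<eta>) t * ennreal ((t powr (2 * \<alpha>) * norm (h t)) powr (q / 2)) \<partial>lebesgue)
      \<le> (\<integral>\<^sup>+ t. ennreal (K powr (q / 2)) * (?F t * ?G t) \<partial>lebesgue)"
    proof (rule nn_integral_mono_AE)
      show "AE t in lebesgue. indicator (ival \<eta>) t * ennreal ((t powr (2 * \<alpha>) * norm (h t)) powr (q / 2))
          \<le> ennreal (K powr (q / 2)) * (?F t * ?G t)"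
        using fg
      proof eventually_elim
        case (elim t)
        show ?case
        proof (cases "t \<in> ival \<eta>")
          case True
          then have "(t powr (2 * \<alpha>) * norm (h t)) powr (q / 2)
            \<le> (K * ((t powr \<alpha> * norm (f t)) * (t powr \<alpha> * norm (g t)))) powr (q / 2)"
            using elim 2 by (intro powr_mono2 w) auto
          also have "\<dots> = K powr (q / 2) * ((t powr \<alpha> * norm (f t)) powr (q / 2) * (t powr \<alpha> * norm (g t)) powr (q / 2))"
            by (simp only: powr_mult)
          finally show ?thesis using True by (simp add: ennreal_mult'[symmetric] ennreal_leI)
        qed simp
      qed
    qed
    also have "\<dots> = ennreal (K powr (q / 2)) * (\<integral>\<^sup>+ t. ?F t * ?G t \<partial>lebesgue)"
      by (intro nn_integral_cmult borel_measurable_times_ennreal FG)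
    also have "\<dots> \<le> ennreal (K powr (q / 2)) * ennreal ((c * d) powr (q / 2))"
      by (intro mult_left_mono FGi) auto
    also have "\<dots> = ennreal ((K * c * d) powr (q / 2))"
      by (simp add: ennreal_mult'[symmetric] powr_mult mult_ac)
    finally show ?thesis using h K cd 2 unfolding p2 by (subst Lpw_le_real) auto
  qed
qed

text \<open>A function bounded by k has norm at most k * d^(\<alpha> + 1/p) on (0, d), with the
  exponent read as \<alpha> for infinite p; positivity of \<alpha> + 1/p makes this small.\<close>

lemma Lpw_le_bounded_small:
  assumes p: "0 < p" and \<alpha>: "0 \<le> \<alpha>" "0 < ereal \<alpha> + inverse p"
    and f: "strongly_measurable_on (ival \<eta>) f" and \<eta>: "0 < \<eta>" and e: "0 < e"
    and b: "AE t in lebesgue. t \<in> ival \<eta> \<longrightarrow> norm (f t) \<le> k"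
  obtains d where "0 < d" "ereal d \<le> \<eta>" "Lpw_le p \<alpha> (ereal d) e f"
proof -
  define k' where "k' = max k 1"
  have k': "0 < k'" by (simp add: k'_def)
  obtain \<eta>1 :: real where \<eta>1: "0 < \<eta>1" "ereal \<eta>1 \<le> \<eta>"
    using \<eta> by (metis ereal_dense2 ereal_less(2) less_imp_le)
  have sm: "strongly_measurable_on (ival (ereal d)) f" if "ereal d \<le> \<eta>" for d
    by (rule strongly_measurable_on_mono_AE[OF _ _ f])
       (use that ival_mono in auto)
  define s where "s = (if p = \<infinity> then \<alpha> else \<alpha> + 1 / real_of_ereal p)"
  have s: "0 < s" using p \<alpha> by (cases p) (auto simp: s_def divide_inverse)
  \<comment> \<open>The second entry solves \<open>k' * d powr s = e\<close>.\<close>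
  define d where "d = min \<eta>1 ((e / k') powr (1 / s))"
  have d: "0 < d" "ereal d \<le> \<eta>" using \<eta>1 e k' by (auto simp: d_def min_def elim!: order_trans[rotated])
  have ds: "k' * d powr s \<le> e"
  proof -
    have "d powr s \<le> ((e / k') powr (1 / s)) powr s"
      using d s by (intro powr_mono2) (auto simp: d_def)
    also have "\<dots> = e / k'" using s e k' by (simp add: powr_powr)
    finally show ?thesis using k' by (simp add: field_simps)
  qed
  have bd: "AE t in lebesgue. t \<in> ival (ereal d) \<longrightarrow> t powr \<alpha> * norm (f t) \<le> k' * d powr \<alpha>"
    using b
  proof eventually_elim
    case (elim t)
    show ?case
    proof
      assume t: "t \<in> ival (ereal d)"
      then have "t \<in> ival \<eta>" using d(2) by (rule ival_mono)
      then have "norm (f t) \<le> k'" using elim by (simp add: k'_def)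
      moreover have "t powr \<alpha> \<le> d powr \<alpha>" using t \<alpha> by (intro powr_mono2) (auto simp: ival_def)
      ultimately have "t powr \<alpha> * norm (f t) \<le> d powr \<alpha> * k'" by (intro mult_mono) auto
      then show "t powr \<alpha> * norm (f t) \<le> k' * d powr \<alpha>" by (simp add: mult_ac)
    qed
  qed
  from p have "Lpw_le p \<alpha> (ereal d) e f"
  proof (cases rule: Lpw_exponent_cases)
    case 1
    then have "s = \<alpha>" by (simp add: s_def)
    then have "AE t in lebesgue. t \<in> ival (ereal d) \<longrightarrow> t powr \<alpha> * norm (f t) \<le> e"
      using bd ds by (auto elim!: eventually_mono)
    then show ?thesis using sm[OF d(2)] e 1 by (simp add: Lpw_le_infinity)
  next
    case (2 q)
    then have sq: "s = \<alpha> + 1 / q" by (simp add: s_def)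
    have "(\<integral>\<^sup>+ t. indicator (ival (ereal d)) t * ennreal ((t powr \<alpha> * norm (f t)) powr q) \<partial>lebesgue)
       \<le> (\<integral>\<^sup>+ t. ennreal ((k' * d powr \<alpha>) powr q) * indicator {0<..<d} t \<partial>lebesgue)"
    proof (rule nn_integral_mono_AE)
      show "AE t in lebesgue. indicator (ival (ereal d)) t * ennreal ((t powr \<alpha> * norm (f t)) powr q)
         \<le> ennreal ((k' * d powr \<alpha>) powr q) * indicator {0<..<d} t"
        using bd
      proof eventually_elim
        case (elim t)
        then show ?case using 2
          by (cases "t \<in> ival (ereal d)") (auto simp: ival_def intro!: ennreal_leI powr_mono2)
      qed
    qed
    also have "\<dots> = ennreal ((k' * d powr \<alpha>) powr q) * ennreal d"
      using d by (subst nn_integral_cmult_indicator) auto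
    also have "\<dots> = ennreal ((k' * d powr s) powr q)"
    proof -
      have "d powr (s * q) = d powr (\<alpha> * q) * d powr 1"
        unfolding powr_add[symmetric] using 2 by (simp add: sq distrib_right)
      then show ?thesis using d by (simp add: powr_mult powr_powr ennreal_mult'[symmetric])
    qed
    also have "\<dots> \<le> ennreal (e powr q)" using ds k' 2 by (intro ennreal_leI powr_mono2) auto
    finally show ?thesis using sm[OF d(2)] e 2 by (simp add: Lpw_le_real)
  qed
  then show thesis using that d by blast
qed

text \<open>One \<open>d\<close> serves all restart points \<open>a\<close> in (t0 - d, t0], and the
  interval of length \<open>2 * d\<close> reaches beyond \<open>t0\<close> from each of them:
  continuity at \<open>t0\<close> needs windows around it that start at freely chosen earlier times.
  For finite exponents the integral over shrinking neighbourhoods of \<open>t0\<close> tends to 0.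
  For p = \<infinity> the function is bounded near t0 > 0 while the restarted weight is at most
  (2d)^\<alpha>; at t0 = 0 the function t^(-\<alpha>) shows that the norm need not become
  small.\<close>

lemma Lpw_le_translation_small:
  assumes p: "0 < p" and \<alpha>: "0 \<le> \<alpha>" "0 < ereal \<alpha> + inverse p"
    and f: "Lpw_le p \<alpha> \<eta> c f" and t0: "0 \<le> t0" "ereal t0 < \<eta>" "t0 > 0 \<or> p \<noteq> \<infinity>" and e: "0 < e"
  obtains d where "0 < d" "ereal (t0 + 2 * d) < \<eta>"
    "\<And>a. 0 \<le> a \<Longrightarrow> t0 - d < a \<Longrightarrow> a \<le> t0 \<Longrightarrow> Lpw_le p \<alpha> (ereal (2 * d)) e (\<lambda>t. f (a + t))"
proof -
  obtain r :: real where r: "0 < r" "ereal (t0 + 2 * r) < \<eta>"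
  proof -
    obtain z where z: "ereal t0 < ereal z" "ereal z < \<eta>" using t0(2) ereal_dense2 by blast
    show thesis by (rule that[of "(z - t0) / 2"]) (use z in \<open>auto simp: field_simps\<close>)
  qed
  have sub: "a + t \<in> ival \<eta>" if "t \<in> ival (ereal (2 * d))" "0 \<le> a" "a \<le> t0" "d \<le> r" for a t d
  proof -
    show ?thesis by (rule ivalI[OF _ _ r(2)]) (use that in \<open>auto simp: ival_def\<close>)
  qed
  have lt: "ereal (t0 + 2 * d) < \<eta>" if "d \<le> r" for d
  proof -
    have "ereal (t0 + 2 * d) \<le> ereal (t0 + 2 * r)" using that by simp
    then show ?thesis using r(2) by (rule le_less_trans)
  qed
  have sm: "strongly_measurable_on (ival (ereal (2 * d))) (\<lambda>t. f (a + t))"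
    if "0 \<le> a" "a \<le> t0" "d \<le> r" for a d
    using strongly_measurable_on_translation[OF _ _ Lpw_leD(1)[OF f]] sub that by simp
  from p show thesis
  proof (cases rule: Lpw_exponent_cases)
    case 1
    then have t0: "0 < t0" and \<alpha>0: "0 < \<alpha>" using t0 \<alpha> by auto
    have c: "0 \<le> c" using f by (rule Lpw_leD)
    \<comment> \<open>Bounds \<open>f\<close> almost everywhere beyond \<open>t0 / 2\<close>, where
      all restarted intervals lie since d \<le> t0 / 2.\<close>
    define k where "k = c / (t0 / 2) powr \<alpha>"
    have k: "0 \<le> k" using c by (simp add: k_def)
    define d where "d = min (min r (t0 / 2)) ((e / (k + 1)) powr (1 / \<alpha>) / 2)"
    have d: "0 < d" "d \<le> r" "d \<le> t0 / 2" "2 * d \<le> (e / (k + 1)) powr (1 / \<alpha>)"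
      using r t0 e k by (auto simp: d_def)
    have "(2 * d) powr \<alpha> \<le> ((e / (k + 1)) powr (1 / \<alpha>)) powr \<alpha>"
      using d \<alpha> by (intro powr_mono2) auto
    also have "\<dots> = e / (k + 1)" using \<alpha>0 e k by (simp add: powr_powr)
    finally have dk: "(2 * d) powr \<alpha> * (k + 1) \<le> e" using k by (simp add: field_simps)
    have f': "AE t in lebesgue. t \<in> ival \<eta> \<longrightarrow> t powr \<alpha> * norm (f t) \<le> c"
      using f 1 by (simp add: Lpw_le_infinity)
    show thesis
    proof (rule that[OF d(1) lt[OF d(2)]])
      fix a assume a: "0 \<le> a" "t0 - d < a" "a \<le> t0"
      have "AE t in lebesgue. a + t \<in> ival \<eta> \<longrightarrow> (a + t) powr \<alpha> * norm (f (a + t)) \<le> c"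
        using f' by (rule AE_lebesgue_translation)
      then have "AE t in lebesgue. t \<in> ival (ereal (2 * d)) \<longrightarrow> t powr \<alpha> * norm (f (a + t)) \<le> e"
      proof eventually_elim
        case (elim t)
        show ?case
        proof
          assume t: "t \<in> ival (ereal (2 * d))"
          have "(t0 / 2) powr \<alpha> \<le> (a + t) powr \<alpha>"
            using t a d t0 \<alpha> by (intro powr_mono2) (auto simp: ival_def)
          then have "(t0 / 2) powr \<alpha> * norm (f (a + t)) \<le> (a + t) powr \<alpha> * norm (f (a + t))"
            by (intro mult_right_mono) auto
          also have "\<dots> \<le> c" using elim sub[OF t a(1,3) d(2)] by blast
          finally have "norm (f (a + t)) \<le> k" using t0 by (simp add: k_def field_simps)
          moreover have "t powr \<alpha> \<le> (2 * d) powr \<alpha>"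
            using t \<alpha> by (intro powr_mono2) (auto simp: ival_def)
          ultimately have "t powr \<alpha> * norm (f (a + t)) \<le> (2 * d) powr \<alpha> * (k + 1)"
            by (intro mult_mono) auto
          then show "t powr \<alpha> * norm (f (a + t)) \<le> e" using dk by simp
        qed
      qed
      then show "Lpw_le p \<alpha> (ereal (2 * d)) e (\<lambda>t. f (a + t))"
        using sm[OF a(1,3) d(2)] e 1 by (simp add: Lpw_le_infinity)
    qed
  next
    case (2 q)
    let ?I = "\<lambda>t. indicator (ival \<eta>) t * ennreal ((t powr \<alpha> * norm (f t)) powr q)"
    have m: "?I \<in> borel_measurable lebesgue" by (intro Lpw_integrand_measurable Lpw_leD(1)[OF f])
    have fin: "integral\<^sup>N lebesgue ?I < \<infinity>"
      using f 2 by (auto simp: Lpw_le_real less_top[symmetric] top_unique)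
    \<comment> \<open>With \<open>d = 1 / real (Suc n)\<close>, every interval (a, a + 2d) with a in
      (t0 - d, t0] lies in \<open>A n\<close>, and these sets shrink to the null set {t0}.\<close>
    define A where "A n = {t0 - 1 / real (Suc n) <..< t0 + 2 / real (Suc n)}" for n
    have mA: "(\<lambda>t. indicator (A n) t * ?I t) \<in> borel_measurable lebesgue" for n
      by (rule borel_measurable_times_ennreal[OF borel_measurable_indicator m]) (simp add: A_def)
    have "(\<lambda>n. \<integral>\<^sup>+ t. indicator (A n) t * ?I t \<partial>lebesgue) \<longlonglongrightarrow> (\<integral>\<^sup>+ t. 0 \<partial>(lebesgue :: real measure))"
    proof (rule nn_integral_dominated_convergence[where w="?I"])
      show "(\<lambda>t. indicator (A n) t * ?I t) \<in> borel_measurable lebesgue" for n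
        by (rule mA)
      show "AE t in lebesgue. indicator (A n) t * ?I t \<le> ?I t" for n
        by (auto simp: indicator_def)
      have "AE t in lebesgue. t \<noteq> t0"
        using AE_lborel_singleton[of t0] AE_completion by blast
      then show "AE t in lebesgue. (\<lambda>n. indicator (A n) t * ?I t) \<longlonglongrightarrow> 0"
      proof eventually_elim
        case (elim t)
        then have "0 < \<bar>t - t0\<bar> / 2" by simp
        then obtain N where N: "1 / real (Suc N) < \<bar>t - t0\<bar> / 2" using nat_approx_posE by blast
        have "t \<notin> A n" if "n \<ge> N" for n
        proof -
          have "1 / real (Suc n) \<le> 1 / real (Suc N)" using that by (simp add: frac_le)
          then have "1 / real (Suc n) < \<bar>t - t0\<bar> / 2" using N by linarith
          then have "1 / real (Suc n) < \<bar>t - t0\<bar>" "2 / real (Suc n) < \<bar>t - t0\<bar>"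
            using zero_less_divide_1_iff[of "real (Suc n)"] by auto
          then show ?thesis unfolding A_def by (auto simp: abs_if split: if_splits)
        qed
        then have "eventually (\<lambda>n. indicator (A n) t * ?I t = 0) sequentially"
          by (intro eventually_sequentiallyI[of N]) simp
        then show ?case by (rule tendsto_eventually)
      qed
    qed (use m fin in auto)
    then have "(\<lambda>n. \<integral>\<^sup>+ t. indicator (A n) t * ?I t \<partial>lebesgue) \<longlonglongrightarrow> 0" by simp
    moreover have "0 < ennreal (e powr q)" using e by simp
    ultimately have ev: "eventually (\<lambda>n. (\<integral>\<^sup>+ t. indicator (A n) t * ?I t \<partial>lebesgue) < ennreal (e powr q)) sequentially"
      by (rule order_tendstoD(2))
    have "eventually (\<lambda>n. 1 / real (Suc n) < r) sequentially"
      using LIMSEQ_inverse_real_of_nat r(1) by (intro order_tendstoD(2)) (simp_all add: inverse_eq_divide)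
    with ev obtain n where n: "(\<integral>\<^sup>+ t. indicator (A n) t * ?I t \<partial>lebesgue) < ennreal (e powr q)"
      and nr: "1 / real (Suc n) < r"
      using eventually_happens'[OF sequentially_bot eventually_conj] by blast
    define d where "d = 1 / real (Suc n)"
    have d: "0 < d" "d \<le> r" using nr by (auto simp: d_def)
    show thesis
    proof (rule that[OF d(1) lt[OF d(2)]])
      fix a assume a: "0 \<le> a" "t0 - d < a" "a \<le> t0"
      have "(\<integral>\<^sup>+ t. indicator (ival (ereal (2 * d))) t * ennreal ((t powr \<alpha> * norm (f (a + t))) powr q) \<partial>lebesgue)
        \<le> (\<integral>\<^sup>+ t. indicator (A n) (a + 1 * t) * ?I (a + 1 * t) \<partial>lebesgue)"
      proof (rule nn_integral_mono)
        fix t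
        show "indicator (ival (ereal (2 * d))) t * ennreal ((t powr \<alpha> * norm (f (a + t))) powr q)
            \<le> indicator (A n) (a + 1 * t) * ?I (a + 1 * t)"
        proof (cases "t \<in> ival (ereal (2 * d))")
          case True
          have "(t powr \<alpha> * norm (f (a + t))) powr q \<le> ((a + t) powr \<alpha> * norm (f (a + t))) powr q"
            using True a 2 \<alpha> by (intro powr_mono2 mult_right_mono) (auto simp: ival_def)
          moreover have "a + t \<in> A n" using True a by (auto simp: A_def ival_def d_def)
          ultimately show ?thesis using True sub[OF True a(1,3) d(2)] by (simp add: ennreal_leI)
        qed simp
      qed
      also have "\<dots> = (\<integral>\<^sup>+ t. indicator (A n) t * ?I t \<partial>lebesgue)"
        using nn_integral_real_affine_lebesgue[OF mA[of n], of 1 a] by simp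
      also have "\<dots> \<le> ennreal (e powr q)" using n by simp
      finally show "Lpw_le p \<alpha> (ereal (2 * d)) e (\<lambda>t. f (a + t))"
        using sm[OF a(1,3) d(2)] e 2 by (simp add: Lpw_le_real)
    qed
  qed
qed

lemma powr_indicator_measurable:
  "(\<lambda>s. indicator {0<..t} s * ennreal (s powr a)) \<in> borel_measurable lebesgue" for a t :: real
  by (intro borel_measurable_times_ennreal borel_measurable_indicator
      measurable_compose[OF borel_measurable_lebesgue_powr measurable_ennreal]) auto

lemma nn_integral_powr_finite:
  fixes a t :: real
  assumes "a > -1"
  shows "(\<integral>\<^sup>+ x. indicator {0<..t} x * ennreal (x powr a) \<partial>lebesgue) < \<infinity>"
proof -
  have "(\<lambda>x. x powr a) integrable_on {0..max t 0}" by (intro integrable_on_powr_from_0 assms) auto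
  then have "(\<lambda>x. x powr a) absolutely_integrable_on {0..max t 0}"
    by (intro nonnegative_absolutely_integrable_1) auto
  then have "integrable lebesgue (\<lambda>x. indicator {0..max t 0} x *\<^sub>R (x powr a))"
    by (simp add: set_integrable_def)
  then have "(\<integral>\<^sup>+ x. ennreal (norm (indicator {0..max t 0} x *\<^sub>R (x powr a))) \<partial>lebesgue) < \<infinity>"
    by (simp add: integrable_iff_bounded)
  moreover have "(\<integral>\<^sup>+ x. indicator {0<..t} x * ennreal (x powr a) \<partial>lebesgue)
     \<le> (\<integral>\<^sup>+ x. ennreal (norm (indicator {0..max t 0} x *\<^sub>R (x powr a))) \<partial>lebesgue)"
    by (intro nn_integral_mono) (auto simp: indicator_def)
  ultimately show ?thesis by (rule le_less_trans[rotated])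
qed

text \<open>Write |f| = s^(-\<alpha>) * (s^\<alpha> |f|): for a finite exponent q with conjugate r,
  the power s^(-\<alpha> r) is integrable at 0 exactly when \<alpha> + 1/q < 1. Applied to inputs
  with exponent p/2 and weight 2\<alpha>, which is where \<alpha> + 1/p < 1/2 enters.\<close>

lemma Lpw_le_locally_integrable:
  assumes p: "1 < p" and \<alpha>: "0 \<le> \<alpha>" "ereal \<alpha> + inverse p < 1" and f: "Lpw_le p \<alpha> \<eta> c f"
    and t: "ereal t < \<eta>"
  shows "(\<integral>\<^sup>+ s. indicator {0<..t} s * ennreal (norm (f s)) \<partial>lebesgue) < \<infinity>"
proof -
  have sub: "s \<in> ival \<eta>" if "s \<in> {0<..t}" for s
    using that t by (auto simp: ival_def intro: le_less_trans[rotated])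
  have eq: "norm (f s) = s powr (- \<alpha>) * (s powr \<alpha> * norm (f s))" if "s \<in> {0<..t}" for s
    using that by (simp add: powr_minus field_simps)
  have p0: "0 < p" using p by (cases p) auto
  then show ?thesis
  proof (cases rule: Lpw_exponent_cases)
    case 1
    have c: "0 \<le> c" using f by (rule Lpw_leD)
    have "(\<integral>\<^sup>+ s. indicator {0<..t} s * ennreal (norm (f s)) \<partial>lebesgue)
       \<le> (\<integral>\<^sup>+ s. ennreal c * (indicator {0<..t} s * ennreal (s powr (- \<alpha>))) \<partial>lebesgue)"
    proof (rule nn_integral_mono_AE)
      have "AE s in lebesgue. s \<in> ival \<eta> \<longrightarrow> s powr \<alpha> * norm (f s) \<le> c"
        using f 1 by (simp add: Lpw_le_infinity)
      then show "AE s in lebesgue. indicator {0<..t} s * ennreal (norm (f s))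
          \<le> ennreal c * (indicator {0<..t} s * ennreal (s powr (- \<alpha>)))"
      proof eventually_elim
        case (elim s)
        show ?case
        proof (cases "s \<in> {0<..t}")
          case True
          then have "norm (f s) \<le> s powr (- \<alpha>) * c"
            using elim sub[OF True] by (subst eq[OF True]) (intro mult_left_mono, auto)
          then show ?thesis using True c by (simp add: ennreal_mult'[symmetric] mult.commute ennreal_leI)
        qed simp
      qed
    qed
    also have "\<dots> = ennreal c * (\<integral>\<^sup>+ s. indicator {0<..t} s * ennreal (s powr (- \<alpha>)) \<partial>lebesgue)"
      by (intro nn_integral_cmult powr_indicator_measurable)
    also have "\<dots> < \<infinity>" using nn_integral_powr_finite[of "- \<alpha>" t] \<alpha> 1 by (simp add: ennreal_mult_less_top)
    finally show ?thesis .
  next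
    case (2 q)
    have q: "1 < q" using p 2 by simp
    define r where "r = q / (q - 1)"
    have r: "0 < r" "1 + r / q = r" "r * (q - 1) = q" using q by (auto simp: r_def field_simps)
    \<comment> \<open>Young's inequality without its constants, by comparing \<open>b\<close> with
      a^(q-1): in one case the product is at most a^q, in the other at most b^r.\<close>
    have young: "a * b \<le> a powr q + b powr r" if "0 \<le> a" "0 \<le> b" for a b
    proof (cases "b \<le> a powr (q - 1)")
      case True
      show ?thesis
      proof (cases "a = 0")
        case False
        have "a * b \<le> a * a powr (q - 1)" using True that by (intro mult_left_mono) auto
        also have "\<dots> = a powr 1 * a powr (q - 1)" using False that by simp
        also have "\<dots> = a powr q" by (simp only: powr_add[symmetric]) simp
        finally show ?thesis by (simp add: add_increasing2)
      qed simp
    next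
      case False
      then have "(a powr (q - 1)) powr (1 / (q - 1)) \<le> b powr (1 / (q - 1))"
        using q by (intro powr_mono2) auto
      then have "a \<le> b powr (1 / (q - 1))" using q that by (simp add: powr_powr)
      then have "a * b \<le> b powr (1 / (q - 1)) * b" using that by (intro mult_right_mono) auto
      also have "\<dots> = b powr (1 / (q - 1)) * b powr 1" using that by simp
      also have "\<dots> = b powr (1 / (q - 1) + 1)" by (simp only: powr_add)
      also have "1 / (q - 1) + 1 = r" using q by (simp add: r_def field_simps)
      finally show ?thesis by (simp add: add_increasing)
    qed
    have "(\<integral>\<^sup>+ s. indicator {0<..t} s * ennreal (norm (f s)) \<partial>lebesgue)
      \<le> (\<integral>\<^sup>+ s. indicator (ival \<eta>) s * ennreal ((s powr \<alpha> * norm (f s)) powr q)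
          + indicator {0<..t} s * ennreal (s powr (- \<alpha> * r)) \<partial>lebesgue)"
    proof (rule nn_integral_mono)
      fix s
      show "indicator {0<..t} s * ennreal (norm (f s))
        \<le> indicator (ival \<eta>) s * ennreal ((s powr \<alpha> * norm (f s)) powr q)
          + indicator {0<..t} s * ennreal (s powr (- \<alpha> * r))"
      proof (cases "s \<in> {0<..t}")
        case True
        have "norm (f s) \<le> (s powr \<alpha> * norm (f s)) powr q + (s powr (- \<alpha>)) powr r"
          using young[of "s powr \<alpha> * norm (f s)" "s powr (- \<alpha>)"] by (subst eq[OF True]) (simp add: mult.commute)
        then have "ennreal (norm (f s)) \<le> ennreal ((s powr \<alpha> * norm (f s)) powr q) + ennreal (s powr (- \<alpha> * r))"
          by (simp add: powr_powr ennreal_plus[symmetric] ennreal_leI del: ennreal_plus)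
        then show ?thesis using True sub[OF True] by simp
      qed simp
    qed
    also have "\<dots> = (\<integral>\<^sup>+ s. indicator (ival \<eta>) s * ennreal ((s powr \<alpha> * norm (f s)) powr q) \<partial>lebesgue)
          + (\<integral>\<^sup>+ s. indicator {0<..t} s * ennreal (s powr (- \<alpha> * r)) \<partial>lebesgue)"
      by (intro nn_integral_add Lpw_integrand_measurable Lpw_leD(1)[OF f] powr_indicator_measurable)
    also have "\<dots> < \<infinity>"
    proof -
      have "\<alpha> + 1 / q < 1" using \<alpha> 2 by (simp add: divide_inverse)
      then have "(\<alpha> + 1 / q) * r < r" using r by simp
      then have "\<alpha> * r < 1" using r by (simp add: algebra_simps)
      then have "(\<integral>\<^sup>+ s. indicator {0<..t} s * ennreal (s powr (- \<alpha> * r)) \<partial>lebesgue) < \<infinity>"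
        by (intro nn_integral_powr_finite) auto
      moreover have "(\<integral>\<^sup>+ s. indicator (ival \<eta>) s * ennreal ((s powr \<alpha> * norm (f s)) powr q) \<partial>lebesgue) < \<infinity>"
        using f 2 by (auto simp: Lpw_le_real less_top[symmetric] top_unique)
      ultimately show ?thesis by simp
    qed
    finally show ?thesis .
  qed
qed

section \<open>Bounded analytic semigroups\<close>

text \<open>Banach-Steinhaus by Baire's theorem, for the sequence of difference quotients of the
  semigroup at a fixed time; it makes their strong limit a bounded operator.\<close>

lemma uniform_boundedness:
  fixes f :: "nat \<Rightarrow> 'a::banach \<Rightarrow> 'b::real_normed_vector"
  assumes f: "\<And>n. bounded_linear (f n)" and bd: "\<And>x. bounded (range (\<lambda>n. f n x))"
  obtains M where "\<And>n x. norm (f n x) \<le> M * norm x"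
proof -
  define C where "C k = (\<Inter>n. {x. norm (f n x) \<le> real k})" for k :: nat
  have cl: "closed (C k)" for k
    unfolding C_def
    by (intro closed_INT ballI closed_Collect_le continuous_intros linear_continuous_on[OF f])
  have un: "\<Union> (range C) = UNIV"
  proof (intro equalityI subset_UNIV subsetI)
    fix x :: 'a
    obtain b where b: "\<And>n. norm (f n x) \<le> b" using bd[of x] by (auto simp: bounded_iff)
    obtain k :: nat where "b \<le> real k" using real_arch_simple by blast
    then have "x \<in> C k" using order_trans[OF b] by (simp add: C_def)
    then show "x \<in> \<Union> (range C)" by blast
  qed
  have "\<exists>k. interior (C k) \<noteq> {}"
  proof (rule ccontr)
    assume "\<not> ?thesis"
    then have "euclidean interior_of \<Union> (range C) = {}"
      by (intro Baire_category_alt) (auto simp: cl completely_metrizable_space_euclidean)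
    then show False using un by simp
  qed
  then obtain k x0 r where r: "0 < r" "cball x0 r \<subseteq> C k"
    by (meson ex_in_conv mem_interior_cball)
  \<comment> \<open>The ball is centred at \<open>x0\<close>, so a vector of length \<open>r\<close>
    is a difference of two of its points, each contributing \<open>k\<close>.\<close>
  have "norm (f n x) \<le> (2 * real k / r) * norm x" for n x
  proof (cases "x = 0")
    case False
    interpret f: bounded_linear "f n" by (rule f)
    let ?y = "(r / norm x) *\<^sub>R x"
    have ny: "norm ?y = r" using False r(1) by simp
    have "x0 \<in> C k" "x0 + ?y \<in> C k"
      using r ny by (auto simp: dist_norm intro!: subsetD[OF r(2)])
    then have "norm (f n x0) \<le> k" "norm (f n (x0 + ?y)) \<le> k" by (auto simp: C_def)
    moreover have "f n ?y = f n (x0 + ?y) - f n x0" by (simp add: f.add)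
    ultimately have "norm (f n ?y) \<le> 2 * real k" using norm_triangle_ineq4[of "f n (x0 + ?y)" "f n x0"] by simp
    moreover have "norm (f n ?y) = r / norm x * norm (f n x)" using r(1) by (simp add: f.scaleR)
    ultimately show ?thesis using False r(1) by (simp add: field_simps)
  qed (simp add: linear_0[OF bounded_linear.linear[OF f]])
  then show thesis by (rule that)
qed

lemma has_integral_shift_UNIV:
  fixes f :: "real \<Rightarrow> 'a::banach"
  assumes "(f has_integral i) UNIV"
  shows "((\<lambda>x. f (h + x)) has_integral i) UNIV"
proof (rule iffD2[OF has_integral'], intro allI impI)
  fix e :: real assume "e > 0"
  then obtain B where B: "B > 0" "\<And>a b. ball 0 B \<subseteq> cbox a b \<Longrightarrow> \<exists>z. (f has_integral z) (cbox a b) \<and> norm (z - i) < e"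
    using iffD1[OF has_integral' assms] by auto
  show "\<exists>B>0. \<forall>a b. ball 0 B \<subseteq> cbox a b \<longrightarrow>
      (\<exists>z. ((\<lambda>x. if x \<in> UNIV then f (h + x) else 0) has_integral z) (cbox a b) \<and> norm (z - i) < e)"
  \<comment> \<open>A box that contains the larger ball still contains the ball of radius
    \<open>B\<close> after being moved by \<open>h\<close>.\<close>
  proof (intro exI[of _ "B + \<bar>h\<bar>"] conjI allI impI)
    fix a b :: real assume "ball 0 (B + \<bar>h\<bar>) \<subseteq> cbox a b"
    then have sub: "y \<in> ball 0 (B + \<bar>h\<bar>) \<Longrightarrow> y \<in> cbox a b" for y by blast
    have "ball 0 B \<subseteq> cbox (a + h) (b + h)"
    proof
      fix x :: real assume "x \<in> ball 0 B"
      then have "x - h \<in> ball 0 (B + \<bar>h\<bar>)" by (auto simp: dist_norm)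
      from sub[OF this] show "x \<in> cbox (a + h) (b + h)" by auto
    qed
    then obtain z where z: "(f has_integral z) (cbox (a + h) (b + h))" "norm (z - i) < e" using B(2) by blast
    then show "\<exists>z. ((\<lambda>x. if x \<in> UNIV then f (h + x) else 0) has_integral z) (cbox a b) \<and> norm (z - i) < e"
      using has_integral_shift_real_ivl[of f z "a + h" "b + h" h] by (auto simp: add.commute)
  qed (use B(1) in auto)
qed

lemma has_vector_derivative_quotient:
  assumes "(f has_vector_derivative v) (at x)"
  shows "((\<lambda>h. (1 / h) *\<^sub>R (f (x + h) - f x)) \<longlongrightarrow> v) (at 0)"
proof -
  have "((\<lambda>h. norm (f (x + h) - f x - h *\<^sub>R v) / norm h) \<longlongrightarrow> 0) (at 0)"
    using assms by (simp add: has_vector_derivative_def has_derivative_at)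
  then have "((\<lambda>h. norm ((1 / h) *\<^sub>R (f (x + h) - f x) - v)) \<longlongrightarrow> 0) (at 0)"
  proof (rule Lim_transform_eventually)
    show "eventually (\<lambda>h. norm (f (x + h) - f x - h *\<^sub>R v) / norm h =
        norm ((1 / h) *\<^sub>R (f (x + h) - f x) - v)) (at 0)"
      unfolding eventually_at
    proof (intro exI[of _ 1] conjI ballI impI)
      fix h :: real assume "h \<noteq> 0 \<and> dist h 0 < 1"
      then have "(1 / h) *\<^sub>R (f (x + h) - f x) - v = (1 / h) *\<^sub>R (f (x + h) - f x - h *\<^sub>R v)"
        by (simp add: scaleR_diff_right)
      then show "norm (f (x + h) - f x - h *\<^sub>R v) / norm h = norm ((1 / h) *\<^sub>R (f (x + h) - f x) - v)"
        by simp
    qed simp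
  qed
  then show ?thesis by (simp add: tendsto_norm_zero_iff LIM_zero_iff)
qed

lemma scaleC_minus_one: "scaleC (- 1) x = - x"
  using scaleC_of_real[of "-1" x] by simp

lemma bounded_clinear_imp_bounded_linear:
  assumes "bounded_clinear f"
  shows "bounded_linear f"
proof -
  obtain M where M: "\<And>x. norm (f x) \<le> M * norm x" and f: "clinear f"
    using assms by (auto simp: bounded_clinear_def)
  show ?thesis
    by (rule bounded_linear_intro[where K=M])
       (use f M in \<open>auto simp: clinear_def scaleC_of_real[symmetric] mult.commute\<close>)
qed

locale bounded_analytic =
  fixes DA :: "'x::cbanach set" and A :: "'x \<Rightarrow> 'x" and T :: "real \<Rightarrow> 'x \<Rightarrow> 'x"
  assumes gen: "generates_bounded_analytic DA A T"
begin

lemma bas: "bounded_analytic_semigroup T" and neg: "neg_generates DA A T"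
  using gen by (auto simp: generates_bounded_analytic_def)

lemma T_bounded_linear: "0 \<le> t \<Longrightarrow> bounded_linear (T t)"
  using bas by (auto simp: bounded_analytic_semigroup_def intro: bounded_clinear_imp_bounded_linear)

lemma T_0 [simp]: "T 0 x = x"
  using bas by (simp add: bounded_analytic_semigroup_def)

lemma T_add: "0 \<le> s \<Longrightarrow> 0 \<le> t \<Longrightarrow> T (s + t) x = T s (T t x)"
  using bas by (simp add: bounded_analytic_semigroup_def)

lemma T_commute: "0 \<le> s \<Longrightarrow> 0 \<le> t \<Longrightarrow> T s (T t x) = T t (T s x)"
  by (metis T_add add.commute)

lemma of_real_sector: "0 < t \<Longrightarrow> 0 < \<theta> \<Longrightarrow> complex_of_real t \<in> sector \<theta>"
  by (simp add: sector_def Arg_of_real)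

lemma ex_T_bound: "\<exists>M\<ge>1. \<forall>t\<ge>0. \<forall>x. norm (T t x) \<le> M * norm x"
proof -
  obtain \<theta> Tc M where *: "0 < \<theta>" "\<forall>t>0. Tc (complex_of_real t) = T t"
      "\<forall>z\<in>sector \<theta>. bounded_clinear (Tc z) \<and> (\<forall>x. norm (Tc z x) \<le> M * norm x)"
    using bas unfolding bounded_analytic_semigroup_def by (elim conjE exE) (rule that)
  \<comment> \<open>The bound on the sector says nothing about time 0, where the identity asks for a
    constant at least 1.\<close>
  have "norm (T t x) \<le> max M 1 * norm x" if "0 \<le> t" for t x
  proof (cases "t = 0")
    case True
    then show ?thesis by (simp add: mult_le_cancel_right1)
  next
    case False
    then have "norm (T t x) \<le> M * norm x"
      using *(2)[rule_format, of t] *(3)[rule_format, OF of_real_sector[of t \<theta>]] *(1) that by simp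
    also have "\<dots> \<le> max M 1 * norm x" by (intro mult_right_mono) auto
    finally show ?thesis .
  qed
  then show ?thesis by (intro exI[of _ "max M 1"]) auto
qed

definition M where "M = (SOME M. M \<ge> 1 \<and> (\<forall>t\<ge>0. \<forall>x. norm (T t x) \<le> M * norm x))"

lemma M_ge_1: "1 \<le> M" and T_bound: "0 \<le> t \<Longrightarrow> norm (T t x) \<le> M * norm x"
  using someI_ex[OF ex_T_bound] by (auto simp: M_def)

lemma T_differentiable:
  assumes "0 < t"
  obtains v where "((\<lambda>s. T s x) has_vector_derivative v) (at t)"
proof -
  obtain \<theta> Tc where *: "0 < \<theta>" "\<forall>t>0. Tc (complex_of_real t) = T t"
      "strongly_holomorphic_on Tc (sector \<theta>)"
    using bas unfolding bounded_analytic_semigroup_def by (elim conjE exE) (rule that)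
  obtain v where v: "((\<lambda>\<zeta>. Tc \<zeta> x) has_derivative (\<lambda>h. scaleC h v)) (at (complex_of_real t))"
    using *(3) of_real_sector[OF assms *(1)] unfolding strongly_holomorphic_on_def by blast
  have "((\<lambda>s. complex_of_real s) has_derivative complex_of_real) (at t)"
    by (auto intro!: derivative_eq_intros)
  then have "((\<lambda>s. Tc (complex_of_real s) x) has_derivative (\<lambda>h. scaleC (complex_of_real h) v)) (at t)"
    by (rule has_derivative_compose[where f=complex_of_real and g="\<lambda>\<zeta>. Tc \<zeta> x" and g'="\<lambda>h. scaleC h v", OF _ v])
  then have "((\<lambda>s. Tc (complex_of_real s) x) has_vector_derivative v) (at t)"
    by (simp add: has_vector_derivative_def scaleC_of_real)
  then have "((\<lambda>s. T s x) has_vector_derivative v) (at t)"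
    by (rule has_vector_derivative_transform_within_open[where S="{0<..}"]) (use assms * in auto)
  then show thesis by (rule that)
qed

lemma T_isCont: "0 < t \<Longrightarrow> isCont (\<lambda>s. T s x) t"
  using T_differentiable has_vector_derivative_continuous by metis

section \<open>The resolvent and the Laplace integral\<close>

definition R where "R y = (THE x. x \<in> DA \<and> x + A x = y)"

lemma ex_resolvent: "\<exists>x\<in>DA. x + A x = y \<and> ((\<lambda>t. exp (- t) *\<^sub>R T t y) has_integral x) {0..}"
  using neg[unfolded neg_generates_def, THEN conjunct2, rule_format, of 1] by simp

lemma lin_op_A: "lin_op DA A"
  using neg by (simp add: neg_generates_def)

lemma DA_add: "x \<in> DA \<Longrightarrow> y \<in> DA \<Longrightarrow> x + y \<in> DA"
  and A_add: "x \<in> DA \<Longrightarrow> y \<in> DA \<Longrightarrow> A (x + y) = A x + A y"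
  and DA_scaleC: "x \<in> DA \<Longrightarrow> scaleC c x \<in> DA"
  and A_scaleC: "x \<in> DA \<Longrightarrow> A (scaleC c x) = scaleC c (A x)"
  using lin_op_A by (auto simp: lin_op_def csubspace_def)

lemma resolvent_unique:
  assumes "x \<in> DA" "y \<in> DA" "x + A x = y + A y"
  shows "x = y"
proof -
  have "x - y \<in> DA" "A (x - y) = A x - A y"
    using DA_add[OF assms(1) DA_scaleC[OF assms(2), of "-1"]]
      A_add[OF assms(1) DA_scaleC[OF assms(2), of "-1"]] A_scaleC[OF assms(2), of "-1"]
    by (simp_all add: scaleC_minus_one)
  moreover have "1 *\<^sub>R (x - y) + (A x - A y) = 0" using assms(3) by (simp add: algebra_simps)
  ultimately have "x - y \<in> DA" "1 *\<^sub>R (x - y) + A (x - y) = 0" by simp_all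
  then have "x - y = 0"
    using neg[unfolded neg_generates_def] zero_less_one by blast
  then show ?thesis by simp
qed

lemma R_eqI: "x \<in> DA \<Longrightarrow> x + A x = y \<Longrightarrow> R y = x"
  unfolding R_def using resolvent_unique by blast

lemma R_in_DA: "R y \<in> DA" and R_right: "R y + A (R y) = y"
  and R_integral: "((\<lambda>t. exp (- t) *\<^sub>R T t y) has_integral R y) {0..}"
  using ex_resolvent[of y] R_eqI by auto

lemma R_left: "x \<in> DA \<Longrightarrow> R (x + A x) = x"
  by (rule R_eqI) auto

lemma R_inj: "R x = R y \<Longrightarrow> x = y"
  by (metis R_right)

lemma R_bounded_linear: "bounded_linear R"
proof (rule bounded_linear_intro[where K=M])
  show "R (x + y) = R x + R y" for x y
    by (rule R_eqI) (use R_right[of x] R_right[of y] in \<open>auto simp: DA_add R_in_DA A_add algebra_simps\<close>)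
  show "R (r *\<^sub>R x) = r *\<^sub>R R x" for r x
    unfolding scaleC_of_real[symmetric]
    by (rule R_eqI) (auto simp: DA_scaleC R_in_DA A_scaleC scaleC_add_right[symmetric] R_right)
  show "norm (R y) \<le> norm y * M" for y
  proof -
    have e: "((\<lambda>t. exp (- t)) has_integral 1) {0::real..}"
      using has_integral_exp_minus_to_infinity[of 1 0] by simp
    have b: "((\<lambda>t. exp (- t) * (M * norm y)) has_integral M * norm y) {0::real..}"
      using has_integral_mult_left[OF e] by simp
    have "norm (integral {0..} (\<lambda>t. exp (- t) *\<^sub>R T t y)) \<le> integral {0..} (\<lambda>t. exp (- t) * (M * norm y))"
      by (rule integral_norm_bound_integral)
         (use R_integral b T_bound in \<open>auto simp: integrable_on_def intro!: mult_left_mono\<close>)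
    then show ?thesis unfolding integral_unique[OF R_integral] integral_unique[OF b] by (simp only: mult.commute)
  qed
qed

lemma T_R: "0 \<le> h \<Longrightarrow> T h (R y) = R (T h y)"
proof -
  assume h: "0 \<le> h"
  interpret T: bounded_linear "T h" by (rule T_bounded_linear[OF h])
  have "((T h \<circ> (\<lambda>t. exp (- t) *\<^sub>R T t y)) has_integral T h (R y)) {0..}"
    by (rule has_integral_linear[OF R_integral T.bounded_linear_axioms])
  then have "((\<lambda>t. exp (- t) *\<^sub>R T t (T h y)) has_integral T h (R y)) {0..}"
    by (rule has_integral_eq[rotated]) (use h in \<open>auto simp: T.scaleR T_commute\<close>)
  then show ?thesis using R_integral has_integral_unique by blast
qed

text \<open>Shifting the variable in the Laplace integral gives T(h)R y = e^h times the integral of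
  e^(-s)T(s)y over [h, \<infinity>). The formula turns orbits of vectors in D(A) into indefinite
  integrals, from which both strong continuity at 0 and the differential equation are read
  off.\<close>

lemma T_R_eq:
  assumes h: "0 \<le> h"
  shows "T h (R y) = exp h *\<^sub>R (R y - integral {0..h} (\<lambda>s. exp (- s) *\<^sub>R T s y))"
proof -
  interpret T: bounded_linear "T h" by (rule T_bounded_linear[OF h])
  let ?g = "\<lambda>s. exp (- s) *\<^sub>R T s y"
  have "(?g has_integral R y - integral {0..h} ?g) {h..}"
  proof -
    have 1: "(?g has_integral integral {0..h} ?g) {0..h}"
      by (intro integrable_integral integrable_on_subinterval[OF has_integral_integrable[OF R_integral]]) auto
    have "(?g has_integral (R y - integral {0..h} ?g)) ({0..} - {0..h})"
      by (rule has_integral_setdiff[OF R_integral 1]) auto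
    then show ?thesis
    proof (rule iffD1[OF has_integral_spike_set_eq, rotated 2])
      show "negligible {x \<in> {0..} - {0..h} - {h..}. ?g x \<noteq> 0}"
        by (rule negligible_subset[of "{}"]) auto
      show "negligible {x \<in> {h..} - ({0..} - {0..h}). ?g x \<noteq> 0}"
        by (rule negligible_subset[of "{h}"]) (use h in auto)
    qed
  qed
  then have "((\<lambda>s. if s \<in> {h..} then ?g s else 0) has_integral R y - integral {0..h} ?g) UNIV"
    by (simp only: has_integral_restrict_UNIV)
  then have "((\<lambda>s. if h + s \<in> {h..} then ?g (h + s) else 0) has_integral R y - integral {0..h} ?g) UNIV"
    by (rule has_integral_shift_UNIV)
  then have "((\<lambda>s. if s \<in> {0..} then ?g (h + s) else 0) has_integral R y - integral {0..h} ?g) UNIV"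
    by simp
  then have "((\<lambda>s. ?g (h + s)) has_integral R y - integral {0..h} ?g) {0..}"
    by (simp only: has_integral_restrict_UNIV)
  then have "((\<lambda>s. exp h *\<^sub>R ?g (h + s)) has_integral exp h *\<^sub>R (R y - integral {0..h} ?g)) {0..}"
    by (rule has_integral_cmul)
  moreover have "((T h \<circ> ?g) has_integral T h (R y)) {0..}"
    by (rule has_integral_linear[OF R_integral T.bounded_linear_axioms])
  then have "((\<lambda>s. exp h *\<^sub>R ?g (h + s)) has_integral T h (R y)) {0..}"
    by (rule has_integral_eq[rotated]) (use h in \<open>auto simp: T.scaleR T_add exp_add[symmetric]\<close>)
  ultimately show ?thesis using has_integral_unique by blast
qed

text \<open>For x = R y the formula above expresses T(t)x by an indefinite integral, which is
  continuous at 0; the uniform bound on T extends this from D(A) to its closure.\<close>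

lemma T_tendsto_0:
  assumes "x \<in> closure DA"
  shows "((\<lambda>t. T t x) \<longlongrightarrow> x) (at_right 0)"
proof -
  have DA: "((\<lambda>t. T t x) \<longlongrightarrow> x) (at_right 0)" if "x \<in> DA" for x
  proof -
    define y where "y = x + A x"
    have x: "x = R y" using R_left[OF that] by (simp add: y_def)
    let ?g = "\<lambda>s. exp (- s) *\<^sub>R T s y"
    have "?g integrable_on {0..1}"
      by (intro integrable_on_subinterval[OF has_integral_integrable[OF R_integral]]) auto
    then have "continuous_on {0..1} (\<lambda>h. integral {0..h} ?g)"
      by (rule indefinite_integral_continuous_1)
    then have "((\<lambda>h. integral {0..h} ?g) \<longlongrightarrow> integral {0..0} ?g) (at 0 within {0..1})"
      unfolding continuous_on_def by (rule bspec) simp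
    then have "((\<lambda>h. integral {0..h} ?g) \<longlongrightarrow> 0) (at_right 0)"
      by (simp add: at_within_Icc_at_right)
    then have "((\<lambda>h. exp h *\<^sub>R (R y - integral {0..h} ?g)) \<longlongrightarrow> exp 0 *\<^sub>R (R y - 0)) (at_right 0)"
      by (intro tendsto_intros)
    then have "((\<lambda>h. exp h *\<^sub>R (R y - integral {0..h} ?g)) \<longlongrightarrow> x) (at_right 0)"
      by (simp add: x)
    then show ?thesis
      by (rule Lim_transform_eventually) (auto simp: eventually_at_right_field x T_R_eq intro!: exI[of _ 1])
  qed
  show ?thesis
  proof (rule tendstoI)
    fix e :: real assume e: "e > 0"
    define e' where "e' = (e / 2) / (M + 1)"
    have e': "e' > 0" using e M_ge_1 by (simp add: e'_def)
    obtain z where z: "z \<in> DA" "dist z x < e'"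
      using assms e' closure_approachable by blast
    have "eventually (\<lambda>t. dist (T t z) z < e/2) (at_right 0)"
      by (rule tendstoD[OF DA[OF z(1)]]) (use e in simp)
    moreover have "eventually (\<lambda>t::real. t > 0) (at_right 0)" by (simp add: eventually_at_right_less)
    ultimately show "eventually (\<lambda>t. dist (T t x) x < e) (at_right 0)"
    proof eventually_elim
      case (elim t)
      interpret T: bounded_linear "T t" by (rule T_bounded_linear) (use elim in simp)
      have "norm (T t x - x) \<le> norm (T t (x - z)) + norm (T t z - z) + norm (z - x)"
        using norm_triangle_ineq[of "T t (x - z) + (T t z - z)" "z - x"]
          norm_triangle_ineq[of "T t (x - z)" "T t z - z"] by (simp add: T.diff)
      also have "\<dots> \<le> M * norm (x - z) + norm (T t z - z) + norm (z - x)"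
        using T_bound[of t "x - z"] elim by simp
      also have "\<dots> < M * e' + e/2 + e'"
        using elim z(2) M_ge_1 by (intro add_le_less_mono add_mono mult_left_mono)
          (auto simp: dist_norm norm_minus_commute)
      also have "M * e' + e/2 + e' = e"
      proof -
        have "M + 1 \<noteq> 0" using M_ge_1 by simp
        then have "e' * (M + 1) = e / 2" unfolding e'_def by (metis nonzero_eq_divide_eq)
        then show ?thesis by (simp add: algebra_simps)
      qed
      finally show ?case by (simp add: dist_norm)
    qed
  qed
qed

lemma T_continuous_on:
  assumes "x \<in> closure DA"
  shows "continuous_on {0..} (\<lambda>t. T t x)"
  unfolding continuous_on_eq_continuous_within
proof
  fix t :: real assume "t \<in> {0..}"
  then consider "t = 0" | "0 < t" by fastforce
  then show "continuous (at t within {0..}) (\<lambda>t. T t x)"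
  proof cases
    case 1
    then show ?thesis using T_tendsto_0[OF assms]
      by (simp add: continuous_within at_within_Ici_at_right)
  next
    case 2
    then show ?thesis using T_isCont continuous_at_imp_continuous_at_within by blast
  qed
qed

section \<open>The operators (I + A)T(h) for h > 0\<close>

definition S where "S h x = (THE y. R y = T h x)"

text \<open>Expresses (I + A)T(h)x = T(h)x - v, the differential equation of the orbit, without
  mentioning \<open>A\<close>. The map R T(u)x is differentiated in two ways: through the shifted
  Laplace integral the derivative is R T(h)x - T(h)x, through boundedness of R it is R v.\<close>

lemma R_derivative:
  assumes h: "0 < h" and v: "((\<lambda>s. T s x) has_vector_derivative v) (at h)"
  shows "R (T h x - v) = T h x"
proof -
  interpret R: bounded_linear R by (rule R_bounded_linear)
  let ?g = "\<lambda>s. exp (- s) *\<^sub>R T s x"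
  have "?g integrable_on {0..h+1}"
    by (intro integrable_on_subinterval[OF has_integral_integrable[OF R_integral]]) auto
  moreover have "isCont ?g h" by (intro continuous_intros T_isCont h)
  ultimately have "((\<lambda>u. integral {0..u} ?g) has_vector_derivative ?g h) (at h within ({0..h+1} - {}))"
    using h by (intro integral_has_vector_derivative_continuous_at) (auto intro: continuous_at_imp_continuous_at_within)
  then have "((\<lambda>u. integral {0..u} ?g) has_vector_derivative ?g h) (at h)"
    using h by (simp add: at_within_Icc_at)
  then have "((\<lambda>u. exp u *\<^sub>R (R x - integral {0..u} ?g)) has_vector_derivative
      (exp h *\<^sub>R (0 - ?g h) + exp h *\<^sub>R (R x - integral {0..h} ?g))) (at h)"
    by (intro has_vector_derivative_scaleR has_vector_derivative_diff has_vector_derivative_const DERIV_exp)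
  also have "exp h *\<^sub>R (0 - ?g h) + exp h *\<^sub>R (R x - integral {0..h} ?g) = R (T h x) - T h x"
    using T_R_eq[of h x] T_R[of h x] h by (simp add: exp_add[symmetric])
  finally have "((\<lambda>u. R (T u x)) has_vector_derivative R (T h x) - T h x) (at h)"
    by (rule has_vector_derivative_transform_within_open[where S="{0<..}"])
       (use h in \<open>auto simp: T_R[symmetric] T_R_eq\<close>)
  moreover have "((\<lambda>u. R (T u x)) has_vector_derivative R v) (at h)"
    using R.has_vector_derivative[OF v] .
  ultimately have "R v = R (T h x) - T h x" by (rule vector_derivative_unique_at[rotated])
  then show ?thesis by (simp add: R.diff)
qed

lemma R_S: "0 < h \<Longrightarrow> R (S h x) = T h x"
proof -
  assume h: "0 < h"
  obtain v where "((\<lambda>s. T s x) has_vector_derivative v) (at h)" using T_differentiable[OF h] .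
  then have "R (T h x - v) = T h x" by (rule R_derivative[OF h])
  then have "S h x = T h x - v" unfolding S_def using R_inj by (intro the_equality) auto
  then show ?thesis using \<open>R (T h x - v) = T h x\<close> by simp
qed

lemma S_eqI: "0 < h \<Longrightarrow> R y = T h x \<Longrightarrow> S h x = y"
  by (rule R_inj) (simp add: R_S)

lemma T_in_DA: "0 < h \<Longrightarrow> T h x \<in> DA"
  using R_in_DA[of "S h x"] by (simp add: R_S)

lemma T_closure: "0 \<le> h \<Longrightarrow> x \<in> closure DA \<Longrightarrow> T h x \<in> closure DA"
  using T_in_DA[of h x] closure_subset[of DA] by (cases "h = 0") auto

lemma S_T: "0 < h \<Longrightarrow> 0 \<le> s \<Longrightarrow> S (h + s) x = S h (T s x)"
  by (rule S_eqI) (auto simp: R_S T_add)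

lemma S_R: "0 < h \<Longrightarrow> S h (R x) = T h x"
  by (rule S_eqI) (auto simp: T_R)

text \<open>By the differential equation S(h) = T(h) - T'(h), and T'(h) is the strong limit of the
  difference quotients \<open>D n\<close>, so Banach-Steinhaus bounds it. Linearity follows from
  injectivity of R.\<close>

lemma S_bounded_linear:
  assumes h: "0 < h"
  shows "bounded_linear (S h)"
proof -
  interpret R: bounded_linear R by (rule R_bounded_linear)
  interpret T: bounded_linear "T h" by (rule T_bounded_linear) (use h in simp)
  define D where "D n x = real (Suc n) *\<^sub>R (T (h + 1 / real (Suc n)) x - T h x)" for n x
  have Dbl: "bounded_linear (D n)" for n
    unfolding D_def using h
    by (intro bounded_linear_scaleR_right[THEN bounded_linear_compose] bounded_linear_sub T_bounded_linear) auto
  have Dlim: "(\<lambda>n. D n x) \<longlonglongrightarrow> T h x - S h x" for x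
  proof -
    obtain v where v: "((\<lambda>s. T s x) has_vector_derivative v) (at h)" using T_differentiable[OF h] .
    have "S h x = T h x - v" by (rule S_eqI[OF h R_derivative[OF h v]])
    moreover have "((\<lambda>e. (1 / e) *\<^sub>R (T (h + e) x - T h x)) \<longlongrightarrow> v) (at 0)"
      using v by (rule has_vector_derivative_quotient)
    then have "((\<lambda>n. (1 / (1 / real (Suc n))) *\<^sub>R (T (h + 1 / real (Suc n)) x - T h x)) \<longlongrightarrow> v) sequentially"
      by (rule filterlim_compose)
         (use LIMSEQ_inverse_real_of_nat in \<open>auto simp: filterlim_at inverse_eq_divide\<close>)
    ultimately show ?thesis by (simp add: D_def)
  qed
  have "bounded (range (\<lambda>n. D n x))" for x using convergent_imp_bounded[OF Dlim] .
  then obtain K where K: "\<And>n x. norm (D n x) \<le> K * norm x" by (rule uniform_boundedness[OF Dbl]) (rule that)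
  have TS: "norm (T h x - S h x) \<le> K * norm x" for x
    by (rule LIMSEQ_le_const2[OF tendsto_norm[OF Dlim]]) (use K in auto)
  have bd: "norm (S h x) \<le> norm x * (K + M)" for x
    using norm_triangle_ineq4[of "T h x" "T h x - S h x"] T_bound[of h x] h TS[of x]
    by (simp add: algebra_simps)
  show ?thesis
    by (rule bounded_linear_intro[OF _ _ bd]; rule S_eqI[OF h]; simp add: R.add R.scaleR T.add T.scaleR R_S h)
qed

end

section \<open>Convolutions with the semigroup\<close>

text \<open>The convolution is known to take values in X only at almost every time, a dense set
  \<open>G\<close>. Its oscillation is estimated near each point and not uniformly on the interval,
  so the Cauchy condition is imposed locally, also at points of \<open>I\<close> outside
  \<open>G\<close>.\<close>

lemma continuous_extension_locally_Cauchy: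
  fixes f :: "real \<Rightarrow> 'a::banach"
  assumes G: "G \<subseteq> I" "I \<subseteq> closure G"
    and cau: "\<And>x e. x \<in> I \<Longrightarrow> e > 0 \<Longrightarrow>
      \<exists>d>0. \<forall>s\<in>G. \<forall>t\<in>G. dist s x < d \<longrightarrow> dist t x < d \<longrightarrow> dist (f s) (f t) \<le> e"
  obtains g where "continuous_on I g" "\<And>t. t \<in> G \<Longrightarrow> g t = f t"
proof -
  have "\<exists>l. \<forall>e>0. \<exists>d>0. \<forall>t\<in>G. dist t x < d \<longrightarrow> dist (f t) l \<le> e" if x: "x \<in> I" for x
  proof -
    obtain s where s: "\<And>n. s n \<in> G" "s \<longlonglongrightarrow> x"
      using G(2) x closure_sequential by blast
    have "Cauchy (\<lambda>n. f (s n))"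
      unfolding Cauchy_def
    proof (intro allI impI)
      fix e :: real assume "e > 0"
      then obtain d where d: "d > 0" "\<And>s t. s \<in> G \<Longrightarrow> t \<in> G \<Longrightarrow> dist s x < d \<Longrightarrow> dist t x < d \<Longrightarrow> dist (f s) (f t) \<le> e/2"
        using cau[OF x, of "e/2"] by auto
      obtain N where "\<And>n. n \<ge> N \<Longrightarrow> dist (s n) x < d" using metric_LIMSEQ_D[OF s(2) d(1)] by blast
      then show "\<exists>N. \<forall>m\<ge>N. \<forall>n\<ge>N. dist (f (s m)) (f (s n)) < e"
        using d(2)[OF s(1) s(1)] \<open>e > 0\<close> by (intro exI[of _ N]) (fastforce intro: le_less_trans[of _ "e/2"])
    qed
    then obtain l where l: "(\<lambda>n. f (s n)) \<longlonglongrightarrow> l" using Cauchy_convergent_iff convergent_def by blast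
    have "\<exists>d>0. \<forall>t\<in>G. dist t x < d \<longrightarrow> dist (f t) l \<le> e" if e: "e > 0" for e
    proof -
      obtain d where d: "d > 0" "\<And>s t. s \<in> G \<Longrightarrow> t \<in> G \<Longrightarrow> dist s x < d \<Longrightarrow> dist t x < d \<Longrightarrow> dist (f s) (f t) \<le> e"
        using cau[OF x e] by blast
      obtain N where N: "\<And>n. n \<ge> N \<Longrightarrow> dist (s n) x < d" using metric_LIMSEQ_D[OF s(2) d(1)] by blast
      have "dist (f t) l \<le> e" if t: "t \<in> G" "dist t x < d" for t
      proof (rule LIMSEQ_le_const2)
        show "(\<lambda>n. dist (f t) (f (s n))) \<longlonglongrightarrow> dist (f t) l" by (intro tendsto_intros l)
        show "\<exists>N. \<forall>n\<ge>N. dist (f t) (f (s n)) \<le> e" using d(2)[OF t(1) s(1) t(2) N] by blast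
      qed
      then show ?thesis using d(1) by blast
    qed
    then show ?thesis by blast
  qed
  then obtain g where g: "\<And>x e. x \<in> I \<Longrightarrow> e > 0 \<Longrightarrow> \<exists>d>0. \<forall>t\<in>G. dist t x < d \<longrightarrow> dist (f t) (g x) \<le> e"
    by metis
  have gG: "g t = f t" if "t \<in> G" for t
  proof -
    have "dist (f t) (g t) \<le> e" if "e > 0" for e
      using g[of t e] that \<open>t \<in> G\<close> G(1) by (metis dist_self subsetD)
    then show ?thesis by (metis dist_eq_0_iff dist_nz field_lbound_gt_zero leD)
  qed
  have "continuous_on I g"
    unfolding continuous_on_iff
  proof (intro ballI allI impI)
    fix x e :: real assume x: "x \<in> I" and e: "e > 0"
    obtain d where d: "d > 0" "\<And>t. t \<in> G \<Longrightarrow> dist t x < d \<Longrightarrow> dist (f t) (g x) \<le> e/3"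
      using g[OF x, of "e/3"] e by auto
    show "\<exists>d>0. \<forall>y\<in>I. dist y x < d \<longrightarrow> dist (g y) (g x) < e"
    proof (intro exI[of _ "d/2"] conjI ballI impI)
      fix y assume y: "y \<in> I" "dist y x < d/2"
      obtain d' where d': "d' > 0" "\<And>t. t \<in> G \<Longrightarrow> dist t y < d' \<Longrightarrow> dist (f t) (g y) \<le> e/3"
        using g[OF y(1), of "e/3"] e by auto
      obtain t where t: "t \<in> G" "dist t y < min d' (d/2)"
        using y(1) G(2) d(1) d'(1) closure_approachable[of y G] by (metis half_gt_zero min_less_iff_conj subsetD)
      have "dist t x < d" using t(2) y(2) dist_triangle[of t x y] by (simp add: dist_commute)
      then have "dist (f t) (g x) \<le> e/3" using d(2) t by blast
      moreover have "dist (f t) (g y) \<le> e/3" using d'(2) t by simp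
      ultimately show "dist (g y) (g x) < e"
        using dist_triangle[of "g y" "g x" "f t"] e by (simp add: dist_commute)
    qed (use d in simp)
  qed
  then show thesis using that gG by blast
qed

lemma tendsto_integral_left:
  fixes f :: "real \<Rightarrow> 'a::banach"
  assumes f: "(f has_integral i) {0..t}" and t: "0 < t"
    and a: "a \<longlonglongrightarrow> t" "\<And>n. a n \<le> t"
  shows "(\<lambda>n. integral {0..a n} f) \<longlonglongrightarrow> i"
proof (rule metric_LIMSEQ_I)
  fix e :: real assume e: "e > 0"
  obtain d where d: "d > 0" "\<forall>s. t - d < s \<and> s \<le> t \<longrightarrow> norm (integral {0..t} f - integral {0..s} f) < e"
    using indefinite_integral_continuous_left[OF has_integral_integrable[OF f] t order_refl e] .
  obtain N where N: "\<And>n. n \<ge> N \<Longrightarrow> dist (a n) t < d" using metric_LIMSEQ_D[OF a(1) d(1)] by blast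
  show "\<exists>N. \<forall>n\<ge>N. dist (integral {0..a n} f) i < e"
  proof (intro exI[of _ N] allI impI)
    fix n assume "n \<ge> N"
    then have "t - d < a n" using N[of n] by (auto simp: dist_real_def)
    then have "norm (integral {0..t} f - integral {0..a n} f) < e" using d(2) a(2) by blast
    then show "dist (integral {0..a n} f) i < e" using integral_unique[OF f] by (simp add: dist_norm norm_minus_commute)
  qed
qed

lemma AE_imp_exists_between:
  assumes "AE t in lebesgue. a < t \<and> t < b \<longrightarrow> P t" and "a < (b::real)"
  shows "\<exists>t. a < t \<and> t < b \<and> P t"
proof (rule ccontr)
  assume "\<not> ?thesis"
  with assms(1) have "AE t in lebesgue. t \<notin> {a<..<b}" by (auto elim!: eventually_mono)
  then have "{a<..<b} \<in> null_sets lebesgue"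
    by (subst AE_iff_null_sets) auto
  then have "{a<..<b} \<in> null_sets lborel" by (simp add: null_sets_completion_iff)
  then show False using assms(2) by (auto simp: null_sets_def)
qed

lemma rival_iff: "t \<in> rival \<eta> \<longleftrightarrow> 0 \<le> t \<and> ereal t < \<eta>"
  by (simp add: rival_def)

lemma ival_iff: "t \<in> ival \<eta> \<longleftrightarrow> 0 < t \<and> ereal t < \<eta>"
  by (simp add: ival_def)

text \<open>Here Bt stands for $(I + A_{-1})^{-1}B$, so that $T_{-1}(t)Bw$ corresponds to T t (Bt w), and to
  S t (Bt w) as an element of X for t > 0.\<close>

locale abstract_problem = bounded_analytic DA A T
  for DA :: "'x::cbanach set" and A :: "'x \<Rightarrow> 'x" and T :: "real \<Rightarrow> 'x \<Rightarrow> 'x" +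
  fixes Bt :: "'w::cbanach \<Rightarrow> 'x" and DC :: "'x set" and C :: "'x \<Rightarrow> 'z::cbanach"
    and F :: "'z \<Rightarrow> 'z \<Rightarrow> 'w" and K :: real
    and \<tau> p :: ereal and \<alpha> M0 M1 M2 M3 :: real
  assumes Bt: "bounded_linear Bt"
    and C_closed: "closed_op DC C"
    and DA_DC: "DA \<subseteq> DC" and C_X1: "\<And>x. x \<in> DA \<Longrightarrow> norm (C x) \<le> M0 * norm (x + A x)"
    and K: "K > 0" and F: "bounded_cbilinear F K"
    and p: "2 < p" and \<alpha>: "0 \<le> \<alpha>" "0 < ereal \<alpha> + inverse p" "ereal \<alpha> + inverse p < 1 / 2"
    and M1: "0 \<le> M1" and A1: "\<And>x. Lpw_le p \<alpha> \<tau> (M1 * norm x) (\<lambda>t. C (T t x))"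
    and M2: "0 \<le> M2" and A2: "\<And>c u. Lpw_le (p / 2) (2 * \<alpha>) \<tau> c u \<Longrightarrow>
      \<exists>v. AE t in lebesgue. t \<in> ival \<tau> \<longrightarrow> norm (v t) \<le> M2 * c \<and>
        ((\<lambda>s. T (t - s) (Bt (u s))) has_integral R (v t)) {0..t}"
    and M3: "0 < M3" and A3: "\<And>c u. Lpw_le (p / 2) (2 * \<alpha>) \<tau> c u \<Longrightarrow>
      \<exists>z. Lpw_le p \<alpha> \<tau> (M3 * c) z \<and> (AE t in lebesgue. t \<in> ival \<tau> \<longrightarrow>
        ((\<lambda>s. C (S (t - s) (Bt (u s)))) has_integral z t) {0..t})"
begin

lemma p_pos: "0 < p" "1 \<le> p" "p \<noteq> 0"
  using p by (cases p; simp)+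

lemma half_p: "0 < p / 2" "1 \<le> p / 2" "1 < p / 2"
  using p by (cases p; simp)+

lemma double_\<alpha>: "0 \<le> 2 * \<alpha>" "0 < ereal (2 * \<alpha>) + inverse (p / 2)" "ereal (2 * \<alpha>) + inverse (p / 2) < 1"
  using \<alpha> p by (cases p; simp add: one_ereal_def field_simps)+

lemma lin_op_C: "lin_op DC C"
  using C_closed by (simp add: closed_op_def)

lemma DC_add: "x \<in> DC \<Longrightarrow> y \<in> DC \<Longrightarrow> x + y \<in> DC"
  and C_add: "x \<in> DC \<Longrightarrow> y \<in> DC \<Longrightarrow> C (x + y) = C x + C y"
  and C_scaleR: "x \<in> DC \<Longrightarrow> C (r *\<^sub>R x) = r *\<^sub>R C x"
  using lin_op_C by (auto simp: lin_op_def csubspace_def scaleC_of_real[symmetric])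

lemma CR_bounded_linear: "bounded_linear (\<lambda>x. C (R x))"
proof (rule bounded_linear_intro[where K=M0])
  interpret R: bounded_linear R by (rule R_bounded_linear)
  have R_DC: "R x \<in> DC" for x using DA_DC R_in_DA by blast
  show "C (R (x + y)) = C (R x) + C (R y)" for x y by (simp add: R.add C_add R_DC)
  show "C (R (r *\<^sub>R x)) = r *\<^sub>R C (R x)" for r x by (simp add: R.scaleR C_scaleR R_DC)
  show "norm (C (R x)) \<le> norm x * M0" for x
    using C_X1[OF R_in_DA, of x] by (simp add: R_right mult.commute)
qed

text \<open>C is bounded only on D(A) with its graph norm. Splitting the time gives S(h) = R S(h/2)
  S(h/2), so that C S(h) is a product of the bounded operators C R and S(h/2).\<close>

lemma CS_bounded_linear:
  assumes "0 < h"
  shows "bounded_linear (\<lambda>x. C (S h x))"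
proof -
  have "C (S h x) = C (R (S (h/2) (S (h/2) x)))" for x
  proof -
    have "R (S h x) = R (R (S (h/2) (S (h/2) x)))"
      using assms T_add[of "h/2" "h/2" x] by (simp add: R_S S_T[symmetric] T_R[symmetric])
    then have "S h x = R (S (h/2) (S (h/2) x))" by (rule R_inj)
    then show ?thesis by simp
  qed
  moreover have "bounded_linear (\<lambda>x. C (R (S (h/2) (S (h/2) x))))"
    using assms by (intro bounded_linear_compose[OF CR_bounded_linear]
        bounded_linear_compose[OF S_bounded_linear] S_bounded_linear) auto
  ultimately show ?thesis by simp
qed

lemma bounded_bilinear_F: "bounded_bilinear F"
proof
  have 1: "clinear (F y)" "clinear (\<lambda>z. F z y)" "norm (F y z) \<le> K * norm y * norm z" for y z
    using F by (auto simp: bounded_cbilinear_def)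
  show "F (a + a') b = F a b + F a' b" "F b (a + a') = F b a + F b a'" for a a' b
    using 1(1)[of b] 1(2)[of b] by (auto simp: clinear_def)
  show "F (r *\<^sub>R a) b = r *\<^sub>R F a b" "F b (r *\<^sub>R a) = r *\<^sub>R F b a" for a b r
    using 1(1)[of b] 1(2)[of b] by (auto simp: clinear_def scaleC_of_real[symmetric])
  show "\<exists>K. \<forall>a b. norm (F a b) \<le> norm a * norm b * K"
    using 1(3) by (intro exI[of _ K]) (simp add: mult_ac)
qed

lemma norm_F: "norm (F y z) \<le> K * norm y * norm z"
  using F by (simp add: bounded_cbilinear_def)

lemma Lpw_le_F:
  assumes "Lpw_le p \<alpha> \<eta> c y" "Lpw_le p \<alpha> \<eta> d z"
  shows "Lpw_le (p / 2) (2 * \<alpha>) \<eta> (K * c * d) (\<lambda>t. F (y t) (z t))"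
proof (rule Lpw_le_product[OF p_pos(1) assms])
  have "continuous_on UNIV (\<lambda>q. F (fst q) (snd q))"
    by (intro bounded_bilinear.continuous_on[OF bounded_bilinear_F] continuous_intros)
  then show "strongly_measurable_on (ival \<eta>) (\<lambda>t. F (y t) (z t))"
    by (intro strongly_measurable_on_compose2[OF ival_sets Lpw_leD(1)[OF assms(1)] Lpw_leD(1)[OF assms(2)]])
       (simp add: case_prod_beta)
  show "0 \<le> K" using K by simp
  show "AE t in lebesgue. t \<in> ival \<eta> \<longrightarrow> norm (F (y t) (z t)) \<le> K * norm (y t) * norm (z t)"
    by (intro AE_I2 impI norm_F)
qed

text \<open>The operator T(t - s) is used only as a strongly continuous function of s < t. Rounding
  \<open>s\<close> to a grid leaves finitely many operators, and the uniform bound \<open>M\<close>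
  allows operator and vector to be approximated at the same time.\<close>

lemma strongly_measurable_on_T:
  assumes u: "strongly_measurable_on {0<..<t} u"
  shows "strongly_measurable_on {0<..<t} (\<lambda>s. T (t - s) (Bt (u s)))"
proof -
  have S: "{0<..<t} \<in> sets lebesgue" by simp
  obtain r where r: "\<And>n::nat. simple_function lebesgue (r n)"
    and lim: "AE s in lebesgue. s \<in> {0<..<t} \<longrightarrow> (\<lambda>n. r n s) \<longlonglongrightarrow> u s"
    using strongly_measurable_on_simple_obtain[OF S u] by blast
  \<comment> \<open>Rounding down keeps \<open>t - q n s\<close> nonnegative, and the value 0
    outside the interval keeps the range finite.\<close>
  define q where "q n s = (if s \<in> {0..t} then of_int \<lfloor>real (Suc n) * s\<rfloor> / real (Suc n) else 0)" for n and s :: real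
  have q: "simple_function lebesgue (q n)" for n
  proof (rule simple_function_borel_measurable)
    have "(\<lambda>s. of_int \<lfloor>real (Suc n) * s\<rfloor> / real (Suc n)) \<in> borel_measurable lebesgue"
      by (intro measurable_completion) measurable
    then show "q n \<in> borel_measurable lebesgue"
      unfolding q_def by (intro measurable_If_set) auto
    have "range (q n) \<subseteq> insert 0 ((\<lambda>k. of_int k / real (Suc n)) ` {0..\<lfloor>real (Suc n) * t\<rfloor>})"
    proof (intro image_subsetI)
      fix s
      show "q n s \<in> insert 0 ((\<lambda>k. of_int k / real (Suc n)) ` {0..\<lfloor>real (Suc n) * t\<rfloor>})"
      proof (cases "s \<in> {0..t}")
        case True
        then have "\<lfloor>real (Suc n) * s\<rfloor> \<in> {0..\<lfloor>real (Suc n) * t\<rfloor>}"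
          by (auto intro!: floor_mono mult_left_mono simp del: of_nat_Suc)
        then show ?thesis using True unfolding q_def by simp
      next
        case False
        then have "q n s = 0" by (auto simp: q_def)
        then show ?thesis by simp
      qed
    qed
    then show "finite (q n ` space lebesgue)" by (simp add: finite_subset)
  qed
  have qb: "0 \<le> q n s" "q n s \<le> s" "s - 1 / real (Suc n) \<le> q n s" if "s \<in> {0<..<t}" for n s
  proof -
    have "of_int \<lfloor>real (Suc n) * s\<rfloor> \<le> real (Suc n) * s" "real (Suc n) * s - 1 \<le> of_int \<lfloor>real (Suc n) * s\<rfloor>"
      by linarith+
    then have "of_int \<lfloor>real (Suc n) * s\<rfloor> / real (Suc n) \<le> s"
      "s - 1 / real (Suc n) \<le> of_int \<lfloor>real (Suc n) * s\<rfloor> / real (Suc n)"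
      by (simp_all add: divide_le_eq le_divide_eq left_diff_distrib right_diff_distrib mult.commute del: of_nat_Suc)
    then show "q n s \<le> s" "s - 1 / real (Suc n) \<le> q n s"
      using that unfolding q_def by simp_all
    show "0 \<le> q n s" using that by (simp add: q_def del: of_nat_Suc)
  qed
  interpret Bt: bounded_linear Bt by (rule Bt)
  have "AE s in lebesgue. s \<in> {0<..<t} \<longrightarrow> (\<lambda>n. T (t - q n s) (Bt (r n s))) \<longlonglongrightarrow> T (t - s) (Bt (u s))"
    using lim
  proof eventually_elim
    case (elim s)
    show ?case
    proof
      assume s: "s \<in> {0<..<t}"
      have nn: "0 \<le> t - q n s" for n using qb[OF s, of n] s by auto
      have "(\<lambda>n. q n s) \<longlonglongrightarrow> s"
      proof (rule tendsto_sandwich[where h="\<lambda>n. s" and f="\<lambda>n. s - 1 / real (Suc n)"])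
        have "(\<lambda>n. s - inverse (real (Suc n))) \<longlonglongrightarrow> s - 0"
          by (intro tendsto_intros LIMSEQ_inverse_real_of_nat)
        then show "(\<lambda>n. s - 1 / real (Suc n)) \<longlonglongrightarrow> s" by (simp add: inverse_eq_divide)
        show "eventually (\<lambda>n. s - 1 / real (Suc n) \<le> q n s) sequentially" "eventually (\<lambda>n. q n s \<le> s) sequentially"
          using qb[OF s] by (auto simp del: of_nat_Suc)
      qed simp
      then have "(\<lambda>n. t - q n s) \<longlonglongrightarrow> t - s" by (intro tendsto_intros)
      then have 1: "(\<lambda>n. T (t - q n s) (Bt (u s))) \<longlonglongrightarrow> T (t - s) (Bt (u s))"
        by (rule isCont_tendsto_compose[OF T_isCont, rotated]) (use s in auto)
      have "(\<lambda>n. T (t - q n s) (Bt (r n s)) - T (t - q n s) (Bt (u s))) \<longlonglongrightarrow> 0"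
      proof (rule Lim_null_comparison)
        show "eventually (\<lambda>n. norm (T (t - q n s) (Bt (r n s)) - T (t - q n s) (Bt (u s))) \<le> M * norm (Bt (r n s) - Bt (u s))) sequentially"
          using T_bound[OF nn] by (intro always_eventually allI)
            (simp add: linear_diff[OF bounded_linear.linear[OF T_bounded_linear[OF nn]], symmetric])
        have "(\<lambda>n. M * norm (Bt (r n s) - Bt (u s))) \<longlonglongrightarrow> M * norm (Bt (u s) - Bt (u s))"
          using elim s by (intro tendsto_intros Bt.tendsto) auto
        then show "(\<lambda>n. M * norm (Bt (r n s) - Bt (u s))) \<longlonglongrightarrow> 0" by simp
      qed
      from tendsto_add[OF this 1] show "(\<lambda>n. T (t - q n s) (Bt (r n s))) \<longlonglongrightarrow> T (t - s) (Bt (u s))" by simp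
    qed
  qed
  then show ?thesis unfolding strongly_measurable_on_iff_simple[OF S]
    by (intro exI[of _ "\<lambda>n s. T (t - q n s) (Bt (r n s))"]) (auto intro: simple_function_compose2 q r)
qed

lemma bochner_integrable_conv:
  assumes u: "Lpw_le (p / 2) (2 * \<alpha>) \<eta> c u" and t: "0 \<le> t" "ereal t < \<eta>"
  shows "bochner_integrable_on (\<lambda>s. T (t - s) (Bt (u s))) {0..t}"
proof -
  \<comment> \<open>At s = 0 the input is unconstrained and at s = t the semigroup is evaluated at
    time 0; both points are discarded.\<close>
  have ae: "AE s in lebesgue. s \<noteq> 0 \<and> s \<noteq> t"
    using AE_lborel_singleton[of 0] AE_lborel_singleton[of t] AE_completion
    by (intro AE_conjI) blast+
  have sub: "s \<in> ival \<eta>" if "0 < s" "s \<le> t" for s using ivalI[OF that t(2)] .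
  have "strongly_measurable_on {0<..<t} u"
    by (rule strongly_measurable_on_mono_AE[OF _ _ Lpw_leD(1)[OF u]]) (use sub in auto)
  from strongly_measurable_on_T[OF this]
  have sm: "strongly_measurable_on {0..t} (\<lambda>s. T (t - s) (Bt (u s)))"
  proof (rule strongly_measurable_on_mono_AE[rotated 2])
    show "AE s in lebesgue. s \<in> {0..t} \<longrightarrow> s \<in> {0<..<t} \<and> T (t - s) (Bt (u s)) = T (t - s) (Bt (u s))"
      using ae by eventually_elim auto
  qed simp_all
  obtain b where b: "0 < b" "\<And>w. norm (Bt w) \<le> norm w * b"
    using bounded_linear.pos_bounded[OF Bt] by blast
  have smu: "strongly_measurable_on {0<..t} u"
    by (rule strongly_measurable_on_mono_AE[OF _ _ Lpw_leD(1)[OF u]]) (use sub in auto)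
  have meas: "(\<lambda>s. indicator {0<..t} s * ennreal (norm (u s))) \<in> borel_measurable lebesgue"
  proof -
    have "(\<lambda>s. if s \<in> {0<..t} then norm (u s) else 0) \<in> borel_measurable lebesgue"
      by (rule borel_measurable_norm_if[OF _ smu]) simp
    then have "(\<lambda>s. ennreal (if s \<in> {0<..t} then norm (u s) else 0)) \<in> borel_measurable lebesgue"
      by (rule measurable_compose[OF _ measurable_ennreal])
    also have "(\<lambda>s. ennreal (if s \<in> {0<..t} then norm (u s) else 0)) = (\<lambda>s. indicator {0<..t} s * ennreal (norm (u s)))"
      by (auto simp: indicator_def fun_eq_iff)
    finally show ?thesis .
  qed
  have "(\<integral>\<^sup>+ s. indicator {0..t} s * ennreal (norm (T (t - s) (Bt (u s)))) \<partial>lebesgue)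
    \<le> (\<integral>\<^sup>+ s. ennreal (M * b) * (indicator {0<..t} s * ennreal (norm (u s))) \<partial>lebesgue)"
  proof (rule nn_integral_mono_AE)
    show "AE s in lebesgue. indicator {0..t} s * ennreal (norm (T (t - s) (Bt (u s))))
       \<le> ennreal (M * b) * (indicator {0<..t} s * ennreal (norm (u s)))"
      using ae
    proof eventually_elim
      case (elim s)
      show ?case
      proof (cases "s \<in> {0<..t}")
        case True
        then have "norm (T (t - s) (Bt (u s))) \<le> M * norm (Bt (u s))" by (intro T_bound) auto
        also have "\<dots> \<le> M * (norm (u s) * b)" using b M_ge_1 by (intro mult_left_mono) auto
        finally show ?thesis using True M_ge_1 b
          by (simp add: ennreal_mult'[symmetric] ennreal_leI mult_ac)
      qed (use elim in \<open>auto simp: indicator_def\<close>)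
    qed
  qed
  also have "\<dots> = ennreal (M * b) * (\<integral>\<^sup>+ s. indicator {0<..t} s * ennreal (norm (u s)) \<partial>lebesgue)"
    by (rule nn_integral_cmult[OF meas])
  also have "\<dots> < \<infinity>"
    using Lpw_le_locally_integrable[OF half_p(3) double_\<alpha>(1,3) u t(2)] by (simp add: ennreal_mult_less_top)
  finally show ?thesis using sm by (simp add: bochner_integrable_on_def)
qed

text \<open>The convolution of [A2] pulled back by (I + A_{-1})^{-1}: the identity
  \<open>R v = conv u t\<close> says that the convolution at time \<open>t\<close>, an element of
  X_{-1}, belongs to X and equals \<open>v\<close>.\<close>

definition conv :: "(real \<Rightarrow> 'w) \<Rightarrow> real \<Rightarrow> 'x" where
  "conv u t = integral {0..t} (\<lambda>s. T (t - s) (Bt (u s)))"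

text \<open>The convolution of [A3], with C S(t - s)Bt for the kernel CT_{-1}(t - s)B. Where the
  integral fails to exist the value is a default, so identities for it are claimed at almost every
  time.\<close>

definition Cconv :: "(real \<Rightarrow> 'w) \<Rightarrow> real \<Rightarrow> 'z" where
  "Cconv u t = integral {0..t} (\<lambda>s. C (S (t - s) (Bt (u s))))"

lemma conv_0 [simp]: "conv u 0 = 0"
  by (simp add: conv_def)

lemma has_integral_conv:
  assumes "Lpw_le (p / 2) (2 * \<alpha>) \<eta> c u" "0 \<le> t" "ereal t < \<eta>"
  shows "((\<lambda>s. T (t - s) (Bt (u s))) has_integral conv u t) {0..t}"
  unfolding conv_def
  by (intro integrable_integral bochner_integrable_on_imp_integrable_on bochner_integrable_conv[OF assms])

lemma has_integral_conv_initial: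
  assumes u: "Lpw_le (p / 2) (2 * \<alpha>) \<eta> c u" and a: "0 \<le> a" "a \<le> t" and t: "ereal t < \<eta>"
  shows "((\<lambda>s. T (t - s) (Bt (u s))) has_integral T (t - a) (conv u a)) {0..a}"
proof -
  have "ereal a < \<eta>" using a t by (metis ereal_less_eq(3) le_less_trans)
  from has_integral_linear[OF has_integral_conv[OF u a(1) this] T_bounded_linear[of "t - a"]]
  have "((T (t - a) \<circ> (\<lambda>s. T (a - s) (Bt (u s)))) has_integral T (t - a) (conv u a)) {0..a}" using a by simp
  then show ?thesis
    by (rule has_integral_eq[rotated]) (use a in \<open>auto simp: T_add[symmetric]\<close>)
qed

lemma Lpw_le_half_translation:
  assumes u: "Lpw_le (p / 2) (2 * \<alpha>) \<eta> c u" and a: "0 \<le> a" and sub: "\<And>t. t \<in> ival \<eta>' \<Longrightarrow> a + t \<in> ival \<eta>"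
  shows "Lpw_le (p / 2) (2 * \<alpha>) \<eta>' c (\<lambda>t. u (a + t))"
  by (rule Lpw_le_translation[OF half_p(1) double_\<alpha>(1) u a sub])

text \<open>The restart formula: the past acts through T(t - a) alone, and what remains is a
  convolution over a short interval, to which [A2] can be applied with a small input.\<close>

lemma conv_split:
  assumes u: "Lpw_le (p / 2) (2 * \<alpha>) \<eta> c u" and a: "0 \<le> a" "a \<le> t" and t: "ereal t < \<eta>"
  shows "conv u t = T (t - a) (conv u a) + conv (\<lambda>s. u (a + s)) (t - a)"
proof -
  have int: "(\<lambda>s. T (t - s) (Bt (u s))) integrable_on {0..t}"
    using has_integral_conv[OF u _ t] a by (auto simp: integrable_on_def)
  have "conv u t = integral {0..a} (\<lambda>s. T (t - s) (Bt (u s))) + integral {a..t} (\<lambda>s. T (t - s) (Bt (u s)))"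
    unfolding conv_def using Henstock_Kurzweil_Integration.integral_combine[OF a int] by simp
  also have "integral {0..a} (\<lambda>s. T (t - s) (Bt (u s))) = T (t - a) (conv u a)"
    by (rule integral_unique[OF has_integral_conv_initial[OF u a t]])
  also have "integral {a..t} (\<lambda>s. T (t - s) (Bt (u s))) = conv (\<lambda>s. u (a + s)) (t - a)"
    using integral_shift_real_ivl[of a a t "\<lambda>s. T (t - s) (Bt (u s))"] by (simp add: conv_def add.commute diff_diff_eq algebra_simps)
  finally show ?thesis .
qed

text \<open>Causality: the convolution at time t sees the input only up to t, so extension by zero
  changes nothing there and [A2] holds on shorter intervals with the same constant. The end point 0,
  which is outside \<open>ival \<eta>\<close>, is removed as a spike.\<close>

lemma A2_local:
  assumes u: "Lpw_le (p / 2) (2 * \<alpha>) \<eta> c u" and \<eta>: "\<eta> \<le> \<tau>"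
  shows "\<exists>v. AE t in lebesgue. t \<in> ival \<eta> \<longrightarrow> norm (v t) \<le> M2 * c \<and> R (v t) = conv u t"
proof -
  let ?u = "\<lambda>t. if t \<in> ival \<eta> then u t else 0"
  obtain v where v: "AE t in lebesgue. t \<in> ival \<tau> \<longrightarrow> norm (v t) \<le> M2 * c \<and>
        ((\<lambda>s. T (t - s) (Bt (?u s))) has_integral R (v t)) {0..t}"
    using A2[OF Lpw_le_extend_0[OF half_p(1) u, of \<tau>]] by blast
  have "R (v t) = conv u t"
    if t: "t \<in> ival \<eta>" and i: "((\<lambda>s. T (t - s) (Bt (?u s))) has_integral R (v t)) {0..t}" for t
  proof -
    have "((\<lambda>s. T (t - s) (Bt (u s))) has_integral R (v t)) {0..t}"
      by (rule has_integral_spike_finite[OF _ _ i, of "{0}"]) (use t ivalI[of _ t \<eta>] in \<open>auto simp: ival_iff\<close>)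
    then show ?thesis by (simp add: conv_def integral_unique)
  qed
  moreover have "t \<in> ival \<tau>" if "t \<in> ival \<eta>" for t using ival_mono[OF that \<eta>] .
  ultimately have "AE t in lebesgue. t \<in> ival \<eta> \<longrightarrow> norm (v t) \<le> M2 * c \<and> R (v t) = conv u t"
    using v by (auto elim!: eventually_mono)
  then show ?thesis by blast
qed

lemma A3_local:
  assumes u: "Lpw_le (p / 2) (2 * \<alpha>) \<eta> c u" and \<eta>: "\<eta> \<le> \<tau>"
  shows "Lpw_le p \<alpha> \<eta> (M3 * c) (Cconv u)"
    and "AE t in lebesgue. t \<in> ival \<eta> \<longrightarrow> ((\<lambda>s. C (S (t - s) (Bt (u s)))) has_integral Cconv u t) {0..t}"
proof -
  let ?u = "\<lambda>t. if t \<in> ival \<eta> then u t else 0"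
  obtain z where z: "Lpw_le p \<alpha> \<tau> (M3 * c) z" "AE t in lebesgue. t \<in> ival \<tau> \<longrightarrow>
        ((\<lambda>s. C (S (t - s) (Bt (?u s)))) has_integral z t) {0..t}"
    using A3[OF Lpw_le_extend_0[OF half_p(1) u, of \<tau>]] by blast
  have *: "((\<lambda>s. C (S (t - s) (Bt (u s)))) has_integral z t) {0..t}"
    if t: "t \<in> ival \<eta>" and i: "((\<lambda>s. C (S (t - s) (Bt (?u s)))) has_integral z t) {0..t}" for t
    by (rule has_integral_spike_finite[OF _ _ i, of "{0}"]) (use t ivalI[of _ t \<eta>] in \<open>auto simp: ival_iff\<close>)
  have eq: "AE t in lebesgue. t \<in> ival \<eta> \<longrightarrow> ((\<lambda>s. C (S (t - s) (Bt (u s)))) has_integral z t) {0..t}"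
    using z(2) by eventually_elim (use * ival_mono[OF _ \<eta>] in blast)
  then show "AE t in lebesgue. t \<in> ival \<eta> \<longrightarrow> ((\<lambda>s. C (S (t - s) (Bt (u s)))) has_integral Cconv u t) {0..t}"
    by eventually_elim (auto simp: Cconv_def integral_unique)
  show "Lpw_le p \<alpha> \<eta> (M3 * c) (Cconv u)"
  proof (rule Lpw_le_cong_AE[OF p_pos(1) Lpw_le_restrict[OF p_pos(1) \<alpha>(1) z(1) \<eta>]])
    show "AE t in lebesgue. t \<in> ival \<eta> \<longrightarrow> Cconv u t = z t"
      using eq by eventually_elim (auto simp: Cconv_def integral_unique)
  qed
qed

text \<open>Operator and vector move together. The uniform bound on T absorbs the change of the
  vector, and strong continuity at 0 finishes the limit, which is why \<open>v t\<close> has to lie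
  in the closure of D(A). It lets integrals over [0, t] be approached through restarts at earlier
  times.\<close>

lemma tendsto_T_diagonal:
  assumes v: "continuous_on (rival \<eta>) v" "v t \<in> closure DA" and t: "t \<in> rival \<eta>"
    and a: "a \<longlonglongrightarrow> t" "\<And>n. 0 \<le> a n" "\<And>n. a n \<le> t"
  shows "(\<lambda>n. T (t - a n) (v (a n))) \<longlonglongrightarrow> v t"
proof -
  have "a n \<in> rival \<eta>" for n
    using t a(2,3)[of n] le_less_trans[of "ereal (a n)" "ereal t" \<eta>] by (simp add: rival_iff)
  then have va: "(\<lambda>n. v (a n)) \<longlonglongrightarrow> v t"
    using continuous_on_tendsto_compose[OF v(1) a(1) t] by simp
  have "(\<lambda>n. t - a n) \<longlonglongrightarrow> t - t" by (intro tendsto_intros a)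
  then have "(\<lambda>n. t - a n) \<longlonglongrightarrow> 0" by simp
  then have 1: "(\<lambda>n. T (t - a n) (v t)) \<longlonglongrightarrow> T 0 (v t)"
    using continuous_on_tendsto_compose[OF T_continuous_on[OF v(2)], of "\<lambda>n. t - a n" 0 sequentially] a(3) by simp
  have "(\<lambda>n. T (t - a n) (v (a n)) - T (t - a n) (v t)) \<longlonglongrightarrow> 0"
  proof (rule Lim_null_comparison)
    have nn: "0 \<le> t - a n" for n using a(3) by simp
    show "eventually (\<lambda>n. norm (T (t - a n) (v (a n)) - T (t - a n) (v t)) \<le> M * norm (v (a n) - v t)) sequentially"
      using T_bound[OF nn] by (intro always_eventually allI)
        (simp add: linear_diff[OF bounded_linear.linear[OF T_bounded_linear[OF nn]], symmetric])
    have "(\<lambda>n. M * norm (v (a n) - v t)) \<longlonglongrightarrow> M * norm (v t - v t)" by (intro tendsto_intros va)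
    then show "(\<lambda>n. M * norm (v (a n) - v t)) \<longlonglongrightarrow> 0" by simp
  qed
  from tendsto_add[OF this 1] show ?thesis by simp
qed

text \<open>Both integrals over [0, a] with a < t are images of the convolution at a under
  bounded operators, so that closedness of C can be used as a tends to t, although the integrand need
  not be integrable in X up to the end point t.\<close>

lemma C_conv:
  assumes u: "Lpw_le (p / 2) (2 * \<alpha>) \<eta> c u"
    and v: "continuous_on (rival \<eta>) v" "\<And>t. t \<in> rival \<eta> \<Longrightarrow> v t \<in> closure DA" "\<And>t. t \<in> rival \<eta> \<Longrightarrow> R (v t) = conv u t"
    and t: "t \<in> ival \<eta>" and z: "((\<lambda>s. C (S (t - s) (Bt (u s)))) has_integral z) {0..t}"
  shows "v t \<in> DC" "C (v t) = z"
proof -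
  have t0: "0 < t" "ereal t < \<eta>" "t \<in> rival \<eta>" using t by (auto simp: ival_iff rival_iff)
  define a where "a n = t - t / real (Suc (Suc n))" for n
  have a: "0 \<le> a n" "a n < t" for n using t0 by (auto simp: a_def field_simps)
  have a_lim: "a \<longlonglongrightarrow> t"
  proof -
    have "(\<lambda>n. t - t * inverse (real (Suc (Suc n)))) \<longlonglongrightarrow> t - t * 0"
      by (intro tendsto_intros LIMSEQ_Suc[OF LIMSEQ_inverse_real_of_nat])
    then show ?thesis by (simp add: a_def[abs_def] divide_inverse)
  qed
  have ar: "a n \<in> rival \<eta>" for n
    using t0 a[of n] less_trans[of "ereal (a n)" "ereal t" \<eta>] by (simp add: rival_iff)
  have 1: "(\<lambda>n. T (t - a n) (v (a n))) \<longlonglongrightarrow> v t"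
    by (rule tendsto_T_diagonal[OF v(1) v(2)]) (use t0 a a_lim in \<open>auto simp: less_imp_le\<close>)
  \<comment> \<open>For s \<le> a n the kernel factors as S(t - s) = S(t - a n) T(a n - s), the
    bounded operator C S(t - a n) leaves the integral, and S(t - a n) R = T(t - a n) turns
    \<open>conv u (a n) = R (v (a n))\<close> into the stated value.\<close>
  have eq: "integral {0..a n} (\<lambda>s. C (S (t - s) (Bt (u s)))) = C (T (t - a n) (v (a n)))" for n
  proof (rule integral_unique)
    have h: "0 < t - a n" using a[of n] by simp
    have "(((\<lambda>x. C (S (t - a n) x)) \<circ> (\<lambda>s. T (a n - s) (Bt (u s)))) has_integral C (S (t - a n) (conv u (a n)))) {0..a n}"
      using ar[of n] by (intro has_integral_linear[OF has_integral_conv[OF u] CS_bounded_linear[OF h]]) (auto simp: rival_iff)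
    then have "((\<lambda>s. C (S (t - s) (Bt (u s)))) has_integral C (S (t - a n) (conv u (a n)))) {0..a n}"
      by (rule has_integral_eq[rotated]) (use h in \<open>auto simp: S_T[symmetric]\<close>)
    then show "((\<lambda>s. C (S (t - s) (Bt (u s)))) has_integral C (T (t - a n) (v (a n)))) {0..a n}"
      using v(3)[OF ar, symmetric] S_R[OF h] by simp
  qed
  have 2: "(\<lambda>n. C (T (t - a n) (v (a n)))) \<longlonglongrightarrow> z"
    using tendsto_integral_left[OF z t0(1) a_lim] a by (simp add: eq less_imp_le)
  have "(T (t - a n) (v (a n)), C (T (t - a n) (v (a n)))) \<in> {(x, C x) | x. x \<in> DC}" for n
    using T_in_DA[of "t - a n"] a[of n] DA_DC by auto
  then have "(v t, z) \<in> {(x, C x) | x. x \<in> DC}"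
    using closed_sequentially[of "{(x, C x) | x. x \<in> DC}" "\<lambda>n. (T (t - a n) (v (a n)), C (T (t - a n) (v (a n))))" "(v t, z)"]
      tendsto_Pair[OF 1 2] C_closed by (simp add: closed_op_def)
  then show "v t \<in> DC" "C (v t) = z" by auto
qed

end

context abstract_problem
begin

text \<open>Near each point the part of the convolution that stems from a short time interval is
  small in X uniformly, and the remaining part is continuous because of the semigroup. The exceptional
  null sets depend on the splitting point, so only countably many of these are used.\<close>

lemma conv_continuous:
  assumes u: "Lpw_le (p / 2) (2 * \<alpha>) \<eta> c u" and \<eta>: "\<eta> \<le> \<tau>" "0 < \<eta>"
    and small: "\<And>e. e > 0 \<Longrightarrow> \<exists>d>0. ereal d \<le> \<eta> \<and> Lpw_le (p / 2) (2 * \<alpha>) (ereal d) e u"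
  obtains v where "continuous_on (rival \<eta>) v" "\<And>t. t \<in> rival \<eta> \<Longrightarrow> v t \<in> closure DA"
    "\<And>t. t \<in> rival \<eta> \<Longrightarrow> R (v t) = conv u t" "v 0 = 0"
proof -
  interpret R: bounded_linear R by (rule R_bounded_linear)
  obtain v' where v': "AE t in lebesgue. t \<in> ival \<eta> \<longrightarrow> norm (v' t) \<le> M2 * c \<and> R (v' t) = conv u t"
    using A2_local[OF u \<eta>(1)] by blast
  \<comment> \<open>[A2] gives no value at time 0; there the empty convolution is 0, and 0 is needed
    as a restart point.\<close>
  define v0 where "v0 t = (if t = 0 then 0 else v' t)" for t
  define G0 where "G0 = {t \<in> ival \<eta>. R (v0 t) = conv u t}"
  have G0: "AE t in lebesgue. t \<in> ival \<eta> \<longrightarrow> t \<in> G0"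
    using v' by eventually_elim (auto simp: G0_def v0_def ival_iff)
  obtain D0 where D0: "countable D0" "D0 \<subseteq> G0" "G0 \<subseteq> closure D0"
    using separable[of G0] .
  define D where "D = insert 0 D0"
  have D: "countable D" "\<And>a. a \<in> D \<Longrightarrow> R (v0 a) = conv u a" "\<And>a. a \<in> D \<Longrightarrow> 0 \<le> a"
    using D0 by (auto simp: D_def G0_def v0_def ival_iff R.zero)
  \<comment> \<open>A triple is a restart point, a window length and a bound for the restarted
    input. Restart points come from a countable dense set and the other entries are rational, so the
    null sets on which [A2] fails for some restarted input have a null union.\<close>
  define I where "I = {(a, b, e). a \<in> D \<and> b \<in> \<rat> \<and> e \<in> \<rat> \<and> ereal (a + b) \<le> \<eta> \<and>
    Lpw_le (p / 2) (2 * \<alpha>) (ereal b) e (\<lambda>s. u (a + s))}"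
  have "I \<subseteq> D \<times> \<rat> \<times> \<rat>" by (auto simp: I_def)
  then have I: "countable I"
    by (rule countable_subset) (intro countable_SIGMA D(1) countable_rat)
  have "AE t in lebesgue. \<forall>(a, b, e)\<in>I. t - a \<in> ival (ereal b) \<longrightarrow>
      (\<exists>w. norm w \<le> M2 * e \<and> R w = conv (\<lambda>s. u (a + s)) (t - a))"
    unfolding case_prod_beta
  proof (subst AE_ball_countable[OF I], rule ballI)
    fix i assume i: "i \<in> I"
    obtain a b e where abe: "i = (a, b, e)" by (cases i)
    have L: "Lpw_le (p / 2) (2 * \<alpha>) (ereal b) e (\<lambda>s. u (a + s))" and a: "a \<in> D" and ab: "ereal (a + b) \<le> \<eta>"
      using i by (auto simp: I_def abe)
    have "ereal b \<le> \<tau>" using D(3)[OF a] ab \<eta>(1) order_trans[of "ereal b" "ereal (a + b)" \<tau>] by (auto intro: order_trans)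
    then obtain w where "AE t in lebesgue. t \<in> ival (ereal b) \<longrightarrow> norm (w t) \<le> M2 * e \<and> R (w t) = conv (\<lambda>s. u (a + s)) t"
      using A2_local[OF L] by blast
    then have "AE t in lebesgue. - a + t \<in> ival (ereal b) \<longrightarrow>
        norm (w (- a + t)) \<le> M2 * e \<and> R (w (- a + t)) = conv (\<lambda>s. u (a + s)) (- a + t)"
      by (rule AE_lebesgue_translation)
    then show "AE t in lebesgue. t - fst i \<in> ival (ereal (fst (snd i))) \<longrightarrow>
        (\<exists>w. norm w \<le> M2 * snd (snd i) \<and> R w = conv (\<lambda>s. u (fst i + s)) (t - fst i))"
      by eventually_elim (auto simp: abe)
  qed
  then have "AE t in lebesgue. t \<in> ival \<eta> \<longrightarrow> t \<in> G0 \<and> (\<forall>(a, b, e)\<in>I. t - a \<in> ival (ereal b) \<longrightarrow>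
      (\<exists>w. norm w \<le> M2 * e \<and> R w = conv (\<lambda>s. u (a + s)) (t - a)))"
    using G0 by eventually_elim blast
  moreover define G where "G = {t \<in> G0. \<forall>(a, b, e)\<in>I. t - a \<in> ival (ereal b) \<longrightarrow>
      (\<exists>w. norm w \<le> M2 * e \<and> R w = conv (\<lambda>s. u (a + s)) (t - a))}"
  ultimately have AEG: "AE t in lebesgue. t \<in> ival \<eta> \<longrightarrow> t \<in> G" by simp
  have Gsub: "t \<in> ival \<eta>" "R (v0 t) = conv u t" if "t \<in> G" for t using that by (auto simp: G_def G0_def)
  have between: "\<exists>t\<in>G. a < t \<and> t < b" if "0 \<le> a" "a < b" "ereal b < \<eta>" for a b
  proof -
    have "t \<in> ival \<eta>" if "a < t" "t < b" for t
      using that \<open>0 \<le> a\<close> \<open>ereal b < \<eta>\<close> less_trans[of "ereal t" "ereal b" \<eta>] by (auto simp: ival_iff)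
    then have "AE t in lebesgue. a < t \<and> t < b \<longrightarrow> t \<in> G" using AEG by (auto elim!: eventually_mono)
    from AE_imp_exists_between[OF this that(2)] show ?thesis by blast
  qed
  \<comment> \<open>By the restart formula the difference is the contribution of the input after
    time \<open>a\<close>, bounded through [A2]; injectivity of R lifts the identity to X.\<close>
  have est: "norm (v0 t - T (t - a) (v0 a)) \<le> M2 * e"
    if t: "t \<in> G" and i: "(a, b, e) \<in> I" and ab: "a < t" "t < a + b" for t a b e
  proof -
    have a: "a \<in> D" using i by (simp add: I_def)
    have "t - a \<in> ival (ereal b)" using ab by (auto simp: ival_iff)
    then obtain w where w: "norm w \<le> M2 * e" "R w = conv (\<lambda>s. u (a + s)) (t - a)"
      using t i by (auto simp: G_def)
    have "R (v0 t) = T (t - a) (R (v0 a)) + R w"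
      using conv_split[OF u D(3)[OF a], of t] ab Gsub[OF t] D(2)[OF a] w(2) by (simp add: ival_iff)
    also have "\<dots> = R (T (t - a) (v0 a) + w)" using ab by (simp add: R.add T_R)
    finally have "v0 t = T (t - a) (v0 a) + w" by (rule R_inj)
    then show ?thesis using w by simp
  qed
  \<comment> \<open>The restart point is taken strictly before \<open>t0\<close>: the orbit of
    \<open>v0 a\<close>, not yet known to start in the closure of D(A), is continuous at positive
    times.\<close>
  have local: "\<exists>a b e. (a, b, e) \<in> I \<and> a < t0 \<and> t0 < a + b \<and> M2 * e \<le> \<epsilon>"
    if t0: "t0 \<in> ival \<eta>" and \<epsilon>: "\<epsilon> > 0" for t0 \<epsilon>
  proof -
    obtain e where e: "e \<in> \<rat>" "0 < e" "e < \<epsilon> / (M2 + 1)"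
      using Rats_dense_in_real[of 0 "\<epsilon> / (M2 + 1)"] \<epsilon> M2 by auto
    have "M2 * e \<le> (M2 + 1) * e" using e by (simp add: algebra_simps)
    also have "\<dots> \<le> \<epsilon>" using e(3) M2 by (simp add: pos_less_divide_eq mult.commute less_imp_le)
    finally have eb: "M2 * e \<le> \<epsilon>" .
    obtain d where d: "0 < d" "ereal (t0 + 2 * d) < \<eta>"
      "\<And>a. 0 \<le> a \<Longrightarrow> t0 - d < a \<Longrightarrow> a \<le> t0 \<Longrightarrow> Lpw_le (p / 2) (2 * \<alpha>) (ereal (2 * d)) e (\<lambda>t. u (a + t))"
      using Lpw_le_translation_small[OF half_p(1) double_\<alpha>(1,2) u, of t0 e] t0 e by (auto simp: ival_iff)
    define lo where "lo = max 0 (t0 - d)"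
    have lo: "0 \<le> lo" "lo < t0" using t0 d(1) by (auto simp: lo_def ival_iff)
    obtain t1 where t1: "t1 \<in> G" "lo < t1" "t1 < t0" using between[OF lo] t0 by (auto simp: ival_iff)
    have "t1 \<in> closure D0" using t1 D0(3) by (auto simp: G_def)
    then obtain a where a: "a \<in> D0" "dist a t1 < min (t1 - lo) (t0 - t1)"
      using t1 by (metis closure_approachable diff_gt_0_iff_gt min_less_iff_conj)
    have a': "lo < a" "a < t0" using a(2) by (auto simp: dist_real_def)
    \<comment> \<open>Since a > t0 - d, a length above \<open>d\<close> reaches past
      \<open>t0\<close>, and a length below \<open>2 * d\<close> keeps the smallness.\<close>
    obtain b where b: "b \<in> \<rat>" "d < b" "b < 2 * d" using Rats_dense_in_real[of d "2 * d"] d(1) by auto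
    have L: "Lpw_le (p / 2) (2 * \<alpha>) (ereal (2 * d)) e (\<lambda>t. u (a + t))"
      by (rule d(3)) (use a' lo in \<open>auto simp: lo_def\<close>)
    have "Lpw_le (p / 2) (2 * \<alpha>) (ereal b) e (\<lambda>t. u (a + t))"
      by (rule Lpw_le_restrict[OF half_p(1) double_\<alpha>(1) L]) (use b in simp)
    moreover have "ereal (a + b) \<le> \<eta>"
      using a' b d(2) order_trans[of "ereal (a + b)" "ereal (t0 + 2 * d)" \<eta>] by simp
    ultimately have "(a, b, e) \<in> I" using a b e by (simp add: I_def D_def)
    moreover have "t0 < a + b" using a' b by (auto simp: lo_def)
    ultimately show ?thesis using a' eb by blast
  qed
  \<comment> \<open>At time 0 no earlier restart exists and smallness is not automatic for infinite
    exponents, so it is taken from the hypothesis \<open>small\<close>.\<close>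
  have local0: "\<exists>b e. (0, b, e) \<in> I \<and> 0 < b \<and> M2 * e \<le> \<epsilon>" if \<epsilon>: "\<epsilon> > 0" for \<epsilon>
  proof -
    obtain e where e: "e \<in> \<rat>" "0 < e" "e < \<epsilon> / (M2 + 1)"
      using Rats_dense_in_real[of 0 "\<epsilon> / (M2 + 1)"] \<epsilon> M2 by auto
    have "M2 * e \<le> (M2 + 1) * e" using e by (simp add: algebra_simps)
    also have "\<dots> \<le> \<epsilon>" using e(3) M2 by (simp add: pos_less_divide_eq mult.commute less_imp_le)
    finally have eb: "M2 * e \<le> \<epsilon>" .
    obtain d where d: "0 < d" "ereal d \<le> \<eta>" "Lpw_le (p / 2) (2 * \<alpha>) (ereal d) e u" using small[OF e(2)] by blast
    obtain b where b: "b \<in> \<rat>" "0 < b" "b < d" using Rats_dense_in_real[of 0 d] d(1) by auto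
    have "Lpw_le (p / 2) (2 * \<alpha>) (ereal b) e (\<lambda>t. u (0 + t))"
      using Lpw_le_restrict[OF half_p(1) double_\<alpha>(1) d(3), of "ereal b"] b by simp
    moreover have "ereal (0 + b) \<le> \<eta>" using b d(2) order_trans[of "ereal b" "ereal d" \<eta>] by simp
    ultimately have "(0, b, e) \<in> I" using b e by (simp add: I_def D_def)
    then show ?thesis using b eb by blast
  qed
  define G' where "G' = insert 0 G"
  have G'sub: "G' \<subseteq> rival \<eta>" using Gsub(1) \<eta>(2) by (auto simp: G'_def ival_iff rival_iff zero_ereal_def[symmetric] less_imp_le)
  have G'clos: "rival \<eta> \<subseteq> closure G'"
  proof
    fix t assume t: "t \<in> rival \<eta>"
    show "t \<in> closure G'"
    proof (cases "t = 0")
      case True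
      then show ?thesis using closure_subset[of G'] by (auto simp: G'_def)
    next
      case False
      then have t: "0 < t" "ereal t < \<eta>" using t by (auto simp: rival_iff)
      show ?thesis unfolding closure_approachable
      proof (intro allI impI)
        fix e :: real assume "e > 0"
        then obtain s where "s \<in> G" "max 0 (t - e) < s" "s < t" using between[of "max 0 (t - e)" t] t by auto
        then show "\<exists>y\<in>G'. dist y t < e" by (auto simp: G'_def dist_real_def intro!: bexI[of _ s])
      qed
    qed
  qed
  have cau: "\<exists>d>0. \<forall>s\<in>G'. \<forall>t\<in>G'. dist s x < d \<longrightarrow> dist t x < d \<longrightarrow> dist (v0 s) (v0 t) \<le> \<epsilon>"
    if x: "x \<in> rival \<eta>" and \<epsilon>: "\<epsilon> > 0" for x \<epsilon>
  proof (cases "x = 0")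
    case True
    obtain b e where b: "(0, b, e) \<in> I" "0 < b" "M2 * e \<le> \<epsilon> / 2" using local0[of "\<epsilon> / 2"] \<epsilon> by auto
    have n: "norm (v0 t) \<le> \<epsilon> / 2" if "t \<in> G'" "dist t x < b" for t
    proof (cases "t = 0")
      case False
      then have t: "t \<in> G" using that by (simp add: G'_def)
      then have "0 < t" using Gsub by (auto simp: ival_iff)
      then have "norm (v0 t - T (t - 0) (v0 0)) \<le> M2 * e"
        using that True by (intro est[OF t b(1)]) (auto simp: dist_real_def)
      moreover have "T (t - 0) (v0 0) = 0"
        using linear_0[OF bounded_linear.linear[OF T_bounded_linear[of t]]] \<open>0 < t\<close> by (simp add: v0_def)
      ultimately show ?thesis using b(3) by simp
    qed (use \<epsilon> in \<open>simp add: v0_def\<close>)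
    show ?thesis
    proof (intro exI[of _ b] conjI ballI impI)
      fix s t assume "s \<in> G'" "t \<in> G'" "dist s x < b" "dist t x < b"
      then show "dist (v0 s) (v0 t) \<le> \<epsilon>"
        using n[of s] n[of t] norm_triangle_ineq4[of "v0 s" "v0 t"] by (simp add: dist_norm)
    qed (rule b(2))
  next
    case False
    then have x: "x \<in> ival \<eta>" using x by (simp add: rival_iff ival_iff)
    obtain a b e where i: "(a, b, e) \<in> I" "a < x" "x < a + b" "M2 * e \<le> \<epsilon> / 4"
      using local[OF x, of "\<epsilon> / 4"] \<epsilon> by auto
    have a0: "0 \<le> a" using i(1) D(3) by (simp add: I_def)
    have "isCont (\<lambda>t. T (t - a) (v0 a)) x"
      using isCont_o2[of x "\<lambda>t. t - a" "\<lambda>s. T s (v0 a)"] T_isCont[of "x - a"] i(2) by simp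
    then obtain r where r: "r > 0" "\<And>t. dist t x < r \<Longrightarrow> dist (T (t - a) (v0 a)) (T (x - a) (v0 a)) < \<epsilon> / 4"
      unfolding continuous_at_eps_delta using \<epsilon> by (metis divide_pos_pos zero_less_numeral)
    define d where "d = min r (min (x - a) (a + b - x))"
    have d: "d > 0" using r i by (simp add: d_def)
    have n: "dist (v0 t) (T (x - a) (v0 a)) \<le> \<epsilon> / 2" if t: "t \<in> G'" "dist t x < d" for t
    proof -
      have t': "a < t" "t < a + b" "dist t x < r" using t(2) by (auto simp: d_def dist_real_def)
      then have "t \<in> G" using t(1) a0 by (auto simp: G'_def)
      from est[OF this i(1) t'(1,2)] have "dist (v0 t) (T (t - a) (v0 a)) \<le> \<epsilon> / 4" using i(4) by (simp add: dist_norm)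
      then show ?thesis using r(2)[OF t'(3)] dist_triangle[of "v0 t" "T (x - a) (v0 a)" "T (t - a) (v0 a)"] by simp
    qed
    show ?thesis
    proof (intro exI[of _ d] conjI ballI impI)
      fix s t assume "s \<in> G'" "t \<in> G'" "dist s x < d" "dist t x < d"
      then show "dist (v0 s) (v0 t) \<le> \<epsilon>"
        using n[of s] n[of t] dist_triangle2[of "v0 s" "v0 t" "T (x - a) (v0 a)"] by simp
    qed (rule d)
  qed
  obtain v where v: "continuous_on (rival \<eta>) v" "\<And>t. t \<in> G' \<Longrightarrow> v t = v0 t"
    using continuous_extension_locally_Cauchy[OF G'sub G'clos cau] by blast
  have v_0: "v 0 = 0" using v(2)[of 0] by (simp add: G'_def v0_def)
  \<comment> \<open>Up to an arbitrarily small error \<open>v t\<close> equals some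
    \<open>T (s - a) (v0 a)\<close> with s > a, and analyticity puts such vectors into D(A).\<close>
  have clos: "v t \<in> closure DA" if t: "t \<in> rival \<eta>" for t
  proof (cases "t = 0")
    case True
    then show ?thesis using R_in_DA[of 0] closure_subset[of DA] by (auto simp: v_0 R.zero)
  next
    case False
    then have t': "t \<in> ival \<eta>" using t by (simp add: rival_iff ival_iff)
    show ?thesis unfolding closure_approachable
    proof (intro allI impI)
      fix \<epsilon> :: real assume \<epsilon>: "\<epsilon> > 0"
      obtain a b e where i: "(a, b, e) \<in> I" "a < t" "t < a + b" "M2 * e \<le> \<epsilon> / 2"
        using local[OF t', of "\<epsilon> / 2"] \<epsilon> by auto
      obtain d where d: "d > 0" "\<And>s. s \<in> rival \<eta> \<Longrightarrow> dist s t < d \<Longrightarrow> dist (v s) (v t) < \<epsilon> / 2"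
        using v(1)[unfolded continuous_on_iff] t \<epsilon> by (metis half_gt_zero)
      have "0 \<le> max a (t - d)" "max a (t - d) < t" using i d(1) D(3)[of a] by (auto simp: I_def max_def)
      from between[OF this] t' obtain s where s: "s \<in> G" "max a (t - d) < s" "s < t"
        by (auto simp: ival_iff)
      have "norm (v0 s - T (s - a) (v0 a)) \<le> \<epsilon> / 2" using est[OF s(1) i(1)] s i by simp
      moreover have "v s = v0 s" "s \<in> rival \<eta>" using v(2) s(1) G'sub by (auto simp: G'_def)
      moreover have "dist (v s) (v t) < \<epsilon> / 2" using d(2)[OF \<open>s \<in> rival \<eta>\<close>] s by (simp add: dist_real_def)
      ultimately have "dist (T (s - a) (v0 a)) (v t) < \<epsilon>"
        using dist_triangle[of "T (s - a) (v0 a)" "v t" "v s"] by (simp add: dist_norm norm_minus_commute)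
      then show "\<exists>y\<in>DA. dist y (v t) < \<epsilon>" using T_in_DA[of "s - a"] s by auto
    qed
  qed
  \<comment> \<open>Known on \<open>G\<close> only; a general time is approached from the left
    through \<open>G\<close>, and the integral up to \<open>a n\<close> is T(t - a n) applied to
    \<open>R (v (a n))\<close>.\<close>
  have "R (v t) = conv u t" if t: "t \<in> rival \<eta>" for t
  proof (cases "t = 0")
    case True
    then show ?thesis by (simp add: v_0 R.zero)
  next
    case False
    then have t': "0 < t" "ereal t < \<eta>" using t by (auto simp: rival_iff)
    have "\<exists>a\<in>G. max 0 (t - 1 / real (Suc n)) < a \<and> a < t" for n using between[of "max 0 (t - 1 / real (Suc n))" t] t' by auto
    then obtain a where a: "\<And>n. a n \<in> G" "\<And>n. max 0 (t - 1 / real (Suc n)) < a n" "\<And>n. a n < t"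
      by metis
    have a_lim: "a \<longlonglongrightarrow> t"
    proof (rule tendsto_sandwich[where f="\<lambda>n. t - inverse (real (Suc n))" and h="\<lambda>n. t"])
      have "(\<lambda>n. t - inverse (real (Suc n))) \<longlonglongrightarrow> t - 0"
        by (intro tendsto_intros LIMSEQ_inverse_real_of_nat)
      then show "(\<lambda>n. t - inverse (real (Suc n))) \<longlonglongrightarrow> t" by simp
      show "eventually (\<lambda>n. t - inverse (real (Suc n)) \<le> a n) sequentially" "eventually (\<lambda>n. a n \<le> t) sequentially"
        using a(2,3) by (auto simp: inverse_eq_divide less_imp_le simp del: of_nat_Suc intro!: always_eventually)
    qed simp
    have a0: "0 \<le> a n" for n using a(2)[of n] by simp
    have "(\<lambda>n. integral {0..a n} (\<lambda>s. T (t - s) (Bt (u s)))) \<longlonglongrightarrow> conv u t"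
      by (rule tendsto_integral_left[OF has_integral_conv[OF u _ t'(2)] t'(1) a_lim]) (use t' a(3) in \<open>auto simp: less_imp_le\<close>)
    moreover have "integral {0..a n} (\<lambda>s. T (t - s) (Bt (u s))) = R (T (t - a n) (v (a n)))" for n
    proof -
      have "integral {0..a n} (\<lambda>s. T (t - s) (Bt (u s))) = T (t - a n) (conv u (a n))"
        by (rule integral_unique[OF has_integral_conv_initial[OF u a0 _ t'(2)]]) (use a(3) in \<open>simp add: less_imp_le\<close>)
      also have "conv u (a n) = R (v (a n))" using Gsub[OF a(1)] v(2)[of "a n"] a(1) by (simp add: G'_def)
      finally show ?thesis using a(3)[of n] by (simp add: T_R)
    qed
    moreover have "(\<lambda>n. R (T (t - a n) (v (a n)))) \<longlonglongrightarrow> R (v t)"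
      by (intro R.tendsto tendsto_T_diagonal[OF v(1) clos[OF t] t a_lim a0]) (use a(3) in \<open>simp add: less_imp_le\<close>)
    ultimately show ?thesis using LIMSEQ_unique by fastforce
  qed
  then show thesis using that v(1) clos v_0 by blast
qed

text \<open>The minimal bound is the norm as a real number. An estimate of a function by a multiple
  of its own norm can then be read as an inequality for that number.\<close>

lemma Lpw_le_minimal:
  assumes "Lpw_le p \<alpha> \<eta> c f"
  obtains N where "Lpw_le p \<alpha> \<eta> N f" "\<And>d. Lpw_le p \<alpha> \<eta> d f \<Longrightarrow> N \<le> d"
proof -
  let ?S = "{d. Lpw_le p \<alpha> \<eta> d f}"
  have bdd: "bdd_below ?S" by (auto simp: bdd_below_def intro!: exI[of _ 0] dest: Lpw_leD(2))
  have ne: "?S \<noteq> {}" using assms by blast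
  have "Lpw_le p \<alpha> \<eta> (Inf ?S) f"
  proof (rule Lpw_le_closed)
    fix e :: real assume "e > 0"
    then obtain d where "Lpw_le p \<alpha> \<eta> d f" "d < Inf ?S + e"
      using cInf_lessD[OF ne, of "Inf ?S + e"] by auto
    then show "Lpw_le p \<alpha> \<eta> (Inf ?S + e) f" using Lpw_le_weaken by (meson less_imp_le)
  qed (use ne in \<open>auto intro!: cInf_greatest dest: Lpw_leD(2)\<close>)
  then show thesis using that cInf_lower[OF _ bdd] by auto
qed

section \<open>Contraction estimates for the output equation\<close>

lemma CS_diff: "0 < h \<Longrightarrow> C (S h (Bt (x - y))) = C (S h (Bt x)) - C (S h (Bt y))"
  using linear_diff[OF bounded_linear.linear[OF CS_bounded_linear]] linear_diff[OF bounded_linear.linear[OF Bt]] by metis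

text \<open>Linearity of \<open>Cconv\<close> requires both integrals to exist, which [A3] ensures
  at almost every time.\<close>

lemma Cconv_diff:
  assumes u: "Lpw_le (p / 2) (2 * \<alpha>) \<eta> c u" and u': "Lpw_le (p / 2) (2 * \<alpha>) \<eta> c' u'"
    and w: "Lpw_le (p / 2) (2 * \<alpha>) \<eta> d (\<lambda>t. u t - u' t)" and \<eta>: "\<eta> \<le> \<tau>"
  shows "Lpw_le p \<alpha> \<eta> (M3 * d) (\<lambda>t. Cconv u t - Cconv u' t)"
proof (rule Lpw_le_cong_AE[OF p_pos(1) A3_local(1)[OF w \<eta>]])
  show "AE t in lebesgue. t \<in> ival \<eta> \<longrightarrow> Cconv u t - Cconv u' t = Cconv (\<lambda>t. u t - u' t) t"
    using A3_local(2)[OF u \<eta>] A3_local(2)[OF u' \<eta>]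
  proof eventually_elim
    case (elim t)
    show ?case
    proof
      assume t: "t \<in> ival \<eta>"
      have "((\<lambda>s. C (S (t - s) (Bt (u s))) - C (S (t - s) (Bt (u' s)))) has_integral Cconv u t - Cconv u' t) {0..t}"
        using elim t by (intro has_integral_diff) auto
      \<comment> \<open>The integrands may differ at s = t, where \<open>S 0\<close> is not known to
        be linear.\<close>
      then have "((\<lambda>s. C (S (t - s) (Bt (u s - u' s)))) has_integral Cconv u t - Cconv u' t) {0..t}"
        by (rule has_integral_spike_finite[of "{t}", rotated 2]) (auto simp: CS_diff)
      then show "Cconv u t - Cconv u' t = Cconv (\<lambda>t. u t - u' t) t" by (simp add: Cconv_def integral_unique)
    qed
  qed
qed

lemma F_diff: "F y y - F y' y' = F y (y - y') + F (y - y') y'"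
  by (simp add: bounded_bilinear.diff_left[OF bounded_bilinear_F] bounded_bilinear.diff_right[OF bounded_bilinear_F])

lemma Lpw_le_F_diff:
  assumes y: "Lpw_le p \<alpha> \<eta> r y" and y': "Lpw_le p \<alpha> \<eta> r y'"
    and w: "Lpw_le p \<alpha> \<eta> e (\<lambda>t. y t - y' t)"
  shows "Lpw_le (p / 2) (2 * \<alpha>) \<eta> (2 * K * r * e) (\<lambda>t. F (y t) (y t) - F (y' t) (y' t))"
  using Lpw_le_add[OF half_p(2) Lpw_le_F[OF y w] Lpw_le_F[OF w y']]
  by (simp add: F_diff algebra_simps)

text \<open>Here \<open>a\<close> is the free output CT(.)x of an initial value x, which changes
  when the problem is restarted.\<close>

definition fixed_point :: "ereal \<Rightarrow> (real \<Rightarrow> 'z) \<Rightarrow> (real \<Rightarrow> 'z) \<Rightarrow> bool" where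
  "fixed_point \<eta> a y \<longleftrightarrow> (AE t in lebesgue. t \<in> ival \<eta> \<longrightarrow> y t = a t + Cconv (\<lambda>s. F (y s) (y s)) t)"

lemma fixed_point_contract:
  assumes y: "Lpw_le p \<alpha> \<eta> r y" and y': "Lpw_le p \<alpha> \<eta> r y'"
    and w: "Lpw_le p \<alpha> \<eta> e (\<lambda>t. y t - y' t)" and \<eta>: "\<eta> \<le> \<tau>"
  shows "Lpw_le p \<alpha> \<eta> (2 * M3 * K * r * e)
    (\<lambda>t. Cconv (\<lambda>s. F (y s) (y s)) t - Cconv (\<lambda>s. F (y' s) (y' s)) t)"
  using Cconv_diff[OF Lpw_le_F[OF y y] Lpw_le_F[OF y' y'] Lpw_le_F_diff[OF y y' w] \<eta>]
  by (simp add: mult_ac)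

text \<open>With 8 M3 K d \<le> 1 the ball of radius 2d is mapped into itself, as d + M3 K (2d)^2
  \<le> 3d/2, and the Lipschitz constant 2 M3 K (2d) there is at most 1/2. Picard iterates are
  followed pointwise: their successive differences have summable norms, so they converge almost
  everywhere.\<close>

lemma ex_fixed_point:
  assumes a: "Lpw_le p \<alpha> \<eta> d a" and \<eta>: "\<eta> \<le> \<tau>" and d: "8 * M3 * K * d \<le> 1"
  obtains y where "Lpw_le p \<alpha> \<eta> (2 * d) y" "fixed_point \<eta> a y"
proof -
  have d0: "0 \<le> d" using a by (rule Lpw_leD)
  define \<Phi> where "\<Phi> y = (\<lambda>t. a t + Cconv (\<lambda>s. F (y s) (y s)) t)" for y
  have \<Phi>: "Lpw_le p \<alpha> \<eta> (2 * d) (\<Phi> y)" if y: "Lpw_le p \<alpha> \<eta> (2 * d) y" for y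
  proof -
    have "Lpw_le p \<alpha> \<eta> (d + M3 * (K * (2 * d) * (2 * d))) (\<Phi> y)"
      unfolding \<Phi>_def by (intro Lpw_le_add[OF p_pos(2) a] A3_local(1)[OF Lpw_le_F[OF y y] \<eta>])
    moreover have "M3 * (K * (2 * d) * (2 * d)) \<le> d"
      using mult_right_mono[OF d d0] d0 by (simp add: algebra_simps)
    ultimately show ?thesis using Lpw_le_weaken by fastforce
  qed
  have contr: "Lpw_le p \<alpha> \<eta> (e / 2) (\<lambda>t. \<Phi> y t - \<Phi> y' t)"
    if y: "Lpw_le p \<alpha> \<eta> (2 * d) y" and y': "Lpw_le p \<alpha> \<eta> (2 * d) y'"
      and w: "Lpw_le p \<alpha> \<eta> e (\<lambda>t. y t - y' t)" for y y' e
  proof -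
    have "2 * M3 * K * (2 * d) * e \<le> e / 2"
      using mult_right_mono[OF d Lpw_leD(2)[OF w]] by (simp add: algebra_simps)
    then show ?thesis using Lpw_le_weaken[OF fixed_point_contract[OF y y' w \<eta>]] by (simp add: \<Phi>_def)
  qed
  define Y where "Y n = (\<Phi> ^^ n) a" for n
  have Y_Suc: "Y (Suc n) = \<Phi> (Y n)" for n by (simp add: Y_def)
  have Yb: "Lpw_le p \<alpha> \<eta> (2 * d) (Y n)" for n
  proof (induction n)
    case 0
    show ?case using Lpw_le_weaken[OF a] d0 by (simp add: Y_def)
  qed (simp add: Y_Suc \<Phi>)
  \<comment> \<open>Two members of the ball are at distance at most 4d, and each iteration halves
    the distance.\<close>
  have Yd: "Lpw_le p \<alpha> \<eta> (4 * d / 2 ^ n) (\<lambda>t. Y (Suc n) t - Y n t)" for n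
  proof (induction n)
    case 0
    show ?case using Lpw_le_diff[OF p_pos(2) Yb[of 1] Yb[of 0]] by simp
  next
    case (Suc n)
    show ?case using contr[OF Yb Yb Suc] by (simp add: Y_Suc[symmetric] mult.commute)
  qed
  have geo: "(\<Sum>k<n. 4 * d / 2 ^ k) \<le> 8 * d" for n :: nat
  proof -
    have "(\<Sum>k<n. 4 * d / 2 ^ k) = 8 * d - 8 * d / 2 ^ n"
      by (induction n) (auto simp: field_simps)
    then show ?thesis using d0 by simp
  qed
  define g where "g n t = (\<Sum>k<n. norm (Y (Suc k) t - Y k t))" for n t
  have gL: "Lpw_le p \<alpha> \<eta> (\<Sum>k<n. 4 * d / 2 ^ k) (g n)" for n
  proof (induction n)
    case 0
    show ?case using Lpw_le_zero[OF p_pos(1)] by (simp add: g_def[abs_def])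
  next
    case (Suc n)
    have "strongly_measurable_on (ival \<eta>) (\<lambda>t. norm (Y (Suc n) t - Y n t))"
      by (intro strongly_measurable_on_compose[OF ival_sets Lpw_leD(1)[OF Yd]] continuous_intros)
    then have "Lpw_le p \<alpha> \<eta> (1 * (4 * d / 2 ^ n)) (\<lambda>t. norm (Y (Suc n) t - Y n t))"
      by (intro Lpw_le_mono_AE[OF p_pos(1) Yd]) auto
    then show ?case using Lpw_le_add[OF p_pos(2) Suc] by (simp add: g_def[abs_def])
  qed
  have "AE t in lebesgue. t \<in> ival \<eta> \<longrightarrow> bdd_above (range (\<lambda>n. g n t))"
    by (rule Lpw_le_incseq_bounded[OF p_pos(1) Lpw_le_weaken[OF gL geo]]) (auto simp: g_def intro: sum_nonneg)
  then have conv: "AE t in lebesgue. t \<in> ival \<eta> \<longrightarrow> convergent (\<lambda>n. Y n t)"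
  proof eventually_elim
    case (elim t)
    show ?case
    proof
      assume "t \<in> ival \<eta>"
      then have "bdd_above (range (\<lambda>n. g n t))" by (rule elim[THEN mp])
      then obtain b where "\<And>n. g n t \<le> b" by (auto simp: bdd_above_def)
      then have "summable (\<lambda>k. norm (Y (Suc k) t - Y k t))"
        by (intro summableI_nonneg_bounded) (auto simp: g_def)
      then have "summable (\<lambda>k. Y (Suc k) t - Y k t)" by (rule summable_norm_cancel)
      then have "convergent (\<lambda>n. \<Sum>k<n. Y (Suc k) t - Y k t)" by (simp add: summable_iff_convergent)
      then have "convergent (\<lambda>n. Y n t - Y 0 t)" by (simp only: sum_lessThan_telescope[of "\<lambda>k. Y k t"])
      then obtain l where "(\<lambda>n. Y n t - Y 0 t) \<longlonglongrightarrow> l" by (auto simp: convergent_def)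
      from tendsto_add[OF this tendsto_const[of "Y 0 t"]] show "convergent (\<lambda>n. Y n t)" by (auto simp: convergent_def)
    qed
  qed
  define y where "y t = lim (\<lambda>n. Y n t)" for t
  have lim: "AE t in lebesgue. t \<in> ival \<eta> \<longrightarrow> (\<lambda>n. Y n t) \<longlonglongrightarrow> y t"
    using conv by eventually_elim (simp add: y_def convergent_LIMSEQ_iff)
  have yb: "Lpw_le p \<alpha> \<eta> (2 * d) y" by (rule Lpw_le_Fatou[OF p_pos(1) Yb lim])
  have Ydm: "Lpw_le p \<alpha> \<eta> (8 * d / 2 ^ n) (\<lambda>t. Y (m + n) t - Y n t)" for m n
  proof -
    have "Lpw_le p \<alpha> \<eta> (8 * d / 2 ^ n - 8 * d / 2 ^ (m + n)) (\<lambda>t. Y (m + n) t - Y n t)"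
    proof (induction m)
      case 0
      show ?case using Lpw_le_zero[OF p_pos(1)] by simp
    next
      case (Suc m)
      have "Lpw_le p \<alpha> \<eta> ((8 * d / 2 ^ n - 8 * d / 2 ^ (m + n)) + 4 * d / 2 ^ (m + n))
          (\<lambda>t. (Y (m + n) t - Y n t) + (Y (Suc (m + n)) t - Y (m + n) t))"
        by (rule Lpw_le_add[OF p_pos(2) Suc Yd])
      also have "8 * d / 2 ^ n - 8 * d / 2 ^ (m + n) + 4 * d / 2 ^ (m + n) = 8 * d / 2 ^ n - 8 * d / 2 ^ (Suc m + n)"
        by simp
      finally show ?case by simp
    qed
    then show ?thesis by (rule Lpw_le_weaken) (use d0 in simp)
  qed
  have yd: "Lpw_le p \<alpha> \<eta> (8 * d / 2 ^ n) (\<lambda>t. y t - Y n t)" for n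
  proof (rule Lpw_le_Fatou[OF p_pos(1) Ydm])
    show "AE t in lebesgue. t \<in> ival \<eta> \<longrightarrow> (\<lambda>m. Y (m + n) t - Y n t) \<longlonglongrightarrow> y t - Y n t"
      using lim by eventually_elim (auto intro!: tendsto_intros LIMSEQ_ignore_initial_segment)
  qed
  \<comment> \<open>Split as (y - Y(n+1)) + (\<Phi> Y(n) - \<Phi> y); each part has norm at most 4d
    / 2^n.\<close>
  have "Lpw_le p \<alpha> \<eta> 0 (\<lambda>t. y t - \<Phi> y t)"
  proof (rule Lpw_le_closed)
    fix e :: real assume e: "e > 0"
    have "(\<lambda>n. 8 * d * (1/2) ^ n) \<longlonglongrightarrow> 8 * d * 0" by (intro tendsto_intros LIMSEQ_realpow_zero) auto
    then have "eventually (\<lambda>n. 8 * d * (1/2) ^ n < e) sequentially" using e by (intro order_tendstoD(2)) auto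
    then obtain n where n: "8 * d * (1/2) ^ n < e" using eventually_happens'[OF sequentially_bot] by blast
    have "Lpw_le p \<alpha> \<eta> (8 * d / 2 ^ n / 2) (\<lambda>t. \<Phi> (Y n) t - \<Phi> y t)"
      using Lpw_le_minus[OF p_pos(1) contr[OF yb Yb yd[of n]]] by simp
    from Lpw_le_add[OF p_pos(2) yd[of "Suc n"] this]
    have "Lpw_le p \<alpha> \<eta> (8 * d / 2 ^ Suc n + 8 * d / 2 ^ n / 2) (\<lambda>t. y t - \<Phi> y t)"
      by (simp add: Y_Suc)
    then show "Lpw_le p \<alpha> \<eta> (0 + e) (\<lambda>t. y t - \<Phi> y t)"
      by (rule Lpw_le_weaken) (use n in \<open>simp add: power_divide\<close>)
  qed simp
  then have "AE t in lebesgue. t \<in> ival \<eta> \<longrightarrow> y t - \<Phi> y t = 0" by (rule Lpw_le_0D[OF p_pos(1)])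
  then have "fixed_point \<eta> a y" by (auto simp: fixed_point_def \<Phi>_def elim!: eventually_mono)
  then show thesis using that yb by blast
qed

text \<open>On a shorter interval the norm N of the solution satisfies N \<le> d' + N/4: one factor
  of the quadratic term is bounded by 2d, which leaves a multiple of N with coefficient 2 M3 K d
  \<le> 1/4. The result is the smallness near time 0 that continuity of the convolution
  requires.\<close>

lemma fixed_point_bound:
  assumes fp: "fixed_point \<eta> a y" and y: "Lpw_le p \<alpha> \<eta> (2 * d) y" and a: "Lpw_le p \<alpha> \<eta>' d' a"
    and \<eta>: "\<eta>' \<le> \<eta>" "\<eta> \<le> \<tau>" and d: "8 * M3 * K * d \<le> 1"
  shows "Lpw_le p \<alpha> \<eta>' (2 * d') y"
proof -
  have y': "Lpw_le p \<alpha> \<eta>' (2 * d) y" by (rule Lpw_le_restrict[OF p_pos(1) \<alpha>(1) y \<eta>(1)])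
  obtain N where N: "Lpw_le p \<alpha> \<eta>' N y" "\<And>d. Lpw_le p \<alpha> \<eta>' d y \<Longrightarrow> N \<le> d"
    using Lpw_le_minimal[OF y'] by blast
  have "\<eta>' \<le> \<tau>" using \<eta> by simp
  from Lpw_le_add[OF p_pos(2) a A3_local(1)[OF Lpw_le_F[OF y' N(1)] this]]
  have "Lpw_le p \<alpha> \<eta>' (d' + M3 * (K * (2 * d) * N)) (\<lambda>t. a t + Cconv (\<lambda>s. F (y s) (y s)) t)" .
  then have "Lpw_le p \<alpha> \<eta>' (d' + M3 * (K * (2 * d) * N)) y"
    by (rule Lpw_le_cong_AE[OF p_pos(1)])
       (use fp ival_mono[OF _ \<eta>(1)] in \<open>auto simp: fixed_point_def elim!: eventually_mono\<close>)
  then have "N \<le> d' + M3 * (K * (2 * d) * N)" by (rule N(2))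
  moreover have "M3 * (K * (2 * d) * N) \<le> N / 4"
    using mult_right_mono[OF d Lpw_leD(2)[OF N(1)]] by (simp add: algebra_simps)
  ultimately have "N \<le> 2 * d'" using Lpw_leD(2)[OF N(1)] by simp
  then show ?thesis by (rule Lpw_le_weaken[OF N(1)])
qed

end

section \<open>Uniqueness and existence of mild solutions\<close>

lemma negligible_AE:
  assumes "AE t in lebesgue. t \<in> S \<longrightarrow> P t"
  shows "negligible {t \<in> S. \<not> P t}"
proof -
  have "{t. \<not> (t \<in> S \<longrightarrow> P t)} \<in> null_sets lebesgue"
    using assms completion.AE_iff_null_sets[of "\<lambda>t. t \<in> S \<longrightarrow> P t" lborel] by simp
  then show ?thesis by (simp add: negligible_iff_null_sets)
qed

context abstract_problem
begin

text \<open>Inputs that agree before \<open>t0\<close> have outputs whose difference forgets that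
  past, so that it is again a \<open>Cconv\<close>, with the time origin moved to \<open>t0\<close>.
  This allows [A3] to be applied on an interval starting at \<open>t0\<close>.\<close>

lemma has_integral_Cconv_translation:
  assumes i: "((\<lambda>s. C (S (t - s) (Bt (u s)))) has_integral i) {0..t}"
    and i': "((\<lambda>s. C (S (t - s) (Bt (u' s)))) has_integral i') {0..t}"
    and eq: "AE s in lebesgue. s \<in> ival (ereal t0) \<longrightarrow> u s = u' s" and t0: "0 \<le> t0" "t0 < t"
  shows "Cconv (\<lambda>s. u (t0 + s) - u' (t0 + s)) (t - t0) = i - i'"
proof -
  let ?D = "\<lambda>s. C (S (t - s) (Bt (u s - u' s)))"
  have "((\<lambda>s. C (S (t - s) (Bt (u s))) - C (S (t - s) (Bt (u' s)))) has_integral i - i') {0..t}"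
    by (rule has_integral_diff[OF i i'])
  then have D: "(?D has_integral i - i') {0..t}"
    by (rule has_integral_spike_finite[of "{t}", rotated 2]) (auto simp: CS_diff)
  have "negligible ({s \<in> ival (ereal t0). \<not> u s = u' s} \<union> {0, t0})"
    by (intro negligible_Un negligible_AE[OF eq] negligible_finite) auto
  then have "(?D has_integral 0) {0..t0}"
  proof (rule has_integral_spike)
    fix s assume "s \<in> {0..t0} - ({s \<in> ival (ereal t0). \<not> u s = u' s} \<union> {0, t0})"
    then have "u s = u' s" "0 < t - s" using t0 by (auto simp: ival_iff)
    then show "?D s = 0" using CS_diff[of "t - s" "u s" "u s"] by simp
  qed (rule has_integral_0)
  then have 1: "integral {0..t0} ?D = 0" by (rule integral_unique)
  have "?D integrable_on {t0..t}"
    by (rule integrable_on_subinterval[OF has_integral_integrable[OF D]]) (use t0 in auto)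
  moreover have "integral {0..t0} ?D + integral {t0..t} ?D = i - i'"
    using Henstock_Kurzweil_Integration.integral_combine[OF _ _ has_integral_integrable[OF D], of t0] t0 integral_unique[OF D] by simp
  ultimately have "(?D has_integral i - i') {t0..t}" using 1 by (simp add: has_integral_iff)
  from has_integral_shift_real_ivl[OF this, of t0]
  have "((\<lambda>s. ?D (s + t0)) has_integral i - i') {0..t - t0}" by simp
  then show ?thesis unfolding Cconv_def by (intro integral_unique) (simp add: algebra_simps)
qed

text \<open>On a short interval after \<open>t0\<close> both translated solutions have norm at most
  \<open>\<kappa>\<close>, so their difference is contracted with factor 2 M3 K \<kappa> \<le> 1/2
  and vanishes. Smallness is asked for locally at every \<open>t0\<close> since a solution need not
  be small as a whole.\<close>

lemma fixed_point_unique: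
  assumes fp: "fixed_point \<eta> a y" "fixed_point \<eta> a y'"
    and y: "Lpw_le p \<alpha> \<eta> c y" "Lpw_le p \<alpha> \<eta> c' y'" and \<eta>: "\<eta> \<le> \<tau>" and \<kappa>: "4 * M3 * K * \<kappa> \<le> 1"
    and loc: "\<And>t0. t0 \<in> rival \<eta> \<Longrightarrow> \<exists>e>0. ereal (t0 + e) \<le> \<eta> \<and>
      Lpw_le p \<alpha> (ereal e) \<kappa> (\<lambda>s. y (t0 + s)) \<and> Lpw_le p \<alpha> (ereal e) \<kappa> (\<lambda>s. y' (t0 + s))"
  shows "AE t in lebesgue. t \<in> ival \<eta> \<longrightarrow> y t = y' t"
proof -
  define P where "P b \<longleftrightarrow> (AE t in lebesgue. t \<in> ival (ereal b) \<longrightarrow> y t = y' t)" for b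
  have P_mono: "P b'" if "P b" "b' \<le> b" for b b'
    using that ival_mono[of _ "ereal b'" "ereal b"] by (auto simp: P_def elim!: eventually_mono)
  have P_0: "P b" if "b \<le> 0" for b using that by (auto simp: P_def ival_iff)
  let ?u = "\<lambda>s. F (y s) (y s)" and ?u' = "\<lambda>s. F (y' s) (y' s)"
  have step: "\<exists>e>0. P (t0 + e)" if t0: "t0 \<in> rival \<eta>" and P: "P t0" for t0
  proof -
    obtain e where e: "e > 0" "ereal (t0 + e) \<le> \<eta>"
      and ye: "Lpw_le p \<alpha> (ereal e) \<kappa> (\<lambda>s. y (t0 + s))" "Lpw_le p \<alpha> (ereal e) \<kappa> (\<lambda>s. y' (t0 + s))"
      using loc[OF t0] by blast
    have t0': "0 \<le> t0" using t0 by (simp add: rival_iff)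
    have sub: "t0 + r \<in> ival \<eta>" if "r \<in> ival (ereal e)" for r
    proof -
      have "ereal (t0 + r) < ereal (t0 + e)" using that by (simp add: ival_iff)
      then show ?thesis using that t0' e(2) less_le_trans[of _ "ereal (t0 + e)" \<eta>] by (simp add: ival_iff)
    qed
    let ?w = "\<lambda>s. y (t0 + s) - y' (t0 + s)"
    let ?U = "\<lambda>s. ?u (t0 + s) - ?u' (t0 + s)"
    have "AE t in lebesgue. t0 < t \<and> t \<in> ival \<eta> \<longrightarrow> y t - y' t = Cconv ?U (t - t0)"
      using A3_local(2)[OF Lpw_le_F[OF y(1) y(1)] \<eta>] A3_local(2)[OF Lpw_le_F[OF y(2) y(2)] \<eta>]
        fp[unfolded fixed_point_def]
    proof eventually_elim
      case (elim t)
      have uu: "AE s in lebesgue. s \<in> ival (ereal t0) \<longrightarrow> ?u s = ?u' s"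
        using P unfolding P_def by eventually_elim auto
      show ?case
        using elim has_integral_Cconv_translation[OF _ _ uu t0', of t "Cconv ?u t" "Cconv ?u' t"] by auto
    qed
    from AE_lebesgue_translation[OF this, of t0]
    have eq: "AE r in lebesgue. r \<in> ival (ereal e) \<longrightarrow> ?w r = Cconv ?U r"
      by eventually_elim (use sub in \<open>auto simp: ival_iff\<close>)
    obtain N where N: "Lpw_le p \<alpha> (ereal e) N ?w" "\<And>d. Lpw_le p \<alpha> (ereal e) d ?w \<Longrightarrow> N \<le> d"
      using Lpw_le_minimal[OF Lpw_le_diff[OF p_pos(2) ye]] by blast
    have "ereal e \<le> \<tau>" using e(2) \<eta> t0' order_trans[of "ereal e" "ereal (t0 + e)" \<tau>] by (auto intro: order_trans)
    from A3_local(1)[OF Lpw_le_F_diff[OF ye N(1)] this]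
    have "Lpw_le p \<alpha> (ereal e) (M3 * (2 * K * \<kappa> * N)) ?w"
      by (rule Lpw_le_cong_AE[OF p_pos(1) _ eq])
    then have "N \<le> M3 * (2 * K * \<kappa> * N)" by (rule N(2))
    also have "\<dots> \<le> N / 2" using mult_right_mono[OF \<kappa> Lpw_leD(2)[OF N(1)]] by (simp add: algebra_simps)
    finally have "N = 0" using Lpw_leD(2)[OF N(1)] by simp
    then have "AE r in lebesgue. r \<in> ival (ereal e) \<longrightarrow> ?w r = 0" using Lpw_le_0D[OF p_pos(1)] N(1) by blast
    from AE_lebesgue_translation[OF this, of "- t0"]
    have "AE t in lebesgue. t \<in> ival (ereal (t0 + e)) \<and> t0 < t \<longrightarrow> y t = y' t"
      by eventually_elim (auto simp: ival_iff)
    moreover have "AE t in lebesgue. t \<noteq> t0" using AE_lborel_singleton[of t0] AE_completion by blast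
    ultimately have "P (t0 + e)" using P unfolding P_def
      by eventually_elim (auto simp: ival_iff)
    then show ?thesis using e(1) by blast
  qed
  \<comment> \<open>Agreement passes to the supremum because (0, b) is the union of the intervals
    (0, q) with rational q < b, which involves countably many null sets.\<close>
  have P_limit: "P b" if "\<And>b'. b' < b \<Longrightarrow> P b'" for b
  proof -
    have "AE t in lebesgue. \<forall>q\<in>{q \<in> \<rat>. q < b}. t \<in> ival (ereal q) \<longrightarrow> y t = y' t"
      using that unfolding P_def by (subst AE_ball_countable) (auto intro: countable_subset[OF _ countable_rat])
    then show ?thesis unfolding P_def
    proof eventually_elim
      case (elim t)
      show ?case
      proof
        assume t: "t \<in> ival (ereal b)"
        then obtain q where "q \<in> \<rat>" "t < q" "q < b" using Rats_dense_in_real[of t b] by (auto simp: ival_iff)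
        then show "y t = y' t" using elim t by (auto simp: ival_iff)
      qed
    qed
  qed
  \<comment> \<open>The supremum of the times of agreement up to \<open>b\<close> is itself such a
    time by \<open>P_limit\<close>, and \<open>step\<close> would carry agreement beyond it unless
    it is \<open>b\<close>.\<close>
  have P_all: "P b" if b: "b \<in> rival \<eta>" for b
  proof -
    let ?S = "{s. s \<le> b \<and> P s}"
    have b0: "0 \<le> b" using b by (simp add: rival_iff)
    have S: "0 \<in> ?S" "bdd_above ?S" using b0 P_0[of 0] by (auto simp: bdd_above_def)
    define m where "m = Sup ?S"
    have m: "0 \<le> m" unfolding m_def by (rule cSup_upper[OF S])
    have mb: "m \<le> b" unfolding m_def by (rule cSup_least) (use S(1) in auto)
    have Pm: "P m"
    proof (rule P_limit)
      fix b' assume "b' < m"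
      then obtain s where "s \<in> ?S" "b' < s" using less_cSup_iff[of ?S b'] S by (auto simp: m_def)
      then show "P b'" using P_mono[of s b'] by simp
    qed
    have "m \<in> rival \<eta>" using m mb b le_less_trans[of "ereal m" "ereal b" \<eta>] by (simp add: rival_iff)
    from step[OF this Pm] obtain e where e: "e > 0" "P (m + e)" by blast
    then have "min (m + e) b \<in> ?S" using P_mono[OF e(2)] by simp
    then have "min (m + e) b \<le> m" unfolding m_def using cSup_upper[OF _ S(2)] by blast
    then show ?thesis using P_mono[OF Pm] e(1) by (auto simp: min_def split: if_splits)
  qed
  have "AE t in lebesgue. \<forall>q\<in>{q \<in> \<rat>. q \<in> rival \<eta>}. t \<in> ival (ereal q) \<longrightarrow> y t = y' t"
    using P_all unfolding P_def by (subst AE_ball_countable) (auto intro: countable_subset[OF _ countable_rat])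
  then show ?thesis
  proof eventually_elim
    case (elim t)
    show ?case
    proof
      assume t: "t \<in> ival \<eta>"
      then obtain z where z: "t < z" "ereal z < \<eta>" using ereal_dense2[of "ereal t" \<eta>] by (auto simp: ival_iff)
      obtain q where q: "q \<in> \<rat>" "t < q" "q < z" using Rats_dense_in_real[OF z(1)] by blast
      have "ereal q < \<eta>" using q(3) z(2) less_trans[of "ereal q" "ereal z" \<eta>] by simp
      then show "y t = y' t" using elim q t by (auto simp: ival_iff rival_iff)
    qed
  qed
qed

text \<open>The integral equation for a given input, pulled back by (I + A_{-1})^{-1}. Separating
  the input from the output lets the same notion serve for the input F(y, y) of a fixed point, for
  F(Cx, Cx), and for translated inputs.\<close>

definition mild :: "ereal \<Rightarrow> (real \<Rightarrow> 'w) \<Rightarrow> 'x \<Rightarrow> (real \<Rightarrow> 'x) \<Rightarrow> bool" where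
  "mild \<eta> u x0 x \<longleftrightarrow> continuous_on (rival \<eta>) x \<and> (\<forall>t\<in>rival \<eta>. x t \<in> closure DA) \<and>
    (\<forall>t\<in>rival \<eta>. ((\<lambda>s. T (t - s) (Bt (u s))) has_integral R (x t - T t x0)) {0..t})"

lemma mildD:
  assumes "mild \<eta> u x0 x"
  shows "continuous_on (rival \<eta>) x" "\<And>t. t \<in> rival \<eta> \<Longrightarrow> x t \<in> closure DA"
    "\<And>t. t \<in> rival \<eta> \<Longrightarrow> R (x t - T t x0) = conv u t"
  using assms by (auto simp: mild_def conv_def integral_unique)

lemma mild_initial:
  assumes "mild \<eta> u x0 x" "0 < \<eta>"
  shows "x 0 = x0"
proof -
  have "R (x 0 - T 0 x0) = R 0"
    using mildD(3)[OF assms(1), of 0] assms(2) linear_0[OF bounded_linear.linear[OF R_bounded_linear]]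
    by (simp add: rival_iff zero_ereal_def[symmetric])
  from R_inj[OF this] show ?thesis by simp
qed

lemma mild_cong_AE:
  assumes x: "mild \<eta> u x0 x" and uu: "AE t in lebesgue. t \<in> ival \<eta> \<longrightarrow> u t = u' t"
  shows "mild \<eta> u' x0 x"
proof -
  have "((\<lambda>s. T (t - s) (Bt (u' s))) has_integral R (x t - T t x0)) {0..t}" if t: "t \<in> rival \<eta>" for t
  proof (rule has_integral_spike)
    show "negligible ({s \<in> ival \<eta>. \<not> u s = u' s} \<union> {0})"
      by (intro negligible_Un negligible_AE[OF uu] negligible_finite) auto
    show "((\<lambda>s. T (t - s) (Bt (u s))) has_integral R (x t - T t x0)) {0..t}"
      using x t by (simp add: mild_def)
    fix s assume "s \<in> {0..t} - ({s \<in> ival \<eta>. \<not> u s = u' s} \<union> {0})"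
    then have "u s = u' s" using t ivalI[of s t \<eta>] by (auto simp: rival_iff)
    then show "T (t - s) (Bt (u' s)) = T (t - s) (Bt (u s))" by simp
  qed
  then show ?thesis using x by (simp add: mild_def)
qed

lemma closure_DA_diff:
  assumes "x \<in> closure DA" "y \<in> closure DA"
  shows "x - y \<in> closure DA"
proof -
  obtain a where a: "\<And>n. a n \<in> DA" "a \<longlonglongrightarrow> x" using assms(1) closure_sequential by blast
  obtain b where b: "\<And>n. b n \<in> DA" "b \<longlonglongrightarrow> y" using assms(2) closure_sequential by blast
  have "a n - b n \<in> DA" for n
    using DA_add[OF a(1) DA_scaleC[OF b(1), of "-1"]] by (simp add: scaleC_minus_one)
  moreover have "(\<lambda>n. a n - b n) \<longlonglongrightarrow> x - y" by (intro tendsto_intros a b)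
  ultimately show ?thesis unfolding closure_sequential by (intro exI[of _ "\<lambda>n. a n - b n"]) auto
qed

lemma closure_DA_add:
  assumes "x \<in> closure DA" "y \<in> closure DA"
  shows "x + y \<in> closure DA"
proof -
  have "0 \<in> closure DA" using closure_DA_diff[OF assms(1,1)] by simp
  from closure_DA_diff[OF assms(1) closure_DA_diff[OF this assms(2)]] show ?thesis by simp
qed

lemma T_continuous_on_rival: "x0 \<in> closure DA \<Longrightarrow> continuous_on (rival \<eta>) (\<lambda>t. T t x0)"
  by (rule continuous_on_subset[OF T_continuous_on]) (auto simp: rival_iff)

text \<open>T(t)x_0 is in D(A) for t > 0, so C splits over the state, and closedness of C identifies
  its value on the convolution part. Hence outputs of mild solutions satisfy the fixed point
  equation.\<close>

lemma mild_C:
  assumes x: "mild \<eta> u x0 x" and x0: "x0 \<in> closure DA" and u: "Lpw_le (p / 2) (2 * \<alpha>) \<eta> c u" and \<eta>: "\<eta> \<le> \<tau>"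
  shows "AE t in lebesgue. t \<in> ival \<eta> \<longrightarrow> x t \<in> DC \<and> C (x t) = C (T t x0) + Cconv u t"
  using A3_local(2)[OF u \<eta>]
proof eventually_elim
  case (elim t)
  show ?case
  proof
    assume t: "t \<in> ival \<eta>"
    have 1: "x t - T t x0 \<in> DC" "C (x t - T t x0) = Cconv u t"
    proof -
      have "continuous_on (rival \<eta>) (\<lambda>t. x t - T t x0)"
        by (intro continuous_intros mildD(1)[OF x] T_continuous_on_rival x0)
      moreover have "x t - T t x0 \<in> closure DA" if "t \<in> rival \<eta>" for t
        using that by (intro closure_DA_diff mildD(2)[OF x] T_closure x0) (auto simp: rival_iff)
      ultimately show "x t - T t x0 \<in> DC" "C (x t - T t x0) = Cconv u t"
        using C_conv[OF u _ _ mildD(3)[OF x] t elim[THEN mp, OF t]] by auto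
    qed
    have 2: "T t x0 \<in> DC" using T_in_DA[of t x0] t DA_DC by (auto simp: ival_iff)
    show "x t \<in> DC \<and> C (x t) = C (T t x0) + Cconv u t"
      using DC_add[OF 1(1) 2] C_add[OF 1(1) 2] 1(2) by simp
  qed
qed

text \<open>By the restart formula \<open>conv_split\<close>; the state x(s) gathers all of the past
  and serves as the new initial value.\<close>

lemma mild_translation:
  assumes x: "mild \<eta> u x0 x" and u: "Lpw_le (p / 2) (2 * \<alpha>) \<eta> c u"
    and s: "0 \<le> s" "ereal (s + e) \<le> \<eta>"
  shows "mild (ereal e) (\<lambda>t. u (s + t)) (x s) (\<lambda>t. x (s + t))"
  unfolding mild_def
proof (intro conjI ballI)
  interpret R: bounded_linear R by (rule R_bounded_linear)
  have sub: "s + t \<in> rival \<eta>" if "t \<in> rival (ereal e)" for t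
    using that s less_le_trans[of "ereal (s + t)" "ereal (s + e)" \<eta>] by (simp add: rival_iff)
  have subi: "s + t \<in> ival \<eta>" if "t \<in> ival (ereal e)" for t
    using that s less_le_trans[of "ereal (s + t)" "ereal (s + e)" \<eta>] by (simp add: ival_iff)
  show "continuous_on (rival (ereal e)) (\<lambda>t. x (s + t))"
    by (rule continuous_on_compose2[OF mildD(1)[OF x]]) (use sub in \<open>auto intro!: continuous_intros\<close>)
  fix t assume t: "t \<in> rival (ereal e)"
  show "x (s + t) \<in> closure DA" using mildD(2)[OF x sub[OF t]] .
  have t0: "0 \<le> t" using t by (simp add: rival_iff)
  have s': "s \<in> rival \<eta>" using sub[OF t] t0 s(1) le_less_trans[of "ereal s" "ereal (s + t)" \<eta>] by (simp add: rival_iff)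
  have "((\<lambda>r. T (t - r) (Bt (u (s + r)))) has_integral conv (\<lambda>r. u (s + r)) t) {0..t}"
    by (rule has_integral_conv[OF Lpw_le_half_translation[OF u s(1) subi]]) (use t in \<open>auto simp: rival_iff\<close>)
  moreover have "conv (\<lambda>r. u (s + r)) t = R (x (s + t) - T t (x s))"
  proof -
    have "conv u (s + t) = T t (conv u s) + conv (\<lambda>r. u (s + r)) t"
      using conv_split[OF u s(1), of "s + t"] t0 sub[OF t] by (simp add: rival_iff)
    moreover have "T t (conv u s) = R (T t (x s)) - R (T (s + t) x0)"
      using mildD(3)[OF x s', symmetric] t0 s(1) T_add[of t s x0]
      by (simp add: R.diff T_R linear_diff[OF bounded_linear.linear[OF T_bounded_linear[OF t0]]] add.commute)
    ultimately show ?thesis using mildD(3)[OF x sub[OF t], symmetric] by (simp add: R.diff)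
  qed
  ultimately show "((\<lambda>r. T (t - r) (Bt (u (s + r)))) has_integral R (x (s + t) - T t (x s))) {0..t}" by simp
qed

lemma CT_add:
  assumes t: "0 < t"
  shows "C (T t (x + y)) = C (T t x) + C (T t y)"
proof -
  have "T t x \<in> DC" "T t y \<in> DC" using T_in_DA[OF t] DA_DC by auto
  then show ?thesis
    using linear_add[OF bounded_linear.linear[OF T_bounded_linear[of t]]] t by (simp add: C_add)
qed

lemma Lpw_le_CT_add:
  assumes y: "Lpw_le p \<alpha> \<eta> c (\<lambda>t. C (T t y))" and \<eta>: "\<eta> \<le> \<tau>"
  shows "Lpw_le p \<alpha> \<eta> (M1 * norm (x - y) + c) (\<lambda>t. C (T t x))"
proof (rule Lpw_le_cong_AE[OF p_pos(1) Lpw_le_add[OF p_pos(2) Lpw_le_restrict[OF p_pos(1) \<alpha>(1) A1 \<eta>] y]])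
  show "AE t in lebesgue. t \<in> ival \<eta> \<longrightarrow> C (T t x) = C (T t (x - y)) + C (T t y)"
    using CT_add[of _ "x - y" y] by (auto simp: ival_iff)
qed

text \<open>For x1 in D(A) the output CT(t)x1 = CR T(t)(I + A)x1 is bounded, and bounded functions
  have small norm near 0 because \<alpha> + 1/p > 0. [A1] controls the error x0 - x1 on every
  interval at once.\<close>

lemma CT_small:
  assumes x0: "x0 \<in> closure DA" and \<eta>: "0 < \<eta>" "\<eta> \<le> \<tau>" and \<epsilon>: "0 < \<epsilon>"
  obtains d where "0 < d" "ereal d \<le> \<eta>" "Lpw_le p \<alpha> (ereal d) \<epsilon> (\<lambda>t. C (T t x0))"
proof -
  have "0 < \<epsilon> / (2 * (M1 + 1))" using \<epsilon> M1 by simp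
  then obtain x1 where x1: "x1 \<in> DA" "dist x1 x0 < \<epsilon> / (2 * (M1 + 1))"
    using x0 closure_approachable by blast
  have "M1 * norm (x0 - x1) \<le> (M1 + 1) * norm (x0 - x1)" by (simp add: algebra_simps)
  also have "\<dots> \<le> \<epsilon> / 2"
    using x1(2) M1 by (simp add: dist_norm norm_minus_commute pos_less_divide_eq mult.commute less_imp_le algebra_simps)
  finally have 1: "M1 * norm (x0 - x1) \<le> \<epsilon> / 2" .
  define y where "y = x1 + A x1"
  obtain b where b: "0 < b" "\<And>z. norm (C (R z)) \<le> norm z * b"
    using bounded_linear.pos_bounded[OF CR_bounded_linear] by blast
  have bd: "norm (C (T t x1)) \<le> M * norm y * b" if "0 < t" for t
  proof -
    have "C (T t x1) = C (R (T t y))" using R_left[OF x1(1)] T_R[of t y] that by (simp add: y_def)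
    then have "norm (C (T t x1)) \<le> norm (T t y) * b" using b(2) by simp
    also have "\<dots> \<le> (M * norm y) * b" using b(1) T_bound[of t y] that by (intro mult_right_mono) auto
    finally show ?thesis .
  qed
  have sm: "strongly_measurable_on (ival \<eta>) (\<lambda>t. C (T t x1))"
    by (rule Lpw_leD(1)[OF Lpw_le_restrict[OF p_pos(1) \<alpha>(1) A1 \<eta>(2)]])
  have "AE t in lebesgue. t \<in> ival \<eta> \<longrightarrow> norm (C (T t x1)) \<le> M * norm y * b"
    using bd by (auto simp: ival_iff)
  then obtain d where d: "0 < d" "ereal d \<le> \<eta>" "Lpw_le p \<alpha> (ereal d) (\<epsilon> / 2) (\<lambda>t. C (T t x1))"
    using Lpw_le_bounded_small[OF p_pos(1) \<alpha>(1,2) sm \<eta>(1), of "\<epsilon> / 2"] \<epsilon> by auto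
  have "ereal d \<le> \<tau>" using d(2) \<eta>(2) by (rule order_trans)
  from Lpw_le_CT_add[OF d(3) this, of x0]
  have "Lpw_le p \<alpha> (ereal d) \<epsilon> (\<lambda>t. C (T t x0))" by (rule Lpw_le_weaken) (use 1 in simp)
  then show thesis using that d by blast
qed

lemma Lpw_le_local_small:
  assumes y: "Lpw_le p \<alpha> \<eta> c y" and t0: "t0 \<in> rival \<eta>" "0 < t0 \<or> p \<noteq> \<infinity>" and \<kappa>: "0 < \<kappa>"
  shows "\<exists>e>0. ereal (t0 + e) \<le> \<eta> \<and> Lpw_le p \<alpha> (ereal e) \<kappa> (\<lambda>s. y (t0 + s))"
proof -
  obtain d where d: "0 < d" "ereal (t0 + 2 * d) < \<eta>"
    "\<And>a. 0 \<le> a \<Longrightarrow> t0 - d < a \<Longrightarrow> a \<le> t0 \<Longrightarrow> Lpw_le p \<alpha> (ereal (2 * d)) \<kappa> (\<lambda>t. y (a + t))"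
    using Lpw_le_translation_small[OF p_pos(1) \<alpha>(1,2) y, of t0 \<kappa>] t0 \<kappa> by (auto simp: rival_iff)
  show ?thesis
    by (rule exI[of _ "2 * d"]) (use d t0 in \<open>auto simp: rival_iff less_imp_le\<close>)
qed

text \<open>A fixed point that is small on the whole interval is small after every translation, so
  local smallness remains to be verified for its competitor alone. With \<kappa> = 2d the two
  conditions on the constants coincide.\<close>

lemma fixed_point_unique':
  assumes fp: "fixed_point \<eta> a y" "fixed_point \<eta> a y'" and \<eta>: "\<eta> \<le> \<tau>"
    and y: "Lpw_le p \<alpha> \<eta> (2 * d) y" and d: "8 * M3 * K * d \<le> 1" and y': "Lpw_le p \<alpha> \<eta> c y'"
    and loc: "\<And>t0. t0 \<in> rival \<eta> \<Longrightarrow> \<exists>e>0. ereal (t0 + e) \<le> \<eta> \<and> Lpw_le p \<alpha> (ereal e) (2 * d) (\<lambda>s. y' (t0 + s))"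
  shows "AE t in lebesgue. t \<in> ival \<eta> \<longrightarrow> y t = y' t"
proof (rule fixed_point_unique[OF fp y y' \<eta>, of "2 * d"])
  fix t0 assume t0: "t0 \<in> rival \<eta>"
  obtain e where e: "e > 0" "ereal (t0 + e) \<le> \<eta>" "Lpw_le p \<alpha> (ereal e) (2 * d) (\<lambda>s. y' (t0 + s))"
    using loc[OF t0] by blast
  have "Lpw_le p \<alpha> (ereal e) (2 * d) (\<lambda>s. y (t0 + s))"
    by (rule Lpw_le_translation[OF p_pos(1) \<alpha>(1) y])
       (use t0 e(2) less_le_trans[of _ "ereal (t0 + e)" \<eta>] in \<open>auto simp: rival_iff ival_iff\<close>)
  then show "\<exists>e>0. ereal (t0 + e) \<le> \<eta> \<and>
      Lpw_le p \<alpha> (ereal e) (2 * d) (\<lambda>s. y (t0 + s)) \<and> Lpw_le p \<alpha> (ereal e) (2 * d) (\<lambda>s. y' (t0 + s))"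
    using e by blast
qed (use d in simp)

text \<open>For infinite p the norm over (0, e) need not vanish as e tends to 0. As in Brezis' argument, the
  solution is restarted at small times s > 0, where its output is bounded; there it coincides with the small
  fixed point, whose smallness is uniform in s because x is continuous at 0.\<close>

lemma mild_output_small:
  assumes x: "mild \<eta> (\<lambda>t. F (C (x t)) (C (x t))) x0 x" and x0: "x0 \<in> closure DA"
    and y: "Lpw_le p \<alpha> \<eta> c (\<lambda>t. C (x t))" and \<eta>: "0 < \<eta>" "\<eta> \<le> \<tau>" and \<kappa>: "0 < \<kappa>"
  shows "\<exists>e>0. ereal e \<le> \<eta> \<and> Lpw_le p \<alpha> (ereal e) \<kappa> (\<lambda>t. C (x t))"
proof (cases "p = \<infinity>")
  case False
  then show ?thesis
    using Lpw_le_local_small[OF y, of 0 \<kappa>] \<kappa> \<eta>(1) by (simp add: rival_iff zero_ereal_def[symmetric])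
next
  case True
  let ?u = "\<lambda>t. F (C (x t)) (C (x t))"
  have u: "Lpw_le (p / 2) (2 * \<alpha>) \<eta> (K * c * c) ?u" by (rule Lpw_le_F[OF y y])
  \<comment> \<open>The first entry turns the fixed point bound 2d into \<open>\<kappa>\<close>, the
    second is the condition for the contraction.\<close>
  define d where "d = min (\<kappa> / 2) (1 / (8 * M3 * K))"
  have d: "0 < d" "2 * d \<le> \<kappa>" using \<kappa> M3 K by (auto simp: d_def)
  have d8: "8 * M3 * K * d \<le> 1"
  proof -
    have "8 * M3 * K * d \<le> 8 * M3 * K * (1 / (8 * M3 * K))"
      using M3 K by (intro mult_left_mono) (auto simp: d_def)
    then show ?thesis using M3 K by simp
  qed
  obtain \<delta>0 where \<delta>0: "0 < \<delta>0" "ereal \<delta>0 \<le> \<eta>" "Lpw_le p \<alpha> (ereal \<delta>0) (d / 2) (\<lambda>t. C (T t x0))"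
    using CT_small[OF x0 \<eta>, of "d / 2"] d(1) by auto
  have z: "0 \<in> rival \<eta>" using \<eta>(1) by (simp add: rival_iff zero_ereal_def[symmetric])
  have "0 < d / (2 * (M1 + 1))" using d(1) M1 by simp
  then obtain s0 where s0: "0 < s0" "\<And>s. s \<in> rival \<eta> \<Longrightarrow> dist s 0 < s0 \<Longrightarrow> dist (x s) (x 0) < d / (2 * (M1 + 1))"
    using mildD(1)[OF x, unfolded continuous_on_iff] z by metis
  \<comment> \<open>Half of \<open>\<delta>0\<close> is kept for the restart time and half for the
    length of the restarted interval, which is therefore independent of \<open>s\<close>.\<close>
  define \<delta> where "\<delta> = \<delta>0 / 2"
  define s1 where "s1 = min s0 \<delta>"
  have \<delta>: "0 < \<delta>" "0 < s1" using \<delta>0 s0 by (auto simp: \<delta>_def s1_def)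
  have \<delta>\<eta>: "ereal \<delta> \<le> ereal \<delta>0" "ereal \<delta> \<le> \<eta>"
    using \<delta>0 order_trans[of "ereal \<delta>" "ereal \<delta>0" \<eta>] by (auto simp: \<delta>_def)
  \<comment> \<open>The free output from x(s) has norm at most d: one half from that of x0, the
    other from [A1] and |x(s) - x0|. So the small fixed point for x(s) exists on (0, \<delta>) and,
    by uniqueness at restart times s > 0, is the translated output.\<close>
  have main: "Lpw_le p \<alpha> (ereal \<delta>) (2 * d) (\<lambda>t. C (x (s + t)))" if s: "0 < s" "s < s1" for s
  proof -
    have "ereal (s + \<delta>) \<le> ereal \<delta>0" using s by (simp add: s1_def \<delta>_def min_def split: if_splits)
    then have s\<delta>: "ereal (s + \<delta>) \<le> \<eta>" using \<delta>0(2) by (rule order_trans)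
    have sr: "s \<in> rival \<eta>"
      using s \<delta>(1) s\<delta> less_le_trans[of "ereal s" "ereal (s + \<delta>)" \<eta>] by (simp add: rival_iff)
    have "norm (x s - x0) < d / (2 * (M1 + 1))"
      using s0(2)[OF sr] s mild_initial[OF x \<eta>(1)] by (simp add: s1_def dist_norm)
    then have "M1 * norm (x s - x0) \<le> d / 2"
    proof -
      assume "norm (x s - x0) < d / (2 * (M1 + 1))"
      then have "(M1 + 1) * norm (x s - x0) \<le> d / 2" using M1 by (simp add: field_simps)
      moreover have "M1 * norm (x s - x0) \<le> (M1 + 1) * norm (x s - x0)" by (intro mult_right_mono) auto
      ultimately show ?thesis by (rule order_trans[rotated])
    qed
    moreover have \<delta>\<tau>: "ereal \<delta> \<le> \<tau>" using \<delta>\<eta>(2) \<eta>(2) by (rule order_trans)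
    ultimately have a: "Lpw_le p \<alpha> (ereal \<delta>) d (\<lambda>t. C (T t (x s)))"
      using Lpw_le_weaken[OF Lpw_le_CT_add[OF Lpw_le_restrict[OF p_pos(1) \<alpha>(1) \<delta>0(3) \<delta>\<eta>(1)] \<delta>\<tau>, of "x s"], of d] by simp
    have subi: "s + t \<in> ival \<eta>" if "t \<in> ival (ereal \<delta>)" for t
      using that s s\<delta> less_le_trans[of "ereal (s + t)" "ereal (s + \<delta>)" \<eta>] by (simp add: ival_iff)
    have ms: "mild (ereal \<delta>) (\<lambda>t. ?u (s + t)) (x s) (\<lambda>t. x (s + t))"
      using mild_translation[OF x u _ s\<delta>] s by simp
    have us: "Lpw_le (p / 2) (2 * \<alpha>) (ereal \<delta>) (K * c * c) (\<lambda>t. ?u (s + t))"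
      by (rule Lpw_le_half_translation[OF u _ subi]) (use s in auto)
    have fp: "fixed_point (ereal \<delta>) (\<lambda>t. C (T t (x s))) (\<lambda>t. C (x (s + t)))"
      using mild_C[OF ms mildD(2)[OF x sr] us \<delta>\<tau>] by (auto simp: fixed_point_def elim!: eventually_mono)
    have ys: "Lpw_le p \<alpha> (ereal \<delta>) c (\<lambda>t. C (x (s + t)))"
      by (rule Lpw_le_translation[OF p_pos(1) \<alpha>(1) y _ subi]) (use s in auto)
    obtain z where z: "Lpw_le p \<alpha> (ereal \<delta>) (2 * d) z" "fixed_point (ereal \<delta>) (\<lambda>t. C (T t (x s))) z"
      using ex_fixed_point[OF a \<delta>\<tau> d8] by blast
    have "AE t in lebesgue. t \<in> ival (ereal \<delta>) \<longrightarrow> z t = C (x (s + t))"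
    proof (rule fixed_point_unique'[OF z(2) fp \<delta>\<tau> z(1) d8 ys])
      fix t0 assume t0: "t0 \<in> rival (ereal \<delta>)"
      have "s + t0 \<in> rival \<eta>"
        using t0 s s\<delta> less_le_trans[of "ereal (s + t0)" "ereal (s + \<delta>)" \<eta>] by (simp add: rival_iff)
      then obtain e where e: "0 < e" "Lpw_le p \<alpha> (ereal e) (2 * d) (\<lambda>r. C (x (s + t0 + r)))"
        using Lpw_le_local_small[OF y, of "s + t0" "2 * d"] s t0 d(1) by (auto simp: rival_iff)
      define e' where "e' = min e (\<delta> - t0)"
      have "Lpw_le p \<alpha> (ereal e') (2 * d) (\<lambda>r. C (x (s + (t0 + r))))"
        using Lpw_le_restrict[OF p_pos(1) \<alpha>(1) e(2), of "ereal e'"] by (simp add: e'_def add.assoc)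
      then show "\<exists>e>0. ereal (t0 + e) \<le> ereal \<delta> \<and> Lpw_le p \<alpha> (ereal e) (2 * d) (\<lambda>r. C (x (s + (t0 + r))))"
        using e(1) t0 by (intro exI[of _ e']) (auto simp: e'_def rival_iff)
    qed
    then have "AE t in lebesgue. t \<in> ival (ereal \<delta>) \<longrightarrow> C (x (s + t)) = z t" by eventually_elim auto
    then show ?thesis by (rule Lpw_le_cong_AE[OF p_pos(1) z(1)])
  qed
  define s where "s n = s1 / real (Suc (Suc n))" for n
  have s: "0 < s n" "s n < s1" for n
  proof -
    have "1 < real (Suc (Suc n))" by simp
    from mult_strict_left_mono[OF this \<delta>(2)] show "0 < s n" "s n < s1"
      using \<delta>(2) by (simp_all add: s_def divide_less_eq del: of_nat_Suc)
  qed
  have s_lim: "s \<longlonglongrightarrow> 0"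
  proof -
    have "(\<lambda>n. s1 * inverse (real (Suc (Suc n)))) \<longlonglongrightarrow> s1 * 0"
      by (intro tendsto_intros LIMSEQ_Suc[OF LIMSEQ_inverse_real_of_nat])
    then show ?thesis by (simp add: s_def[abs_def] divide_inverse)
  qed
  \<comment> \<open>For each \<open>s n\<close> the bound holds off a null set. A sequence of
    restart times gives a single null set, and as \<open>s n\<close> tends to 0 the weight (t - s
    n)^\<alpha> tends to t^\<alpha>.\<close>
  have "AE t in lebesgue. \<forall>n. t - s n \<in> ival (ereal \<delta>) \<longrightarrow> (t - s n) powr \<alpha> * norm (C (x t)) \<le> 2 * d"
    unfolding AE_all_countable
  proof
    fix n
    have "AE t in lebesgue. t \<in> ival (ereal \<delta>) \<longrightarrow> t powr \<alpha> * norm (C (x (s n + t))) \<le> 2 * d"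
      using main[OF s] True by (simp add: Lpw_le_infinity)
    from AE_lebesgue_translation[OF this, of "- s n"]
    show "AE t in lebesgue. t - s n \<in> ival (ereal \<delta>) \<longrightarrow> (t - s n) powr \<alpha> * norm (C (x t)) \<le> 2 * d" by simp
  qed
  then have "AE t in lebesgue. t \<in> ival (ereal \<delta>) \<longrightarrow> t powr \<alpha> * norm (C (x t)) \<le> \<kappa>"
  proof eventually_elim
    case (elim t)
    show ?case
    proof
      assume t: "t \<in> ival (ereal \<delta>)"
      have le: "(t - s n) powr \<alpha> * norm (C (x t)) \<le> 2 * d" if "0 < t - s n" for n
      proof -
        have "t - s n \<in> ival (ereal \<delta>)" using that t s(1)[of n] by (simp add: ival_iff)
        then show ?thesis using elim by blast
      qed
      have "(\<lambda>n. t - s n) \<longlonglongrightarrow> t - 0" by (intro tendsto_intros s_lim)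
      then have l: "(\<lambda>n. t - s n) \<longlonglongrightarrow> t" by simp
      then have "(\<lambda>n. (t - s n) powr \<alpha> * norm (C (x t))) \<longlonglongrightarrow> t powr \<alpha> * norm (C (x t))"
        using t by (intro tendsto_intros) (auto simp: ival_iff)
      moreover have "eventually (\<lambda>n. 0 < t - s n) sequentially" using order_tendstoD(1)[OF l, of 0] t by (simp add: ival_iff)
      then have "eventually (\<lambda>n. (t - s n) powr \<alpha> * norm (C (x t)) \<le> 2 * d) sequentially"
        by (rule eventually_mono) (rule le)
      ultimately have "t powr \<alpha> * norm (C (x t)) \<le> 2 * d" by (rule tendsto_upperbound) simp
      then show "t powr \<alpha> * norm (C (x t)) \<le> \<kappa>" using d(2) by simp
    qed
  qed
  moreover have "strongly_measurable_on (ival (ereal \<delta>)) (\<lambda>t. C (x t))"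
    by (rule Lpw_leD(1)[OF Lpw_le_restrict[OF p_pos(1) \<alpha>(1) y \<delta>\<eta>(2)]])
  ultimately have "Lpw_le p \<alpha> (ereal \<delta>) \<kappa> (\<lambda>t. C (x t))" using \<kappa> True by (simp add: Lpw_le_infinity)
  then show ?thesis using \<delta>(1) \<delta>\<eta>(2) by blast
qed

text \<open>The fixed point is only an output. The state is rebuilt as T(t)x_0 plus the continuous
  version of the convolution with input F(y, y), and its output is y again by \<open>mild_C\<close>.
  Conversely the output determines the state, as R is injective, so uniqueness is a matter of
  outputs.\<close>

lemma mild_solution_exists_unique:
  assumes x0: "x0 \<in> closure DA" and \<eta>: "0 < \<eta>" "\<eta> \<le> \<tau>"
    and a: "Lpw_le p \<alpha> \<eta> d (\<lambda>t. C (T t x0))" and d: "0 < d" "8 * M3 * K * d \<le> 1"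
  obtains x c where "mild \<eta> (\<lambda>t. F (C (x t)) (C (x t))) x0 x" "Lpw_le p \<alpha> \<eta> c (\<lambda>t. C (x t))"
    "AE t in lebesgue. t \<in> ival \<eta> \<longrightarrow> x t \<in> DC"
    "\<And>x' c' t. mild \<eta> (\<lambda>t. F (C (x' t)) (C (x' t))) x0 x' \<Longrightarrow> Lpw_le p \<alpha> \<eta> c' (\<lambda>t. C (x' t)) \<Longrightarrow>
      t \<in> rival \<eta> \<Longrightarrow> x' t = x t"
proof -
  obtain y where y: "Lpw_le p \<alpha> \<eta> (2 * d) y" "fixed_point \<eta> (\<lambda>t. C (T t x0)) y"
    using ex_fixed_point[OF a \<eta>(2) d(2)] by blast
  let ?u = "\<lambda>t. F (y t) (y t)"
  have u: "Lpw_le (p / 2) (2 * \<alpha>) \<eta> (K * (2 * d) * (2 * d)) ?u" by (rule Lpw_le_F[OF y(1) y(1)])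
  have small: "\<exists>r>0. ereal r \<le> \<eta> \<and> Lpw_le (p / 2) (2 * \<alpha>) (ereal r) e ?u" if e: "e > 0" for e
  proof -
    \<comment> \<open>Makes K (2d')^2 = e, the bound for the input when the fixed point has norm at
      most 2d'.\<close>
    define d' where "d' = sqrt (e / (4 * K))"
    have d': "0 < d'" "K * (2 * d') * (2 * d') = e" using e K by (auto simp: d'_def field_simps)
    obtain r where r: "0 < r" "ereal r \<le> \<eta>" "Lpw_le p \<alpha> (ereal r) d' (\<lambda>t. C (T t x0))"
      using CT_small[OF x0 \<eta> d'(1)] by blast
    have "Lpw_le p \<alpha> (ereal r) (2 * d') y" by (rule fixed_point_bound[OF y(2,1) r(3,2) \<eta>(2) d(2)])
    from Lpw_le_F[OF this this] show ?thesis using r d'(2) by auto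
  qed
  obtain v where v: "continuous_on (rival \<eta>) v" "\<And>t. t \<in> rival \<eta> \<Longrightarrow> v t \<in> closure DA"
    "\<And>t. t \<in> rival \<eta> \<Longrightarrow> R (v t) = conv ?u t" "v 0 = 0"
    by (rule conv_continuous[OF u \<eta>(2,1) small]) (assumption, rule that)
  define x where "x t = T t x0 + v t" for t
  have "mild \<eta> ?u x0 x"
    unfolding mild_def
  proof (intro conjI ballI)
    show "continuous_on (rival \<eta>) x"
      unfolding x_def by (intro continuous_intros T_continuous_on_rival x0 v(1))
    fix t assume t: "t \<in> rival \<eta>"
    show "x t \<in> closure DA" unfolding x_def
      using t by (intro closure_DA_add T_closure x0 v(2)) (auto simp: rival_iff)
    show "((\<lambda>s. T (t - s) (Bt (?u s))) has_integral R (x t - T t x0)) {0..t}"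
      using has_integral_conv[OF u, of t] t v(3)[OF t] by (simp add: x_def rival_iff)
  qed
  note x = this
  have ae: "AE t in lebesgue. t \<in> ival \<eta> \<longrightarrow> x t \<in> DC \<and> C (x t) = y t"
    using mild_C[OF x x0 u \<eta>(2)] y(2)[unfolded fixed_point_def] by eventually_elim auto
  have ae': "AE t in lebesgue. t \<in> ival \<eta> \<longrightarrow> C (x t) = y t" using ae by eventually_elim auto
  show thesis
  proof
    show "mild \<eta> (\<lambda>t. F (C (x t)) (C (x t))) x0 x"
      by (rule mild_cong_AE[OF x]) (use ae' in \<open>auto elim!: eventually_mono\<close>)
    show "Lpw_le p \<alpha> \<eta> (2 * d) (\<lambda>t. C (x t))" by (rule Lpw_le_cong_AE[OF p_pos(1) y(1) ae'])
    show "AE t in lebesgue. t \<in> ival \<eta> \<longrightarrow> x t \<in> DC" using ae by eventually_elim auto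
    fix x' c' t
    assume x': "mild \<eta> (\<lambda>t. F (C (x' t)) (C (x' t))) x0 x'" and y': "Lpw_le p \<alpha> \<eta> c' (\<lambda>t. C (x' t))"
      and t: "t \<in> rival \<eta>"
    have fp': "fixed_point \<eta> (\<lambda>t. C (T t x0)) (\<lambda>t. C (x' t))"
      using mild_C[OF x' x0 Lpw_le_F[OF y' y'] \<eta>(2)] by (auto simp: fixed_point_def elim!: eventually_mono)
    have "AE t in lebesgue. t \<in> ival \<eta> \<longrightarrow> y t = C (x' t)"
    proof (rule fixed_point_unique'[OF y(2) fp' \<eta>(2) y(1) d(2) y'])
      fix t0 assume t0: "t0 \<in> rival \<eta>"
      show "\<exists>e>0. ereal (t0 + e) \<le> \<eta> \<and> Lpw_le p \<alpha> (ereal e) (2 * d) (\<lambda>s. C (x' (t0 + s)))"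
      proof (cases "t0 = 0")
        case True
        then show ?thesis using mild_output_small[OF x' x0 y' \<eta>, of "2 * d"] d(1) by simp
      next
        case False
        then show ?thesis using Lpw_le_local_small[OF y' t0, of "2 * d"] t0 d(1) by (simp add: rival_iff)
      qed
    qed
    \<comment> \<open>Both states now belong to the same input, so their convolution parts agree
      under the injective R.\<close>
    then have "mild \<eta> (\<lambda>t. F (C (x' t)) (C (x' t))) x0 x"
      by (intro mild_cong_AE[OF x]) (auto elim!: eventually_mono)
    then have "R (x t - T t x0) = R (x' t - T t x0)"
      using mildD(3)[OF _ t] x' by metis
    then show "x' t = x t" using R_inj by force
  qed
qed

end

section \<open>Transfer between the stated problem and the abstract one\<close>

lemma Lpw_norm_nonneg:
  assumes "0 < \<eta>"
  shows "0 \<le> Lpw_norm p \<alpha> \<eta> f"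
proof (cases "p = \<infinity>")
  case True
  obtain b :: real where b: "0 < b" "ereal b < \<eta>"
    using assms ereal_dense2[of 0 \<eta>] by auto
  let ?M = "restrict_space lebesgue (ival \<eta>)"
  have "emeasure lebesgue {0<..<b} \<le> emeasure lebesgue (ival \<eta>)"
    by (rule emeasure_mono) (use b ivalI[of _ b \<eta>] in auto)
  then have "emeasure ?M (space ?M) \<noteq> 0"
    using b by (auto simp: space_restrict_space emeasure_restrict_space)
  \<comment> \<open>On a space of measure zero the essential supremum of a constant would be
    -\<infinity>; a nonempty interval excludes this.\<close>
  then have "0 = esssup ?M (\<lambda>t. 0 :: ereal)" by (rule esssup_const[symmetric])
  also have "\<dots> \<le> esssup ?M (\<lambda>t. ereal (t powr \<alpha> * norm (f t)))" by (rule esssup_mono) auto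
  finally show ?thesis using True by (simp add: Lpw_norm_def)
qed (simp add: Lpw_norm_def Let_def)

lemma in_Lpw_Lpw_le:
  assumes "in_Lpw p \<alpha> \<eta> f"
  obtains c where "Lpw_le p \<alpha> \<eta> c f"
proof -
  have "Lpw_norm p \<alpha> \<eta> f \<le> ereal (max 0 (real_of_ereal (Lpw_norm p \<alpha> \<eta> f)))"
    using assms by (cases "Lpw_norm p \<alpha> \<eta> f") (auto simp: in_Lpw_def)
  then have "Lpw_le p \<alpha> \<eta> (max 0 (real_of_ereal (Lpw_norm p \<alpha> \<eta> f))) f"
    using assms by (simp add: Lpw_le_def in_Lpw_def)
  then show thesis by (rule that)
qed

lemma Lpw_le_in_Lpw: "Lpw_le p \<alpha> \<eta> c f \<Longrightarrow> in_Lpw p \<alpha> \<eta> f"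
  by (auto simp: Lpw_le_def in_Lpw_def)

text \<open>The constants in the hypotheses come without a sign; replacing \<open>M\<close> by a
  larger nonnegative \<open>N\<close> is harmless since norms over nonempty intervals are
  nonnegative.\<close>

lemma Lpw_le_operator_bound:
  assumes u: "Lpw_le p \<alpha> \<eta> c u" and v: "in_Lpw q \<beta> \<eta> v" and le: "Lpw_norm q \<beta> \<eta> v \<le> ereal M * Lpw_norm p \<alpha> \<eta> u"
    and M: "M \<le> N" "0 \<le> N" and \<eta>: "0 < \<eta>"
  shows "Lpw_le q \<beta> \<eta> (N * c) v"
proof -
  note le
  also have "ereal M * Lpw_norm p \<alpha> \<eta> u \<le> ereal N * Lpw_norm p \<alpha> \<eta> u"
    using M Lpw_norm_nonneg[OF \<eta>] by (intro ereal_mult_right_mono) auto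
  also have "\<dots> \<le> ereal N * ereal c"
    using u M by (intro ereal_mult_left_mono) (auto simp: Lpw_le_def)
  finally show ?thesis using u v M by (simp add: Lpw_le_def in_Lpw_def)
qed

locale extrapolated = bounded_analytic DA A T
  for DA :: "'x::cbanach set" and A :: "'x \<Rightarrow> 'x" and T :: "real \<Rightarrow> 'x \<Rightarrow> 'x" +
  fixes J Am1 :: "'x \<Rightarrow> 'xm::cbanach" and B :: "'w::cbanach \<Rightarrow> 'xm"
  assumes extrap: "extrapolation_space DA A J Am1" and B: "bounded_clinear B"
begin

definition E where "E x = J x + Am1 x"

lemma E_bounded_linear: "bounded_linear E" and norm_E: "norm (E x) = norm x" and bij_E: "bij E"
proof -
  have J: "bounded_linear J" and Am1: "clinear Am1" and n: "\<And>x. norm (E x) = norm x" and s: "surj E"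
    using extrap by (auto simp: extrapolation_space_def E_def[abs_def] intro: bounded_clinear_imp_bounded_linear)
  show E: "bounded_linear E"
    by (rule bounded_linear_intro[where K=1])
       (use n Am1 linear_add[OF bounded_linear.linear[OF J]] linear_scale[OF bounded_linear.linear[OF J]]
        in \<open>auto simp: E_def clinear_def scaleR_add_right scaleC_of_real[symmetric] scaleC_add_right\<close>)
  show "norm (E x) = norm x" by (rule n)
  have "inj E"
  proof (rule injI)
    fix x y assume "E x = E y"
    then have "norm (E (x - y)) = 0" by (simp add: linear_diff[OF bounded_linear.linear[OF E]])
    then show "x = y" by (simp add: n)
  qed
  then show "bij E" using s by (simp add: bij_def)
qed

lemma E_inv [simp]: "E (inv E y) = y" "inv E (E x) = x"
  using bij_E by (simp_all add: bij_def surj_f_inv_f)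

lemma inv_E_bounded_linear: "bounded_linear (inv E)"
proof (rule bounded_linear_intro[where K=1])
  interpret E: bounded_linear E by (rule E_bounded_linear)
  have inj: "x = y" if "E x = E y" for x y using that bij_E by (simp add: bij_def inj_eq)
  show "inv E (x + y) = inv E x + inv E y" for x y by (rule inj) (simp add: E.add)
  show "inv E (r *\<^sub>R x) = r *\<^sub>R inv E x" for r x by (rule inj) (simp add: E.scaleR)
  show "norm (inv E y) \<le> norm y * 1" for y using norm_E[of "inv E y"] by simp
qed

lemma J_bounded_linear: "bounded_linear J"
  using extrap by (auto simp: extrapolation_space_def intro: bounded_clinear_imp_bounded_linear)

lemma J_eq: "J x = E (R x)"
proof -
  have "E (R x) = J (R x) + J (A (R x))"
    using extrap R_in_DA by (simp add: E_def extrapolation_space_def)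
  also have "\<dots> = J (R x + A (R x))" by (simp add: linear_add[OF bounded_linear.linear[OF J_bounded_linear]])
  finally show ?thesis by (simp add: R_right)
qed

definition Bt where "Bt w = inv E (B w)"

lemma Bt_bounded_linear: "bounded_linear Bt"
  unfolding Bt_def
  by (rule bounded_linear_compose[OF inv_E_bounded_linear bounded_clinear_imp_bounded_linear[OF B]])

lemma extrap_sg_eq: "extrap_sg J Am1 T t (B w) = E (T t (Bt w))"
  unfolding extrap_sg_def Let_def E_def[abs_def, symmetric] Bt_def ..

text \<open>For t > 0 the smoothing of the semigroup brings T_{-1}(t)Bw = E R S(t)Bt w = J S(t)Bt w
  into X, which gives CT_{-1}(t)B its meaning in [A3]. At t = 0 this may fail, so kernels are
  compared off the end point.\<close>

lemma inv_J_extrap_sg: "0 < t \<Longrightarrow> inv J (extrap_sg J Am1 T t (B w)) = S t (Bt w)"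
proof -
  assume t: "0 < t"
  have "inj J" using extrap by (simp add: extrapolation_space_def)
  moreover have "extrap_sg J Am1 T t (B w) = J (S t (Bt w))" by (simp add: extrap_sg_eq J_eq R_S t)
  ultimately show ?thesis by simp
qed

lemma has_integral_extrap_sg_iff:
  "((\<lambda>s. extrap_sg J Am1 T (t - s) (B (u s))) has_integral J x) {0..t} \<longleftrightarrow>
   ((\<lambda>s. T (t - s) (Bt (u s))) has_integral R x) {0..t}"
proof
  assume "((\<lambda>s. extrap_sg J Am1 T (t - s) (B (u s))) has_integral J x) {0..t}"
  from has_integral_linear[OF this inv_E_bounded_linear]
  show "((\<lambda>s. T (t - s) (Bt (u s))) has_integral R x) {0..t}" by (simp add: o_def extrap_sg_eq J_eq)
next
  assume "((\<lambda>s. T (t - s) (Bt (u s))) has_integral R x) {0..t}"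
  from has_integral_linear[OF this E_bounded_linear]
  show "((\<lambda>s. extrap_sg J Am1 T (t - s) (B (u s))) has_integral J x) {0..t}" by (simp add: o_def extrap_sg_eq J_eq)
qed

lemma bochner_integrable_extrap_sg:
  assumes "bochner_integrable_on (\<lambda>s. T (t - s) (Bt (u s))) {0..t}"
  shows "bochner_integrable_on (\<lambda>s. extrap_sg J Am1 T (t - s) (B (u s))) {0..t}"
proof -
  have "strongly_measurable_on {0..t} (\<lambda>s. E (T (t - s) (Bt (u s))))"
    by (rule strongly_measurable_on_compose[OF _ _ linear_continuous_on[OF E_bounded_linear]])
       (use assms in \<open>auto simp: bochner_integrable_on_def\<close>)
  then show ?thesis using assms by (simp add: bochner_integrable_on_def extrap_sg_eq norm_E)
qed

end

theorem theorem3p1: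
  fixes DA :: "'x::cbanach set" and A :: "'x \<Rightarrow> 'x" and T :: "real \<Rightarrow> 'x \<Rightarrow> 'x"
    and J :: "'x \<Rightarrow> 'xm::cbanach" and Am1 :: "'x \<Rightarrow> 'xm"
    and B :: "'w::cbanach \<Rightarrow> 'xm"
    and DC :: "'x set" and C :: "'x \<Rightarrow> 'z::cbanach"
    and F :: "'z \<Rightarrow> 'z \<Rightarrow> 'w" and K :: real
    and \<tau> :: ereal and p :: ereal and \<alpha> :: real
  assumes gen: "generates_bounded_analytic DA A T"
    and extrap: "extrapolation_space DA A J Am1"
    and B_bdd: "bounded_clinear B"
    and C_closed: "closed_op DC C"
    and C_X1: "DA \<subseteq> DC" "\<exists>M. \<forall>x\<in>DA. norm (C x) \<le> M * norm (x + A x)"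
    and F_bil: "K > 0" "bounded_cbilinear F K"
    and tau: "0 < \<tau>"
    and p: "2 < p"
    and alpha: "0 \<le> \<alpha>" "0 < ereal \<alpha> + inverse p" "ereal \<alpha> + inverse p < 1 / 2"
    and A1: "\<exists>M. \<forall>x. in_Lpw p \<alpha> \<tau> (\<lambda>t. C (T t x)) \<and>
                   Lpw_norm p \<alpha> \<tau> (\<lambda>t. C (T t x)) \<le> ereal (M * norm x)"
    and A2: "\<exists>M. \<forall>u :: real \<Rightarrow> 'w. in_Lpw (p / 2) (2 * \<alpha>) \<tau> u \<longrightarrow>
               (\<exists>v :: real \<Rightarrow> 'x. in_Lpw \<infinity> 0 \<tau> v \<and>
                  Lpw_norm \<infinity> 0 \<tau> v \<le> ereal M * Lpw_norm (p / 2) (2 * \<alpha>) \<tau> u \<and>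
                  (AE t in lebesgue. t \<in> ival \<tau> \<longrightarrow>
                     bochner_integrable_on (\<lambda>s. extrap_sg J Am1 T (t - s) (B (u s))) {0..t} \<and>
                     ((\<lambda>s. extrap_sg J Am1 T (t - s) (B (u s))) has_integral J (v t)) {0..t}))"
    and A3: "\<exists>M. \<forall>u :: real \<Rightarrow> 'w. in_Lpw (p / 2) (2 * \<alpha>) \<tau> u \<longrightarrow>
               (\<exists>v :: real \<Rightarrow> 'z. in_Lpw p \<alpha> \<tau> v \<and>
                  Lpw_norm p \<alpha> \<tau> v \<le> ereal M * Lpw_norm (p / 2) (2 * \<alpha>) \<tau> u \<and>
                  (AE t in lebesgue. t \<in> ival \<tau> \<longrightarrow>
                     bochner_integrable_on (\<lambda>s. C (inv J (extrap_sg J Am1 T (t - s) (B (u s))))) {0..t} \<and>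
                     ((\<lambda>s. C (inv J (extrap_sg J Am1 T (t - s) (B (u s))))) has_integral v t) {0..t}))"
  shows "(\<forall>x0\<in>closure DA. \<exists>\<eta>. 0 < \<eta> \<and> \<eta> \<le> \<tau> \<and>
            (\<exists>x. mild_solution DA T J Am1 B DC C F p \<alpha> x0 \<eta> x \<and>
                 (\<forall>x'. mild_solution DA T J Am1 B DC C F p \<alpha> x0 \<eta> x' \<longrightarrow> (\<forall>t\<in>rival \<eta>. x' t = x t))))
       \<and> (\<exists>\<delta>>0. \<forall>x0\<in>closure DA. norm x0 < \<delta> \<longrightarrow>
            (\<exists>x. mild_solution DA T J Am1 B DC C F p \<alpha> x0 \<tau> x \<and>
                 (\<forall>x'. mild_solution DA T J Am1 B DC C F p \<alpha> x0 \<tau> x' \<longrightarrow> (\<forall>t\<in>rival \<tau>. x' t = x t))))"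
proof -
  interpret ex: extrapolated DA A T J Am1 B
    by unfold_locales (fact gen extrap B_bdd)+
  obtain M0 where M0: "\<And>x. x \<in> DA \<Longrightarrow> norm (C x) \<le> M0 * norm (x + A x)" using C_X1(2) by blast
  obtain m1 where m1: "\<And>x. in_Lpw p \<alpha> \<tau> (\<lambda>t. C (T t x))"
    "\<And>x. Lpw_norm p \<alpha> \<tau> (\<lambda>t. C (T t x)) \<le> ereal (m1 * norm x)" using A1 by blast
  obtain m2 where m2: "\<And>u :: real \<Rightarrow> 'w. in_Lpw (p / 2) (2 * \<alpha>) \<tau> u \<Longrightarrow>
      \<exists>v :: real \<Rightarrow> 'x. in_Lpw \<infinity> 0 \<tau> v \<and>
        Lpw_norm \<infinity> 0 \<tau> v \<le> ereal m2 * Lpw_norm (p / 2) (2 * \<alpha>) \<tau> u \<and>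
        (AE t in lebesgue. t \<in> ival \<tau> \<longrightarrow>
           ((\<lambda>s. extrap_sg J Am1 T (t - s) (B (u s))) has_integral J (v t)) {0..t})"
    using A2 by (force elim!: eventually_mono)
  obtain m3 where m3: "\<And>u :: real \<Rightarrow> 'w. in_Lpw (p / 2) (2 * \<alpha>) \<tau> u \<Longrightarrow>
      \<exists>v :: real \<Rightarrow> 'z. in_Lpw p \<alpha> \<tau> v \<and>
        Lpw_norm p \<alpha> \<tau> v \<le> ereal m3 * Lpw_norm (p / 2) (2 * \<alpha>) \<tau> u \<and>
        (AE t in lebesgue. t \<in> ival \<tau> \<longrightarrow>
           ((\<lambda>s. C (inv J (extrap_sg J Am1 T (t - s) (B (u s))))) has_integral v t) {0..t})"
    using A3 by (force elim!: eventually_mono)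
  \<comment> \<open>Nonnegative versions of the constants; \<open>M3\<close> is at least 1 so that 8
    M3 K can be divided by.\<close>
  define M1 M2 M3 where "M1 = max m1 0" and "M2 = max m2 0" and "M3 = max m3 1"
  interpret ap: abstract_problem DA A T ex.Bt DC C F K \<tau> p \<alpha> M0 M1 M2 M3
  proof (intro abstract_problem.intro abstract_problem_axioms.intro)
    show "Lpw_le p \<alpha> \<tau> (M1 * norm x) (\<lambda>t. C (T t x))" for x
    proof -
      have "ereal (m1 * norm x) \<le> ereal (M1 * norm x)" by (simp add: M1_def mult_right_mono)
      then show ?thesis using m1[of x] order_trans by (fastforce simp: Lpw_le_def in_Lpw_def M1_def)
    qed
  next
    fix c and u :: "real \<Rightarrow> 'w" assume u: "Lpw_le (p / 2) (2 * \<alpha>) \<tau> c u"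
    obtain v :: "real \<Rightarrow> 'x" where v: "in_Lpw \<infinity> 0 \<tau> v"
      "Lpw_norm \<infinity> 0 \<tau> v \<le> ereal m2 * Lpw_norm (p / 2) (2 * \<alpha>) \<tau> u"
      "AE t in lebesgue. t \<in> ival \<tau> \<longrightarrow> ((\<lambda>s. extrap_sg J Am1 T (t - s) (B (u s))) has_integral J (v t)) {0..t}"
      using m2[OF Lpw_le_in_Lpw[OF u]] by blast
    have "Lpw_le \<infinity> 0 \<tau> (M2 * c) v"
      by (rule Lpw_le_operator_bound[OF u v(1,2) _ _ tau]) (auto simp: M2_def)
    then have "AE t in lebesgue. t \<in> ival \<tau> \<longrightarrow> t powr 0 * norm (v t) \<le> M2 * c"
      by (simp add: Lpw_le_infinity)
    with v(3) have "AE t in lebesgue. t \<in> ival \<tau> \<longrightarrow> norm (v t) \<le> M2 * c \<and>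
        ((\<lambda>s. T (t - s) (ex.Bt (u s))) has_integral ex.R (v t)) {0..t}"
      by eventually_elim (auto simp: ex.has_integral_extrap_sg_iff ival_iff)
    then show "\<exists>v. AE t in lebesgue. t \<in> ival \<tau> \<longrightarrow> norm (v t) \<le> M2 * c \<and>
        ((\<lambda>s. T (t - s) (ex.Bt (u s))) has_integral ex.R (v t)) {0..t}" by blast
  next
    fix c and u :: "real \<Rightarrow> 'w" assume u: "Lpw_le (p / 2) (2 * \<alpha>) \<tau> c u"
    obtain z :: "real \<Rightarrow> 'z" where z: "in_Lpw p \<alpha> \<tau> z"
      "Lpw_norm p \<alpha> \<tau> z \<le> ereal m3 * Lpw_norm (p / 2) (2 * \<alpha>) \<tau> u"
      "AE t in lebesgue. t \<in> ival \<tau> \<longrightarrow> ((\<lambda>s. C (inv J (extrap_sg J Am1 T (t - s) (B (u s))))) has_integral z t) {0..t}"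
      using m3[OF Lpw_le_in_Lpw[OF u]] by blast
    have "Lpw_le p \<alpha> \<tau> (M3 * c) z"
      by (rule Lpw_le_operator_bound[OF u z(1,2) _ _ tau]) (auto simp: M3_def)
    moreover have "AE t in lebesgue. t \<in> ival \<tau> \<longrightarrow>
        ((\<lambda>s. C (ex.S (t - s) (ex.Bt (u s)))) has_integral z t) {0..t}"
      using z(3)
    proof eventually_elim
      case (elim t)
      show ?case
      proof
        assume "t \<in> ival \<tau>"
        then have "((\<lambda>s. C (inv J (extrap_sg J Am1 T (t - s) (B (u s))))) has_integral z t) {0..t}"
          using elim by blast
        then show "((\<lambda>s. C (ex.S (t - s) (ex.Bt (u s)))) has_integral z t) {0..t}"
          by (rule has_integral_spike_finite[of "{t}", rotated 2]) (auto simp: ex.inv_J_extrap_sg)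
      qed
    qed
    ultimately show "\<exists>z. Lpw_le p \<alpha> \<tau> (M3 * c) z \<and> (AE t in lebesgue. t \<in> ival \<tau> \<longrightarrow>
        ((\<lambda>s. C (ex.S (t - s) (ex.Bt (u s)))) has_integral z t) {0..t})" by blast
  qed (use M0 C_closed C_X1(1) F_bil p alpha ex.Bt_bounded_linear ex.bounded_analytic_axioms in \<open>auto simp: M1_def M2_def M3_def\<close>)
  have J_diff: "J (x - y) = J x - J y" for x y
    by (rule linear_diff[OF bounded_linear.linear[OF ex.J_bounded_linear]])
  have abstract: "ap.mild \<eta> (\<lambda>t. F (C (x t)) (C (x t))) x0 x"
    if "mild_solution DA T J Am1 B DC C F p \<alpha> x0 \<eta> x" for x0 \<eta> x
    using that by (simp add: mild_solution_def ap.mild_def J_diff[symmetric] ex.has_integral_extrap_sg_iff)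
  have concrete: "mild_solution DA T J Am1 B DC C F p \<alpha> x0 \<eta> x"
    if m: "ap.mild \<eta> (\<lambda>t. F (C (x t)) (C (x t))) x0 x" and y: "Lpw_le p \<alpha> \<eta> c (\<lambda>t. C (x t))"
      and DC: "AE t in lebesgue. t \<in> ival \<eta> \<longrightarrow> x t \<in> DC" for x0 \<eta> x c
    unfolding mild_solution_def
  proof (intro conjI ballI)
    fix t assume t: "t \<in> rival \<eta>"
    show "bochner_integrable_on (\<lambda>s. extrap_sg J Am1 T (t - s) (B (F (C (x s)) (C (x s))))) {0..t}"
      using t by (intro ex.bochner_integrable_extrap_sg ap.bochner_integrable_conv[OF ap.Lpw_le_F[OF y y]])
        (auto simp: rival_iff)
    show "((\<lambda>s. extrap_sg J Am1 T (t - s) (B (F (C (x s)) (C (x s))))) has_integral J (x t) - J (T t x0)) {0..t}"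
      using m t by (simp add: J_diff[symmetric] ex.has_integral_extrap_sg_iff ap.mild_def)
  qed (use m DC Lpw_le_in_Lpw[OF y] in \<open>auto simp: ap.mild_def\<close>)
  \<comment> \<open>One statement for both claims: the local solution uses a short interval on which
    the free output has norm at most \<open>d\<close>, the global one all of (0, \<tau>) and a small
    initial value.\<close>
  have unique: "\<exists>x. mild_solution DA T J Am1 B DC C F p \<alpha> x0 \<eta> x \<and>
      (\<forall>x'. mild_solution DA T J Am1 B DC C F p \<alpha> x0 \<eta> x' \<longrightarrow> (\<forall>t\<in>rival \<eta>. x' t = x t))"
    if x0: "x0 \<in> closure DA" and \<eta>: "0 < \<eta>" "\<eta> \<le> \<tau>"
      and a: "Lpw_le p \<alpha> \<eta> d (\<lambda>t. C (T t x0))" and d: "0 < d" "8 * M3 * K * d \<le> 1" for x0 \<eta> d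
  proof -
    obtain x c where x: "ap.mild \<eta> (\<lambda>t. F (C (x t)) (C (x t))) x0 x" "Lpw_le p \<alpha> \<eta> c (\<lambda>t. C (x t))"
      "AE t in lebesgue. t \<in> ival \<eta> \<longrightarrow> x t \<in> DC"
      and u: "\<And>x' c' t. ap.mild \<eta> (\<lambda>t. F (C (x' t)) (C (x' t))) x0 x' \<Longrightarrow> Lpw_le p \<alpha> \<eta> c' (\<lambda>t. C (x' t)) \<Longrightarrow>
        t \<in> rival \<eta> \<Longrightarrow> x' t = x t"
      by (rule ap.mild_solution_exists_unique[OF x0 \<eta> a d]) (rule that)
    show ?thesis
    proof (intro exI[of _ x] conjI allI impI ballI)
      show "mild_solution DA T J Am1 B DC C F p \<alpha> x0 \<eta> x" by (rule concrete[OF x])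
      fix x' t assume x': "mild_solution DA T J Am1 B DC C F p \<alpha> x0 \<eta> x'" and t: "t \<in> rival \<eta>"
      obtain c' where "Lpw_le p \<alpha> \<eta> c' (\<lambda>t. C (x' t))"
        using x' in_Lpw_Lpw_le unfolding mild_solution_def by blast
      then show "x' t = x t" by (rule u[OF abstract[OF x'] _ t])
    qed
  qed
  define d where "d = 1 / (8 * M3 * K)"
  have d: "0 < d" "8 * M3 * K * d \<le> 1" using F_bil(1) ap.M3 by (auto simp: d_def)
  show ?thesis
  proof (intro conjI ballI)
    fix x0 assume x0: "x0 \<in> closure DA"
    obtain r where r: "0 < r" "ereal r \<le> \<tau>" "Lpw_le p \<alpha> (ereal r) d (\<lambda>t. C (T t x0))"
      using ap.CT_small[OF x0 tau order_refl d(1)] by blast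
    have "0 < ereal r" using r(1) by simp
    from unique[OF x0 this r(2,3) d] this r(2)
    show "\<exists>\<eta>. 0 < \<eta> \<and> \<eta> \<le> \<tau> \<and> (\<exists>x. mild_solution DA T J Am1 B DC C F p \<alpha> x0 \<eta> x \<and>
        (\<forall>x'. mild_solution DA T J Am1 B DC C F p \<alpha> x0 \<eta> x' \<longrightarrow> (\<forall>t\<in>rival \<eta>. x' t = x t)))" by blast
  next
    show "\<exists>\<delta>>0. \<forall>x0\<in>closure DA. norm x0 < \<delta> \<longrightarrow> (\<exists>x. mild_solution DA T J Am1 B DC C F p \<alpha> x0 \<tau> x \<and>
        (\<forall>x'. mild_solution DA T J Am1 B DC C F p \<alpha> x0 \<tau> x' \<longrightarrow> (\<forall>t\<in>rival \<tau>. x' t = x t)))"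
    \<comment> \<open>By [A1] the free output on (0, \<tau>) then has norm at most
      \<open>M1 * norm x0\<close>, which is at most \<open>d\<close>.\<close>
    proof (intro exI[of _ "d / (M1 + 1)"] conjI ballI impI)
      show "0 < d / (M1 + 1)" using d(1) ap.M1 by simp
      fix x0 assume x0: "x0 \<in> closure DA" and n: "norm x0 < d / (M1 + 1)"
      have "M1 * norm x0 \<le> (M1 + 1) * norm x0" by (intro mult_right_mono) auto
      also have "\<dots> \<le> d" using n ap.M1 by (simp add: pos_less_divide_eq mult.commute less_imp_le)
      finally have "Lpw_le p \<alpha> \<tau> d (\<lambda>t. C (T t x0))" by (rule Lpw_le_weaken[OF ap.A1])
      from unique[OF x0 tau order_refl this d]
      show "\<exists>x. mild_solution DA T J Am1 B DC C F p \<alpha> x0 \<tau> x \<and>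
        (\<forall>x'. mild_solution DA T J Am1 B DC C F p \<alpha> x0 \<tau> x' \<longrightarrow> (\<forall>t\<in>rival \<tau>. x' t = x t))" .
    qed
  qed
qed

end
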